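(* Let $(\Omega,d)$ be a metric space of finite diameter $D<+\infty$, let $U\subset\Omega$ and let $f:U\to\Omega$ be an unramified covering map of finite degree which is uniformly expanding, in the sense that there are $0<\rho<1$ and a finite index set $J$ such that for every couple $y,y'\in\Omega$ there is a pairing $\{(x_j,x_j'):j\in J\}$ of the pre-images $f^{-1}(y)=\{x_j\}_{j\in J}$ and $f^{-1}(y')=\{x_j'\}_{j\in J}$ for which $d(x_j,x_j')\le\rho\,d(y,y')$ for all $j\in J$. Let $X_{\mathbb C}$ be the Banach space of functions $\phi:\Omega\to\mathbb C$ with $\|\phi\|=|\phi|_0+\operatorname{Lip}(\phi)<+\infty$. Fix $g\in X_{\mathbb C}$ and define, for $\phi\in X_{\mathbb C}$, $$M_g\phi(y)=\sum_{x:\,f(x)=y}e^{g(x)}\phi(x),\qquad y\in\Omega .$$ Denote $a=\operatorname{Lip}(\operatorname{Re}g)$, $b=\operatorname{Lip}(\operatorname{Im}g)$ and $\theta=\operatorname{osc}(\operatorname{Im}g)$. Suppose that $$\left(\theta+\frac{2\rho^2Db}{1-\rho+\rho^2Da}\right)\exp\left(1+\rho\,\frac{1+\rho}{1-\rho}\,Da\right)\frac{4}{1-\rho}<1 .$$ Then $M_g\in L(X_{\mathbb C})$ has a spectral gap.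
   Context: For a function $\phi$ on $\Omega$: $\operatorname{Lip}(\phi)=\sup_{x\ne y}|\phi(x)-\phi(y)|/d(x,y)$ and $|\phi|_0=\sup_{x\in\Omega}|\phi(x)|$. For real-valued $k$, $\operatorname{osc}(k)=\sup k-\inf k$. The enumerations $\{x_j\}_{j\in J}$, $\{x'_j\}_{j\in J}$ list each pre-image exactly once. $L(X)$ denotes bounded linear operators on $X$. A bounded operator has a spectral gap if it has a simple isolated eigenvalue whose modulus equals the spectral radius $r_{\rm sp}$ and the remaining part of the spectrum is contained in a disk centered at $0$ of radius strictly smaller than $r_{\rm sp}$. *)

theory Defs
  imports "HOL-Analysis.Analysis"
begin

section \<open>Oscillation and Lipschitz constant\<close>

definition sup_norm :: "('a \<Rightarrow> 'b::real_normed_vector) \<Rightarrow> real" where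
  "sup_norm \<phi> = (SUP x. norm (\<phi> x))"

definition osc :: "('a \<Rightarrow> real) \<Rightarrow> real" where
  "osc k = (SUP x. k x) - (INF x. k x)"

text \<open>The pairs with \<open>x = y\<close> are included; they contribute \<open>0 / 0 = 0\<close>. This does not affect the
  supremum of the (nonnegative) quotients, and gives the value \<open>0\<close> on a one-point space.\<close>

definition lip_quot :: "('a::metric_space \<Rightarrow> 'b::real_normed_vector) \<Rightarrow> 'a \<times> 'a \<Rightarrow> real" where
  "lip_quot \<phi> = (\<lambda>(x, y). norm (\<phi> x - \<phi> y) / dist x y)"

definition Lip :: "('a::metric_space \<Rightarrow> 'b::real_normed_vector) \<Rightarrow> real" where
  "Lip \<phi> = (SUP p. lip_quot \<phi> p)"

lemma lip_quot_nonneg: "0 \<le> lip_quot \<phi> p"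
  by (simp add: lip_quot_def split: prod.split)

lemma lip_quot_add: "lip_quot (\<lambda>x. \<phi> x + \<psi> x) p \<le> lip_quot \<phi> p + lip_quot \<psi> p"
proof -
  obtain x y where p: "p = (x, y)" by (cases p)
  have "norm (\<phi> x + \<psi> x - (\<phi> y + \<psi> y)) \<le> norm (\<phi> x - \<phi> y) + norm (\<psi> x - \<psi> y)"
    by (metis add_diff_add norm_triangle_ineq)
  then have "norm (\<phi> x + \<psi> x - (\<phi> y + \<psi> y)) / dist x y
      \<le> (norm (\<phi> x - \<phi> y) + norm (\<psi> x - \<psi> y)) / dist x y"
    by (rule divide_right_mono) simp
  then show ?thesis
    by (simp add: p lip_quot_def add_divide_distrib)
qed

lemma lip_quot_mult:
  fixes \<phi> :: "'a::metric_space \<Rightarrow> complex"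
  shows "lip_quot (\<lambda>x. c * \<phi> x) p = norm c * lip_quot \<phi> p"
  by (simp add: lip_quot_def norm_mult flip: right_diff_distrib split: prod.split)

section \<open>Complex normed spaces\<close>

class complex_normed_vector = real_normed_vector +
  fixes scaleC :: "complex \<Rightarrow> 'a \<Rightarrow> 'a"  (infixr "*\<^sub>C" 75)
  assumes scaleC_add_right: "c *\<^sub>C (x + y) = c *\<^sub>C x + c *\<^sub>C y"
    and scaleC_add_left: "(c + c') *\<^sub>C x = c *\<^sub>C x + c' *\<^sub>C x"
    and scaleC_scaleC: "c *\<^sub>C c' *\<^sub>C x = (c * c') *\<^sub>C x"
    and scaleC_one: "1 *\<^sub>C x = x"
    and scaleC_of_real: "complex_of_real r *\<^sub>C x = r *\<^sub>R x"
    and norm_scaleC: "norm (c *\<^sub>C x) = norm c * norm x"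

class complex_banach = complex_normed_vector + banach

section \<open>The Banach space of bounded Lipschitz functions\<close>

typedef (overloaded) 'a lip_fun =
  "{\<phi> :: 'a::metric_space \<Rightarrow> complex.
      bdd_above (range (\<lambda>x. norm (\<phi> x))) \<and> bdd_above (range (lip_quot \<phi>))}"
  morphisms apply_lip Abs_lip
proof -
  have "lip_quot (\<lambda>x::'a. 0::complex) = (\<lambda>p. 0)"
    by (auto simp: lip_quot_def)
  then show ?thesis
    by (intro exI[of _ "\<lambda>x. 0"]) simp
qed

setup_lifting type_definition_lip_fun

lemma lip_fun_eqI: "(\<And>x. apply_lip \<phi> x = apply_lip \<psi> x) \<Longrightarrow> \<phi> = \<psi>"
  by transfer auto

lemma bdd_above_apply_lip:
  "bdd_above (range (\<lambda>x. norm (apply_lip \<phi> x)))"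
  "bdd_above (range (lip_quot (apply_lip \<phi>)))"
  using apply_lip[of \<phi>] by auto

lemma lip_fun_closed_add:
  fixes \<phi> \<psi> :: "'a::metric_space \<Rightarrow> complex"
  assumes "bdd_above (range (\<lambda>x. norm (\<phi> x))) \<and> bdd_above (range (lip_quot \<phi>))"
    and "bdd_above (range (\<lambda>x. norm (\<psi> x))) \<and> bdd_above (range (lip_quot \<psi>))"
  shows "bdd_above (range (\<lambda>x. norm (\<phi> x + \<psi> x))) \<and> bdd_above (range (lip_quot (\<lambda>x. \<phi> x + \<psi> x)))"
proof -
  from assms obtain A B C D where
    bounds: "\<And>x. norm (\<phi> x) \<le> A" "\<And>p. lip_quot \<phi> p \<le> B"
      "\<And>x. norm (\<psi> x) \<le> C" "\<And>p. lip_quot \<psi> p \<le> D"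
    unfolding bdd_above_def by auto
  have "norm (\<phi> x + \<psi> x) \<le> A + C" for x
    by (rule norm_triangle_le[OF add_mono[OF bounds(1,3)]])
  moreover have "lip_quot (\<lambda>x. \<phi> x + \<psi> x) p \<le> B + D" for p
    by (rule order_trans[OF lip_quot_add add_mono[OF bounds(2,4)]])
  ultimately show ?thesis
    unfolding bdd_above_def by blast
qed

lemma lip_fun_closed_mult:
  fixes \<phi> :: "'a::metric_space \<Rightarrow> complex"
  assumes "bdd_above (range (\<lambda>x. norm (\<phi> x))) \<and> bdd_above (range (lip_quot \<phi>))"
  shows "bdd_above (range (\<lambda>x. norm (c * \<phi> x))) \<and> bdd_above (range (lip_quot (\<lambda>x. c * \<phi> x)))"
proof -
  from assms obtain A B where "\<And>x. norm (\<phi> x) \<le> A" "\<And>p. lip_quot \<phi> p \<le> B"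
    unfolding bdd_above_def by auto
  then have "\<And>x. norm (c * \<phi> x) \<le> norm c * A" "\<And>p. lip_quot (\<lambda>x. c * \<phi> x) p \<le> norm c * B"
    by (simp_all add: norm_mult lip_quot_mult mult_left_mono)
  then show ?thesis
    unfolding bdd_above_def by blast
qed

instantiation lip_fun :: (metric_space) real_vector
begin

lift_definition zero_lip_fun :: "'a lip_fun" is "\<lambda>_. 0"
proof -
  have "lip_quot (\<lambda>x::'a. 0::complex) = (\<lambda>p. 0)"
    by (auto simp: lip_quot_def)
  then show "bdd_above (range (\<lambda>x::'a. norm (0::complex))) \<and>
      bdd_above (range (lip_quot (\<lambda>x::'a. 0::complex)))"
    by simp
qed

lift_definition plus_lip_fun :: "'a lip_fun \<Rightarrow> 'a lip_fun \<Rightarrow> 'a lip_fun" is "\<lambda>\<phi> \<psi> x. \<phi> x + \<psi> x"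
  by (rule lip_fun_closed_add)

lift_definition uminus_lip_fun :: "'a lip_fun \<Rightarrow> 'a lip_fun" is "\<lambda>\<phi> x. - \<phi> x"
  subgoal for \<phi>
    using lip_fun_closed_mult[of \<phi> "- 1"] by simp
  done

lift_definition minus_lip_fun :: "'a lip_fun \<Rightarrow> 'a lip_fun \<Rightarrow> 'a lip_fun" is "\<lambda>\<phi> \<psi> x. \<phi> x - \<psi> x"
  subgoal for \<phi> \<psi>
    using lip_fun_closed_add[of \<phi> "\<lambda>x. - 1 * \<psi> x"] lip_fun_closed_mult[of \<psi> "- 1"] by simp
  done

lift_definition scaleR_lip_fun :: "real \<Rightarrow> 'a lip_fun \<Rightarrow> 'a lip_fun" is "\<lambda>r \<phi> x. r *\<^sub>R \<phi> x"
  unfolding scaleR_conv_of_real by (rule lip_fun_closed_mult)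

instance
proof
  fix \<phi> \<psi> \<xi> :: "'a lip_fun" and r s :: real
  show "\<phi> + \<psi> + \<xi> = \<phi> + (\<psi> + \<xi>)" "\<phi> + \<psi> = \<psi> + \<phi>" "0 + \<phi> = \<phi>" "- \<phi> + \<phi> = 0" "\<phi> - \<psi> = \<phi> + - \<psi>"
    by (transfer, simp add: add_ac)+
  show "r *\<^sub>R (\<phi> + \<psi>) = r *\<^sub>R \<phi> + r *\<^sub>R \<psi>" "(r + s) *\<^sub>R \<phi> = r *\<^sub>R \<phi> + s *\<^sub>R \<phi>"
    "r *\<^sub>R s *\<^sub>R \<phi> = (r * s) *\<^sub>R \<phi>" "1 *\<^sub>R \<phi> = \<phi>"
    by (transfer, simp add: algebra_simps)+
qed

end

instantiation lip_fun :: (metric_space) complex_normed_vector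
begin

lift_definition scaleC_lip_fun :: "complex \<Rightarrow> 'a lip_fun \<Rightarrow> 'a lip_fun" is "\<lambda>c \<phi> x. c * \<phi> x"
  by (rule lip_fun_closed_mult)

definition norm_lip_fun :: "'a lip_fun \<Rightarrow> real"
  where "norm_lip_fun \<phi> = sup_norm (apply_lip \<phi>) + Lip (apply_lip \<phi>)"

definition dist_lip_fun :: "'a lip_fun \<Rightarrow> 'a lip_fun \<Rightarrow> real"
  where "dist_lip_fun \<phi> \<psi> = norm (\<phi> - \<psi>)"

definition sgn_lip_fun :: "'a lip_fun \<Rightarrow> 'a lip_fun"
  where "sgn_lip_fun \<phi> = \<phi> /\<^sub>R norm \<phi>"

definition uniformity_lip_fun :: "('a lip_fun \<times> 'a lip_fun) filter"
  where "uniformity_lip_fun = (INF e\<in>{0 <..}. principal {(x, y). dist x y < e})"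

definition open_lip_fun :: "'a lip_fun set \<Rightarrow> bool"
  where "open_lip_fun S = (\<forall>x\<in>S. \<forall>\<^sub>F (x', y) in uniformity. x' = x \<longrightarrow> y \<in> S)"

instance
proof
  fix \<phi> \<psi> \<xi> :: "'a lip_fun" and r s :: real and c c' :: complex
  note bdd = bdd_above_apply_lip
  have sup_le: "norm (apply_lip \<phi> x) \<le> sup_norm (apply_lip \<phi>)" for \<phi> :: "'a lip_fun" and x
    unfolding sup_norm_def by (rule cSUP_upper[OF _ bdd(1)]) simp
  have lip_le: "lip_quot (apply_lip \<phi>) p \<le> Lip (apply_lip \<phi>)" for \<phi> :: "'a lip_fun" and p
    unfolding Lip_def by (rule cSUP_upper[OF _ bdd(2)]) simp
  have sup_nn: "0 \<le> sup_norm (apply_lip \<phi>)" for \<phi> :: "'a lip_fun"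
    by (rule order_trans[OF norm_ge_zero sup_le])
  have lip_nn: "0 \<le> Lip (apply_lip \<phi>)" for \<phi> :: "'a lip_fun"
    by (rule order_trans[OF lip_quot_nonneg lip_le])
  have norm_le: "norm (c *\<^sub>C \<phi>) \<le> norm c * norm \<phi>" for c and \<phi> :: "'a lip_fun"
  proof -
    have "sup_norm (apply_lip (c *\<^sub>C \<phi>)) \<le> norm c * sup_norm (apply_lip \<phi>)"
      unfolding sup_norm_def[of "apply_lip (c *\<^sub>C \<phi>)"]
      by (rule cSUP_least) (simp_all add: scaleC_lip_fun.rep_eq norm_mult mult_left_mono sup_le)
    moreover have "Lip (apply_lip (c *\<^sub>C \<phi>)) \<le> norm c * Lip (apply_lip \<phi>)"
      unfolding Lip_def[of "apply_lip (c *\<^sub>C \<phi>)"]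
      by (rule cSUP_least) (simp_all add: scaleC_lip_fun.rep_eq lip_quot_mult mult_left_mono lip_le)
    ultimately show ?thesis
      by (simp add: norm_lip_fun_def distrib_left)
  qed
  have of_real: "complex_of_real r *\<^sub>C \<phi> = r *\<^sub>R \<phi>" for r and \<phi> :: "'a lip_fun"
    by transfer (simp add: scaleR_conv_of_real)
  have scale2: "c *\<^sub>C c' *\<^sub>C \<phi> = (c * c') *\<^sub>C \<phi>" for c c' and \<phi> :: "'a lip_fun"
    by transfer (simp add: mult.assoc)
  have one: "1 *\<^sub>C \<phi> = \<phi>" for \<phi> :: "'a lip_fun"
    by transfer simp
  have norm_eq: "norm (c *\<^sub>C \<phi>) = norm c * norm \<phi>" for c and \<phi> :: "'a lip_fun"
  proof (cases "c = 0")
    case True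
    then show ?thesis
      using norm_le[of 0 \<phi>] sup_nn[of "c *\<^sub>C \<phi>"] lip_nn[of "c *\<^sub>C \<phi>"] by (simp add: norm_lip_fun_def)
  next
    case False
    then have "inverse c *\<^sub>C c *\<^sub>C \<phi> = \<phi>"
      by (simp add: scale2 one)
    then have "norm \<phi> \<le> norm (inverse c) * norm (c *\<^sub>C \<phi>)"
      using norm_le[of "inverse c" "c *\<^sub>C \<phi>"] by simp
    then have "norm c * norm \<phi> \<le> norm (c *\<^sub>C \<phi>)"
      using False unfolding norm_inverse by (simp add: divide_simps mult.commute)
    then show ?thesis
      using norm_le[of c \<phi>] by simp
  qed
  show "dist \<phi> \<psi> = norm (\<phi> - \<psi>)"
    by (rule dist_lip_fun_def)
  show "sgn \<phi> = \<phi> /\<^sub>R norm \<phi>"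
    by (rule sgn_lip_fun_def)
  show "(uniformity :: ('a lip_fun \<times> 'a lip_fun) filter)
      = (INF e\<in>{0 <..}. principal {(x, y). dist x y < e})"
    by (rule uniformity_lip_fun_def)
  show "open S = (\<forall>x\<in>S. \<forall>\<^sub>F (x', y) in uniformity. x' = x \<longrightarrow> y \<in> S)" for S :: "'a lip_fun set"
    by (rule open_lip_fun_def)
  show "norm \<phi> = 0 \<longleftrightarrow> \<phi> = 0"
  proof
    assume "norm \<phi> = 0"
    then have "sup_norm (apply_lip \<phi>) \<le> 0"
      using sup_nn[of \<phi>] lip_nn[of \<phi>] by (simp add: norm_lip_fun_def)
    then have "norm (apply_lip \<phi> x) \<le> 0" for x
      by (rule order_trans[OF sup_le])
    then have "apply_lip \<phi> x = 0" for x
      by (simp only: norm_le_zero_iff)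
    then show "\<phi> = 0"
      by (intro lip_fun_eqI) (simp add: zero_lip_fun.rep_eq)
  next
    assume "\<phi> = 0"
    then have "0 *\<^sub>C \<phi> = \<phi>"
      by transfer simp
    then show "norm \<phi> = 0"
      using norm_eq[of 0 \<phi>] by simp
  qed
  show "norm (\<phi> + \<psi>) \<le> norm \<phi> + norm \<psi>"
  proof -
    have "sup_norm (apply_lip (\<phi> + \<psi>)) \<le> sup_norm (apply_lip \<phi>) + sup_norm (apply_lip \<psi>)"
      unfolding sup_norm_def[of "apply_lip (\<phi> + \<psi>)"]
      unfolding plus_lip_fun.rep_eq
      by (rule cSUP_least) (auto intro: norm_triangle_le add_mono sup_le)
    moreover have "Lip (apply_lip (\<phi> + \<psi>)) \<le> Lip (apply_lip \<phi>) + Lip (apply_lip \<psi>)"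
      unfolding Lip_def[of "apply_lip (\<phi> + \<psi>)"]
      unfolding plus_lip_fun.rep_eq
      by (rule cSUP_least) (auto intro: order_trans[OF lip_quot_add] add_mono lip_le)
    ultimately show ?thesis
      by (simp add: norm_lip_fun_def)
  qed
  show "norm (r *\<^sub>R \<phi>) = \<bar>r\<bar> * norm \<phi>"
    using norm_eq[of "complex_of_real r" \<phi>] by (simp add: of_real)
  show "c *\<^sub>C (\<phi> + \<psi>) = c *\<^sub>C \<phi> + c *\<^sub>C \<psi>" "(c + c') *\<^sub>C \<phi> = c *\<^sub>C \<phi> + c' *\<^sub>C \<phi>"
    by (transfer, simp add: algebra_simps)+
  show "c *\<^sub>C c' *\<^sub>C \<phi> = (c * c') *\<^sub>C \<phi>" "1 *\<^sub>C \<phi> = \<phi>" "complex_of_real r *\<^sub>C \<phi> = r *\<^sub>R \<phi>"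
    "norm (c *\<^sub>C \<phi>) = norm c * norm \<phi>"
    by (rule scale2 one of_real norm_eq)+
qed

end

lemma norm_apply_lip_le: "norm (apply_lip \<phi> x) \<le> norm \<phi>"
  and lip_quot_apply_lip_le: "lip_quot (apply_lip \<phi>) p \<le> norm \<phi>"
proof -
  have s: "norm (apply_lip \<phi> x) \<le> sup_norm (apply_lip \<phi>)" for x
    unfolding sup_norm_def by (rule cSUP_upper[OF _ bdd_above_apply_lip(1)]) simp
  have l: "lip_quot (apply_lip \<phi>) p \<le> Lip (apply_lip \<phi>)" for p
    unfolding Lip_def by (rule cSUP_upper[OF _ bdd_above_apply_lip(2)]) simp
  have "0 \<le> sup_norm (apply_lip \<phi>)" "0 \<le> Lip (apply_lip \<phi>)"
    using order_trans[OF norm_ge_zero s] order_trans[OF lip_quot_nonneg l] by blast+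
  then show "norm (apply_lip \<phi> x) \<le> norm \<phi>" "lip_quot (apply_lip \<phi>) p \<le> norm \<phi>"
    using s[of x] l[of p] by (simp_all add: norm_lip_fun_def)
qed

instance lip_fun :: (metric_space) complex_banach
proof
  fix X :: "nat \<Rightarrow> 'a lip_fun"
  assume "Cauchy X"
  have apply_diff: "apply_lip (\<phi> - \<psi>) x = apply_lip \<phi> x - apply_lip \<psi> x"
    for \<phi> \<psi> :: "'a lip_fun" and x
    by (simp add: minus_lip_fun.rep_eq)
  have "Cauchy (\<lambda>n. apply_lip (X n) x)" for x
  proof (rule metric_CauchyI)
    fix e :: real assume "0 < e"
    then obtain N where N: "\<And>m n. m \<ge> N \<Longrightarrow> n \<ge> N \<Longrightarrow> norm (X m - X n) < e"
      using CauchyD[OF \<open>Cauchy X\<close>] by blast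
    have "dist (apply_lip (X m) x) (apply_lip (X n) x) < e" if "m \<ge> N" "n \<ge> N" for m n
      using norm_apply_lip_le[of "X m - X n" x] N[OF that] by (simp add: apply_diff dist_norm)
    then show "\<exists>N. \<forall>m\<ge>N. \<forall>n\<ge>N. dist (apply_lip (X m) x) (apply_lip (X n) x) < e"
      by blast
  qed
  then have "\<exists>l. (\<lambda>n. apply_lip (X n) x) \<longlonglongrightarrow> l" for x
    by (simp add: Cauchy_convergent_iff convergent_def)
  then obtain L where L: "\<And>x. (\<lambda>n. apply_lip (X n) x) \<longlonglongrightarrow> L x"
    by metis
  have lq: "(\<lambda>n. lip_quot (\<lambda>x. apply_lip (X n) x - \<psi> x) p) \<longlonglongrightarrow> lip_quot (\<lambda>x. L x - \<psi> x) p"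
    for \<psi> p
    unfolding lip_quot_def divide_inverse case_prod_beta
    by (intro tendsto_intros L)
  obtain K where K: "\<And>n. norm (X n) \<le> K"
    using Cauchy_Bseq[OF \<open>Cauchy X\<close>] by (auto simp: Bseq_def)
  have "norm (L x) \<le> K" for x
    by (rule LIMSEQ_le_const2[OF tendsto_norm[OF L]])
      (auto intro: order_trans[OF norm_apply_lip_le K])
  moreover have "lip_quot L p \<le> K" for p
    by (rule LIMSEQ_le_const2[OF lq[of "\<lambda>_. 0" p, simplified]])
      (auto intro: order_trans[OF lip_quot_apply_lip_le K])
  ultimately have Lmem: "L \<in> {\<phi>. bdd_above (range (\<lambda>x. norm (\<phi> x))) \<and> bdd_above (range (lip_quot \<phi>))}"
    unfolding bdd_above_def by blast
  then have AL: "apply_lip (Abs_lip L) = L"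
    by (rule Abs_lip_inverse)
  have "X \<longlonglongrightarrow> Abs_lip L"
  proof (rule LIMSEQ_I)
    fix e :: real assume "0 < e"
    then obtain N where N: "\<And>m n. m \<ge> N \<Longrightarrow> n \<ge> N \<Longrightarrow> norm (X m - X n) < e / 3"
      using CauchyD[OF \<open>Cauchy X\<close>, of "e / 3"] by auto
    have "norm (X n - Abs_lip L) < e" if "n \<ge> N" for n
    proof -
      have "norm (L x - apply_lip (X n) x) \<le> e / 3" for x
      proof (rule LIMSEQ_le_const2)
        show "(\<lambda>m. norm (apply_lip (X m) x - apply_lip (X n) x)) \<longlonglongrightarrow> norm (L x - apply_lip (X n) x)"
          by (intro tendsto_intros L)
        show "\<exists>M. \<forall>m\<ge>M. norm (apply_lip (X m) x - apply_lip (X n) x) \<le> e / 3"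
          unfolding apply_diff[symmetric]
          using order_trans[OF norm_apply_lip_le less_imp_le[OF N[OF _ that]]] by blast
      qed
      then have 1: "sup_norm (apply_lip (Abs_lip L - X n)) \<le> e / 3"
        unfolding sup_norm_def apply_diff AL by (intro cSUP_least) auto
      have diff_fun: "apply_lip (\<phi> - \<psi>) = (\<lambda>x. apply_lip \<phi> x - apply_lip \<psi> x)"
        for \<phi> \<psi> :: "'a lip_fun"
        by (rule ext) (rule apply_diff)
      have "lip_quot (\<lambda>x. L x - apply_lip (X n) x) p \<le> e / 3" for p
      proof (rule LIMSEQ_le_const2[OF lq])
        show "\<exists>M. \<forall>m\<ge>M. lip_quot (\<lambda>x. apply_lip (X m) x - apply_lip (X n) x) p \<le> e / 3"
          unfolding diff_fun[symmetric]
          using order_trans[OF lip_quot_apply_lip_le less_imp_le[OF N[OF _ that]]] by blast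
      qed
      then have 2: "Lip (apply_lip (Abs_lip L - X n)) \<le> e / 3"
        unfolding Lip_def diff_fun AL by (intro cSUP_least) auto
      have "norm (Abs_lip L - X n) \<le> e / 3 + e / 3"
        using 1 2 by (simp add: norm_lip_fun_def)
      then show ?thesis
        using \<open>0 < e\<close> by (simp add: norm_minus_commute)
    qed
    then show "\<exists>N. \<forall>n\<ge>N. norm (X n - Abs_lip L) < e"
      by blast
  qed
  then show "convergent X"
    by (auto simp: convergent_def)
qed

section \<open>Spectral gap\<close>

definition bounded_clinear :: "('x::complex_normed_vector \<Rightarrow> 'y::complex_normed_vector) \<Rightarrow> bool" where
  "bounded_clinear A \<longleftrightarrow> bounded_linear A \<and> (\<forall>c v. A (c *\<^sub>C v) = c *\<^sub>C A v)"

definition is_resolvent ::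
    "('x::complex_normed_vector \<Rightarrow> 'x) \<Rightarrow> complex \<Rightarrow> ('x \<Rightarrow> 'x) \<Rightarrow> bool" where
  "is_resolvent A z R \<longleftrightarrow> bounded_clinear R \<and>
     (\<forall>v. R (z *\<^sub>C v - A v) = v) \<and> (\<forall>v. z *\<^sub>C R v - A (R v) = v)"

definition spectrum :: "('x::complex_normed_vector \<Rightarrow> 'x) \<Rightarrow> complex set" where
  "spectrum A = {z. \<not> (\<exists>R. is_resolvent A z R)}"

definition resolvent :: "('x::complex_normed_vector \<Rightarrow> 'x) \<Rightarrow> complex \<Rightarrow> 'x \<Rightarrow> 'x" where
  "resolvent A z = (THE R. is_resolvent A z R)"

text \<open>Only meaningful for a bounded operator on a nonzero Banach space, where the spectrum is
  nonempty and bounded.\<close>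

definition spectral_radius :: "('x::complex_normed_vector \<Rightarrow> 'x) \<Rightarrow> real" where
  "spectral_radius A = (SUP z\<in>spectrum A. norm z)"

definition is_eigenvalue :: "('x::complex_normed_vector \<Rightarrow> 'x) \<Rightarrow> complex \<Rightarrow> bool" where
  "is_eigenvalue A \<mu> \<longleftrightarrow> (\<exists>v. v \<noteq> 0 \<and> A v = \<mu> *\<^sub>C v)"

text \<open>The Riesz projection \<open>v \<mapsto> 1/(2\<pi>\<i>) \<ointegral> (z - A)\<^sup>-\<^sup>1 v dz\<close> over the positively oriented circle
  \<open>|z - \<mu>| = r\<close>, parametrised by \<open>z = \<mu> + r e\<^sup>i\<^sup>t\<close>, so that \<open>dz = \<i> r e\<^sup>i\<^sup>t dt\<close>.\<close>

definition riesz_projection ::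
    "('x::complex_banach \<Rightarrow> 'x) \<Rightarrow> complex \<Rightarrow> real \<Rightarrow> 'x \<Rightarrow> 'x" where
  "riesz_projection A \<mu> r v =
     (1 / (2 * pi)) *\<^sub>R
       integral {0..2 * pi} (\<lambda>t. (r * cis t) *\<^sub>C resolvent A (\<mu> + r * cis t) v)"

text \<open>An isolated point of the spectrum is a simple eigenvalue if its algebraic multiplicity, the
  complex dimension of the range of the Riesz projection, is one. The projection does not depend
  on the circle, as long as the disk contains no other point of the spectrum.\<close>

definition simple_isolated_eigenvalue :: "('x::complex_banach \<Rightarrow> 'x) \<Rightarrow> complex \<Rightarrow> bool" where
  "simple_isolated_eigenvalue A \<mu> \<longleftrightarrow> is_eigenvalue A \<mu> \<and>
     (\<exists>r>0. spectrum A \<inter> cball \<mu> r = {\<mu>} \<and>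
       (\<exists>h. h \<noteq> 0 \<and> range (riesz_projection A \<mu> r) = range (\<lambda>c. c *\<^sub>C h)))"

definition has_spectral_gap :: "('x::complex_banach \<Rightarrow> 'x) \<Rightarrow> bool" where
  "has_spectral_gap A \<longleftrightarrow> bounded_clinear A \<and>
     (\<exists>\<mu>. simple_isolated_eigenvalue A \<mu> \<and> norm \<mu> = spectral_radius A \<and>
       (\<exists>r. 0 \<le> r \<and> r < spectral_radius A \<and> spectrum A - {\<mu>} \<subseteq> cball 0 r))"

section \<open>Expanding coverings and transfer operators\<close>

text \<open>The metric space \<open>\<Omega>\<close> is the whole type, and \<open>f\<close> is relevant on \<open>U\<close> only.\<close>

definition preimages :: "'a set \<Rightarrow> ('a \<Rightarrow> 'a) \<Rightarrow> 'a \<Rightarrow> 'a set" where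
  "preimages U f y = {x \<in> U. f x = y}"

definition finite_degree_covering :: "'a::metric_space set \<Rightarrow> ('a \<Rightarrow> 'a) \<Rightarrow> bool" where
  "finite_degree_covering U f \<longleftrightarrow> covering_space U f UNIV \<and>
     (\<exists>n. \<forall>y. finite (preimages U f y) \<and> card (preimages U f y) = n)"

definition expanding_pairing ::
    "'a::metric_space set \<Rightarrow> ('a \<Rightarrow> 'a) \<Rightarrow> 'j set \<Rightarrow> real \<Rightarrow> bool" where
  "expanding_pairing U f J \<rho> \<longleftrightarrow>
     (\<forall>y y'. \<exists>x x'. bij_betw x J (preimages U f y) \<and> bij_betw x' J (preimages U f y') \<and>
        (\<forall>j\<in>J. dist (x j) (x' j) \<le> \<rho> * dist y y'))"

definition transfer ::
    "'a set \<Rightarrow> ('a \<Rightarrow> 'a) \<Rightarrow> ('a \<Rightarrow> complex) \<Rightarrow> ('a \<Rightarrow> complex) \<Rightarrow> 'a \<Rightarrow> complex" where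
  "transfer U f g \<phi> y = (\<Sum>x\<in>preimages U f y. exp (g x) * \<phi> x)"

end

(*
Write M = M_g and let L be the transfer operator of the real weight exp (Re g). Let K_s be the cone of
functions u >= 0 with u x <= exp (s d(x,y)) u y. For suitable tau < sigma, L maps K_sigma into K_tau, which
has finite projective diameter in K_sigma. The functionals l defining K_sigma (evaluations and
u |-> exp (sigma d(x,y)) u x - u y) also define a complex cone: all phi for which the values l phi pairwise
enclose an angle of at most pi/2. Up to a constant phase its elements are u + i v with u, v in K_sigma, and
|l (M u) - l (L u)| <= gamma l (L u) up to a constant phase; the gap condition makes gamma so small compared
with the diameter that M maps the complex cone well inside itself.

Such an M contracts. Suppose z h - v lies in the complex cone for all z outside a disk of radius R. Then
z M h - M v lies in it for all z outside some disk of radius eta R, with eta < 1 independent of h, v and R: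
either all ratios l (M v) / l (M h) stay away from the boundary circle, and the same disk can be shrunk, or
one of them is close to it, and then comparability within the image forces all of them to be close to one
another. Iterating, M^n v approaches the line of M^n h exponentially fast relative to |M^n h|. This yields an
eigenvector k and an invariant functional nu such that M^n (v - nu(v) k) decays faster than |mu|^n, so the
resolvent is nu(v) k / (z - mu) plus a Neumann series which is holomorphic near mu.
*)
theory Submission
  imports Defs "HOL-Complex_Analysis.Cauchy_Integral_Theorem"
begin

section \<open>Spectral gap from a decomposition\<close>

text \<open>The weight is complex, so positivity is lost and the Hilbert metric is not at hand. Its
  role is taken by the smallest disk outside which \<open>z h - v\<close> stays in the complex cone,
  the counterpart of the interval of ratios \<open>v / h\<close> over a real cone. Contraction means
  that this disk shrinks, and perturbation of interior points is enough to prove it.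

  The gap condition says \<open>2 * \<gamma> * E < 1\<close>. Cross ratios of the image cone are at
  most E^2, so two values p + i r of an unperturbed image enclose an angle whose cosine is at least
  of order 1/E; a relative error \<gamma> in each value costs about 2 \<gamma> of it. In
  \<open>\<gamma>\<close>, \<open>\<theta> / 2\<close> is the spread of the phase of the weight,
  while \<open>\<rho> * b / (\<sigma> - \<tau>)\<close> is the change of phase between paired
  pre-images, measured against the margin \<open>\<sigma> - \<tau>\<close> by which the image cone
  lies inside the cone. A larger \<open>\<sigma>\<close> widens this margin but raises the factor
  \<open>exp (\<tau> * D)\<close> in \<open>E\<close>; the choice of \<open>\<sigma>\<close> settles
  the trade-off in the form that the theorem prescribes.\<close>

lemma bounded_linear_scaleC_left:
  fixes v :: "'x::complex_normed_vector"
  shows "bounded_linear (\<lambda>c. c *\<^sub>C v)"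
proof (rule bounded_linear_intro[where K = "norm v"])
  fix r :: real and c :: complex
  show "(r *\<^sub>R c) *\<^sub>C v = r *\<^sub>R c *\<^sub>C v"
    by (metis scaleC_of_real scaleC_scaleC scaleR_conv_of_real)
qed (simp_all add: scaleC_add_left norm_scaleC)

lemma bounded_linear_scaleC_right:
  fixes c :: complex
  shows "bounded_linear (\<lambda>v::'x::complex_normed_vector. c *\<^sub>C v)"
proof (rule bounded_linear_intro[where K = "norm c"])
  fix r :: real and v :: 'x
  show "c *\<^sub>C r *\<^sub>R v = r *\<^sub>R c *\<^sub>C v"
    by (metis scaleC_of_real scaleC_scaleC mult.commute)
qed (simp_all add: scaleC_add_right norm_scaleC)

lemmas scaleC_simps =
  linear_0[OF bounded_linear.linear[OF bounded_linear_scaleC_left]]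
  linear_0[OF bounded_linear.linear[OF bounded_linear_scaleC_right]]
  linear_diff[OF bounded_linear.linear[OF bounded_linear_scaleC_left]]
  linear_diff[OF bounded_linear.linear[OF bounded_linear_scaleC_right]]
  linear_neg[OF bounded_linear.linear[OF bounded_linear_scaleC_left]]
  linear_neg[OF bounded_linear.linear[OF bounded_linear_scaleC_right]]
  scaleC_add_left scaleC_add_right scaleC_scaleC scaleC_one

lemma tendsto_scaleC:
  fixes v :: "'a \<Rightarrow> 'x::complex_normed_vector"
  assumes c: "(c \<longlongrightarrow> c0) G" and v: "(v \<longlongrightarrow> v0) G"
  shows "((\<lambda>x. c x *\<^sub>C v x) \<longlongrightarrow> c0 *\<^sub>C v0) G"
proof -
  have "((\<lambda>x. norm (c x) * norm (v x - v0)) \<longlongrightarrow> norm c0 * norm (v0 - v0)) G"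
    by (intro tendsto_intros c v)
  then have "((\<lambda>x. c x *\<^sub>C (v x - v0)) \<longlongrightarrow> 0) G"
    by (intro tendsto_norm_zero_cancel[of "\<lambda>x. c x *\<^sub>C (v x - v0)"]) (simp add: norm_scaleC)
  moreover have "((\<lambda>x. c x *\<^sub>C v0) \<longlongrightarrow> c0 *\<^sub>C v0) G"
    by (rule bounded_linear.tendsto[OF bounded_linear_scaleC_left c])
  ultimately have "((\<lambda>x. c x *\<^sub>C (v x - v0) + c x *\<^sub>C v0) \<longlongrightarrow> 0 + c0 *\<^sub>C v0) G"
    by (rule tendsto_add)
  then show ?thesis by (simp add: scaleC_simps)
qed

lemma bounded_clinearD:
  assumes "bounded_clinear A"
  shows "bounded_linear A" "A (u + v) = A u + A v" "A (u - v) = A u - A v" "A 0 = 0"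
    "A (c *\<^sub>C v) = c *\<^sub>C A v"
  using assms by (simp_all add: bounded_clinear_def bounded_linear.linear linear_add linear_diff linear_0)

lemma bounded_clinearI:
  assumes "\<And>u v. A (u + v) = A u + A v" "\<And>c v. A (c *\<^sub>C v) = c *\<^sub>C A v" "\<And>v. norm (A v) \<le> K * norm v"
  shows "bounded_clinear A"
  unfolding bounded_clinear_def
proof
  show "bounded_linear A"
    by (rule bounded_linear_intro[where K = K])
      (use assms in \<open>auto simp: mult.commute simp flip: scaleC_of_real\<close>)
qed (use assms in auto)

lemma bounded_clinear_funpow:
  fixes A :: "'x::complex_normed_vector \<Rightarrow> 'x"
  assumes "bounded_clinear A"
  shows "bounded_clinear (A ^^ n)"
proof (induction n)
  case 0
  show ?case by (rule bounded_clinearI[where K = 1]) auto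
next
  case (Suc n)
  then show ?case
    using assms by (auto simp: bounded_clinear_def o_def intro: bounded_linear_compose)
qed

lemma is_resolvent_unique:
  assumes "is_resolvent A z R" "is_resolvent A z R'"
  shows "R = R'"
proof
  fix v
  have 1: "R (z *\<^sub>C R' v - A (R' v)) = R' v" using assms(1) by (auto simp: is_resolvent_def)
  have 2: "z *\<^sub>C R' v - A (R' v) = v" using assms(2) by (auto simp: is_resolvent_def)
  show "R v = R' v" using 1 unfolding 2 .
qed

lemma resolvent_eqI: "is_resolvent A z R \<Longrightarrow> resolvent A z = R"
  unfolding resolvent_def by (rule the_equality) (auto intro: is_resolvent_unique)

lemma eigenvalue_in_spectrum:
  assumes "is_eigenvalue A \<mu>"
  shows "\<mu> \<in> spectrum A"
proof -
  obtain v where v: "v \<noteq> 0" "A v = \<mu> *\<^sub>C v" using assms by (auto simp: is_eigenvalue_def)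
  have False if R: "is_resolvent A \<mu> R" for R
  proof -
    have "v = R (\<mu> *\<^sub>C v - A v)" using R by (simp add: is_resolvent_def)
    also have "\<dots> = 0" using R v by (simp add: is_resolvent_def bounded_clinearD(4))
    finally show False using v by simp
  qed
  then show ?thesis by (auto simp: spectrum_def)
qed

text \<open>The open disk of radius \<open>norm \<mu>\<close> about \<open>\<mu>\<close> misses 0,
  so the powers of 1/z are holomorphic there and Cauchy's theorem applies. They are the coefficients
  of the Neumann series, which therefore drops out of the Riesz projection.\<close>

lemma integral_circle_inverse_power:
  fixes \<mu> :: complex
  assumes "0 < r" "r < norm \<mu>"
  shows "((\<lambda>t. r * cis t * (1 / (\<mu> + r * cis t)) ^ Suc n) has_integral 0) {0..2*pi}"
proof -
  let ?f = "\<lambda>z::complex. (1 / z) ^ Suc n"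
  have nz: "0 \<notin> ball \<mu> (norm \<mu>)" by (simp add: dist_norm)
  have "(?f has_contour_integral 0) (part_circlepath \<mu> r 0 (2*pi))"
  proof (rule Cauchy_theorem_disc_simple)
    show "?f holomorphic_on ball \<mu> (norm \<mu>)"
      using nz by (intro holomorphic_intros) auto
    have "path_image (part_circlepath \<mu> r 0 (2*pi)) \<subseteq> sphere \<mu> r"
      using assms by (intro path_image_part_circlepath_subset) auto
    also have "\<dots> \<subseteq> ball \<mu> (norm \<mu>)" using assms by auto
    finally show "path_image (part_circlepath \<mu> r 0 (2*pi)) \<subseteq> ball \<mu> (norm \<mu>)" .
    show "pathfinish (part_circlepath \<mu> r 0 (2*pi)) = pathstart (part_circlepath \<mu> r 0 (2*pi))"
      by (simp add: exp_eq_1)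
  qed simp
  then have "((\<lambda>t. ?f (\<mu> + r * cis t) * r * \<i> * cis t) has_integral 0) {0..2*pi}"
    by (subst (asm) has_contour_integral_part_circlepath_iff) auto
  \<comment> \<open>The derivative of the circle brings in a factor \<open>\<i>\<close>, absent from
    \<open>riesz_projection\<close>, where it has been cancelled against 1/(2 pi i).\<close>
  from has_integral_mult_right[OF this, of "- \<i>"] show ?thesis
    by (simp add: mult_ac)
qed


theorem spectral_gap_of_decomposition:
  fixes A :: "'x::complex_banach \<Rightarrow> 'x" and \<nu> :: "'x \<Rightarrow> complex"
  assumes A: "bounded_clinear A"
    and Ah: "A h = \<mu> *\<^sub>C h"
    and \<nu>: "bounded_linear \<nu>" "\<And>c v. \<nu> (c *\<^sub>C v) = c * \<nu> v"
    and \<nu>A: "\<And>v. \<nu> (A v) = \<mu> * \<nu> v" and \<nu>h: "\<nu> h = 1"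
    and decay: "\<And>n v. norm ((A ^^ n) (v - \<nu> v *\<^sub>C h)) \<le> K * r ^ n * norm v"
    and r: "0 \<le> r" "r < norm \<mu>"
  shows "has_spectral_gap A"
proof -
  note A_simps = bounded_clinearD[OF A]
  note An_simps = bounded_clinearD[OF bounded_clinear_funpow[OF A]]
  note \<nu>_simps = \<nu>(2) linear_add[OF bounded_linear.linear[OF \<nu>(1)]]
  define q where "q v = v - \<nu> v *\<^sub>C h" for v
  define N where "N z v = (\<Sum>n. (1 / z) ^ Suc n *\<^sub>C (A ^^ n) (q v))" for z v
  define R where "R z v = (\<nu> v / (z - \<mu>)) *\<^sub>C h + N z v" for z v
  have h: "h \<noteq> 0" using \<nu>h linear_0[OF bounded_linear.linear[OF \<nu>(1)]] by auto
  have q_add: "q (u + v) = q u + q v" and q_scale: "q (c *\<^sub>C v) = c *\<^sub>C q v" for u v c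
    by (simp_all add: q_def \<nu>_simps scaleC_simps)
  have qA: "q (A v) = A (q v)" for v
    by (simp add: q_def \<nu>A A_simps Ah scaleC_simps mult.commute)
  have "0 \<le> K * norm h" 
    using order_trans[OF norm_ge_zero decay[of 0 h]] by simp
  then have K: "0 \<le> K" using h by (simp add: zero_le_mult_iff)
  \<comment> \<open>The lower bound \<open>s\<close> of \<open>norm z\<close> is left free:
    \<open>s = norm z\<close> gives convergence at a point, \<open>s = norm \<mu> - e\<close> a
    uniform majorant on the circle.\<close>
  have term_le: "norm ((1 / z) ^ Suc n *\<^sub>C (A ^^ n) (q v)) \<le> (1 / s * K * norm v) * (r / s) ^ n"
    if "s \<le> norm z" "r < s" for z s n v
  proof -
    have "0 < s" using r(1) that by simp
    have "norm ((1 / z) ^ Suc n *\<^sub>C (A ^^ n) (q v)) \<le> (1 / norm z) ^ Suc n * (K * r ^ n * norm v)"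
      unfolding norm_scaleC norm_power norm_divide norm_one q_def
      by (intro mult_left_mono decay) auto
    also have "\<dots> \<le> (1 / s) ^ Suc n * (K * r ^ n * norm v)"
      using that K r \<open>0 < s\<close> by (intro mult_right_mono power_mono) (auto simp: frac_le)
    finally show ?thesis by (simp add: power_divide mult_ac)
  qed
  have geo: "(\<lambda>n. (1 / s * K * norm v) * (r / s) ^ n) sums ((1 / s * K * norm v) * (1 / (1 - r / s)))" if "r < s" for s and v :: 'x
    using r(1) that by (intro sums_mult geometric_sums) auto
  have sn: "summable (\<lambda>n. norm ((1 / z) ^ Suc n *\<^sub>C (A ^^ n) (q v)))" if "r < norm z" for z v
  proof (rule summable_comparison_test[OF _ sums_summable[OF geo[OF that, of v]]], intro exI allI impI)
    fix n
    show "norm (norm ((1 / z) ^ Suc n *\<^sub>C (A ^^ n) (q v))) \<le> (1 / norm z * K * norm v) * (r / norm z) ^ n"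
      unfolding real_norm_def abs_norm_cancel by (rule term_le[OF order_refl that])
  qed
  have sm: "summable (\<lambda>n. (1 / z) ^ Suc n *\<^sub>C (A ^^ n) (q v))" if "r < norm z" for z v
    by (rule summable_norm_cancel[OF sn[OF that]])
  have N_bound: "norm (N z v) \<le> (1 / norm z * K * (1 / (1 - r / norm z))) * norm v" if "r < norm z" for z v
  proof -
    have "norm (N z v) \<le> (\<Sum>n. norm ((1 / z) ^ Suc n *\<^sub>C (A ^^ n) (q v)))"
      unfolding N_def by (rule summable_norm[OF sn[OF that]])
    also have "\<dots> \<le> (1 / norm z * K * norm v) * (1 / (1 - r / norm z))"
      using suminf_le[OF term_le[OF order_refl that] sn[OF that] sums_summable[OF geo[OF that]]]
        sums_unique[OF geo[OF that, of v]] by simp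
    finally show ?thesis by (simp add: mult_ac)
  qed
  have N_add: "N z (u + v) = N z u + N z v" if "r < norm z" for z u v
    unfolding N_def by (subst suminf_add[OF sm[OF that] sm[OF that]]) (simp add: q_add An_simps scaleC_simps)
  have N_scale: "N z (c *\<^sub>C v) = c *\<^sub>C N z v" if "r < norm z" for z c v
    unfolding N_def by (subst bounded_linear.suminf[OF bounded_linear_scaleC_right sm[OF that]])
      (simp add: q_scale An_simps scaleC_simps mult.commute)
  have AN: "A (N z v) = (\<Sum>n. (1 / z) ^ Suc n *\<^sub>C (A ^^ Suc n) (q v))" if "r < norm z" for z v
    unfolding N_def by (subst bounded_linear.suminf[OF A_simps(1) sm[OF that]]) (simp add: A_simps)
  have NA: "N z (A v) = A (N z v)" if "r < norm z" for z v
    unfolding AN[OF that] unfolding N_def by (simp add: qA funpow_swap1)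
  have N_eq: "z *\<^sub>C N z v - A (N z v) = q v" if "r < norm z" for z v
  proof -
    have z: "z \<noteq> 0" using that r by auto
    let ?t = "\<lambda>n. z *\<^sub>C (1 / z) ^ Suc n *\<^sub>C (A ^^ n) (q v)"
    have "z *\<^sub>C N z v = (\<Sum>n. ?t n)"
      unfolding N_def by (rule bounded_linear.suminf[OF bounded_linear_scaleC_right sm[OF that]])
    also have "\<dots> = ?t 0 + (\<Sum>n. ?t (Suc n))"
      using suminf_split_head[OF bounded_linear.summable[OF bounded_linear_scaleC_right sm[OF that, of v], of z]]
      by simp
    also have "(\<Sum>n. ?t (Suc n)) = A (N z v)"
      unfolding AN[OF that] using z by (simp add: scaleC_simps)
    also have "?t 0 = q v" using z by (simp add: scaleC_simps)
    finally show ?thesis by simp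
  qed
  have res: "is_resolvent A z (R z)" if z: "r < norm z" "z \<noteq> \<mu>" for z
  proof -
    obtain C where C: "\<And>v. norm (\<nu> v) \<le> norm v * C" using bounded_linear.bounded[OF \<nu>(1)] by blast
    have "bounded_clinear (R z)"
    proof (rule bounded_clinearI)
      show "R z (u + v) = R z u + R z v" for u v
        by (simp add: R_def N_add[OF z(1)] \<nu>_simps add_divide_distrib scaleC_simps)
      show "R z (c *\<^sub>C v) = c *\<^sub>C R z v" for c v
        by (simp add: R_def N_scale[OF z(1)] \<nu>_simps scaleC_simps)
      show "norm (R z v) \<le> (C / norm (z - \<mu>) * norm h + 1 / norm z * K * (1 / (1 - r / norm z))) * norm v" for v
      proof -
        have "norm (R z v) \<le> norm (\<nu> v) / norm (z - \<mu>) * norm h + norm (N z v)"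
          unfolding R_def by (rule order_trans[OF norm_triangle_ineq]) (simp add: norm_scaleC norm_divide)
        also have "\<dots> \<le> (norm v * C) / norm (z - \<mu>) * norm h + (1 / norm z * K * (1 / (1 - r / norm z))) * norm v"
          by (intro add_mono mult_right_mono divide_right_mono C N_bound z) auto
        finally show ?thesis by (simp add: algebra_simps)
      qed
    qed
    moreover have "R z (A v) = A (R z v)" for v
      by (simp add: R_def NA[OF z(1)] \<nu>A A_simps Ah scaleC_simps mult.commute)
    moreover have "z *\<^sub>C R z v - A (R z v) = v" for v
    proof -
      have "z *\<^sub>C R z v - A (R z v) = ((z - \<mu>) * (\<nu> v / (z - \<mu>))) *\<^sub>C h + (z *\<^sub>C N z v - A (N z v))"
        unfolding left_diff_distrib scaleC_simps(3)
        by (simp add: R_def A_simps Ah scaleC_simps mult.commute)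
      also have "\<dots> = v" using z by (simp add: N_eq q_def)
      finally show ?thesis .
    qed
    ultimately show ?thesis
      unfolding is_resolvent_def by (simp add: bounded_clinearD)
  qed
  have eig: "is_eigenvalue A \<mu>" using h Ah by (auto simp: is_eigenvalue_def)
  have sp: "norm z \<le> r" if "z \<in> spectrum A" "z \<noteq> \<mu>" for z
  proof (rule ccontr)
    assume "\<not> norm z \<le> r"
    then have "is_resolvent A z (R z)" using that(2) by (intro res) auto
    then show False using that(1) unfolding spectrum_def by blast
  qed
  have sr: "spectral_radius A = norm \<mu>"
    unfolding spectral_radius_def
  proof (rule cSup_eq_maximum)
    show "norm \<mu> \<in> norm ` spectrum A" using eigenvalue_in_spectrum[OF eig] by simp
    show "x \<le> norm \<mu>" if x: "x \<in> norm ` spectrum A" for x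
    proof -
      obtain z where z: "x = norm z" "z \<in> spectrum A" using x by auto
      show ?thesis using sp[OF z(2)] r(2) z(1) by (cases "z = \<mu>") auto
    qed
  qed
  \<comment> \<open>Half of the gap between \<open>r\<close> and \<open>norm \<mu>\<close>: the
    closed disk of radius \<open>e\<close> about \<open>\<mu>\<close> stays where the Neumann series
    converges.\<close>
  define e where "e = (norm \<mu> - r) / 2"
  have e: "0 < e" "e < norm \<mu>" "r < norm \<mu> - e" using r by (auto simp: e_def field_simps)
  have far: "norm \<mu> - e \<le> norm z" if "z \<in> cball \<mu> e" for z
    using that norm_triangle_ineq2[of \<mu> z] by (simp add: dist_norm)
  have "z = \<mu>" if "z \<in> spectrum A" "z \<in> cball \<mu> e" for z
    using sp[OF that(1)] far[OF that(2)] e(3) by linarith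
  then have iso: "spectrum A \<inter> cball \<mu> e = {\<mu>}"
    using eigenvalue_in_spectrum[OF eig] e(1) by auto
  have riesz: "riesz_projection A \<mu> e v = \<nu> v *\<^sub>C h" for v
  proof -
    let ?z = "\<lambda>t. \<mu> + e * cis t"
    have z: "norm \<mu> - e \<le> norm (?z t)" for t
      using e by (intro far) (simp add: dist_norm norm_mult)
    have zr: "r < norm (?z t)" and z\<mu>: "?z t \<noteq> \<mu>" for t
      using z[of t] e by auto
    let ?f = "\<lambda>n t. (e * cis t * (1 / ?z t) ^ Suc n) *\<^sub>C (A ^^ n) (q v)"
    have f_int: "(?f n has_integral 0) {0..2*pi}" for n
      using has_integral_linear[OF integral_circle_inverse_power[OF e(1,2), of n]
          bounded_linear_scaleC_left[of "(A ^^ n) (q v)"]]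
      by (simp add: o_def scaleC_simps)
    \<comment> \<open>Uniform convergence on the circle permits integration term by term, and every
      term integrates to 0.\<close>
    have "uniform_limit {0..2*pi} (\<lambda>n t. \<Sum>i<n. ?f i t) (\<lambda>t. \<Sum>i. ?f i t) sequentially"
    proof (rule Weierstrass_m_test)
      let ?s = "norm \<mu> - e"
      show "summable (\<lambda>n. e * ((1 / ?s * K * norm v) * (r / ?s) ^ n))"
        by (rule summable_mult[OF sums_summable[OF geo[OF e(3)]]])
      show "norm (?f n t) \<le> e * ((1 / ?s * K * norm v) * (r / ?s) ^ n)" for n t
      proof -
        have "norm (?f n t) = e * norm ((1 / ?z t) ^ Suc n *\<^sub>C (A ^^ n) (q v))"
          unfolding norm_scaleC norm_mult using e by simp
        also have "\<dots> \<le> e * ((1 / ?s * K * norm v) * (r / ?s) ^ n)"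
          using e by (intro mult_left_mono term_le z) auto
        finally show ?thesis .
      qed
    qed
    moreover have "continuous_on {0..2*pi} (\<lambda>t. \<Sum>i<n. ?f i t)" for n
    proof (intro continuous_on_sum bounded_linear.continuous_on[OF bounded_linear_scaleC_left] continuous_intros)
      show "\<forall>t\<in>{0..2*pi}. ?z t \<noteq> 0"
      proof
        fix t show "?z t \<noteq> 0" using zr[of t] r(1) by (metis norm_zero not_less)
      qed
    qed
    moreover have "sequentially \<noteq> bot" by simp
    ultimately obtain I J where IJ: "\<And>n. ((\<lambda>t. \<Sum>i<n. ?f i t) has_integral I n) {0..2*pi}"
        "((\<lambda>t. \<Sum>i. ?f i t) has_integral J) {0..2*pi}" "I \<longlonglongrightarrow> J"
      by (rule uniform_limit_integral) blast
    have "((\<lambda>t. \<Sum>i<n. ?f i t) has_integral (\<Sum>i<n. 0)) {0..2*pi}" for n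
      by (intro has_integral_sum f_int) auto
    then have "I = (\<lambda>n. 0)" using has_integral_unique[OF IJ(1)] by auto
    then have "J = 0" using IJ(3) by (simp add: LIMSEQ_const_iff)
    \<comment> \<open>The factor \<open>e * cis t\<close> equals \<open>?z t - \<mu>\<close> and
      cancels the pole, so the singular part becomes constant on the circle.\<close>
    have "(e * cis t) *\<^sub>C resolvent A (?z t) v = \<nu> v *\<^sub>C h + (\<Sum>i. ?f i t)" for t
    proof -
      have "resolvent A (?z t) = R (?z t)" by (rule resolvent_eqI[OF res[OF zr z\<mu>]])
      moreover have "(e * cis t) *\<^sub>C N (?z t) v = (\<Sum>i. ?f i t)"
        unfolding N_def by (subst bounded_linear.suminf[OF bounded_linear_scaleC_right sm[OF zr]])
          (simp add: scaleC_simps)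
      ultimately show ?thesis
        using e(1) by (simp add: R_def scaleC_simps)
    qed
    moreover have "((\<lambda>t. \<nu> v *\<^sub>C h + (\<Sum>i. ?f i t)) has_integral (2 * pi) *\<^sub>R \<nu> v *\<^sub>C h + 0) {0..2*pi}"
      using IJ(2) \<open>J = 0\<close> has_integral_const_real[of "\<nu> v *\<^sub>C h" 0 "2*pi"]
      by (intro has_integral_add) auto
    ultimately show ?thesis
      unfolding riesz_projection_def by (simp add: integral_unique)
  qed
  have "range (riesz_projection A \<mu> e) = range (\<lambda>c. c *\<^sub>C h)"
  proof
    show "range (\<lambda>c. c *\<^sub>C h) \<subseteq> range (riesz_projection A \<mu> e)"
    proof
      fix x assume "x \<in> range (\<lambda>c. c *\<^sub>C h)"
      then obtain c where "x = c *\<^sub>C h" by auto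
      then have "x = riesz_projection A \<mu> e (c *\<^sub>C h)" by (simp add: riesz \<nu>_simps \<nu>h)
      then show "x \<in> range (riesz_projection A \<mu> e)" by simp
    qed
  qed (auto simp: riesz)
  then have "simple_isolated_eigenvalue A \<mu>"
    unfolding simple_isolated_eigenvalue_def using eig e(1) iso h by blast
  moreover have "spectrum A - {\<mu>} \<subseteq> cball 0 r"
  proof
    fix z assume "z \<in> spectrum A - {\<mu>}"
    then show "z \<in> cball 0 r" using sp[of z] by simp
  qed
  ultimately show ?thesis
    unfolding has_spectral_gap_def using A sr r by auto
qed

section \<open>Contraction of complex cones\<close>

text \<open>Applied to normalised iterates, where only the limit is used, and to the approximations
  of the invariant functional, where the rate enters the decay estimate.\<close>

lemma geometric_increments_converge:
  fixes x :: "nat \<Rightarrow> 'x::banach"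
  assumes inc: "\<And>n. norm (x (Suc n) - x n) \<le> C * \<eta> ^ n" and \<eta>: "0 \<le> \<eta>" "\<eta> < 1"
  obtains L where "x \<longlonglongrightarrow> L" "\<And>n. norm (x n - L) \<le> C / (1 - \<eta>) * \<eta> ^ n"
proof -
  have geo: "(\<lambda>i. C * \<eta> ^ n * \<eta> ^ i) sums (C * \<eta> ^ n * (1 / (1 - \<eta>)))" for n
    using \<eta> by (intro sums_mult geometric_sums) auto
  have le: "norm (x (Suc (i + n)) - x (i + n)) \<le> C * \<eta> ^ n * \<eta> ^ i" for i n
    using inc[of "i + n"] by (simp add: power_add mult_ac)
  have sn: "summable (\<lambda>i. norm (x (Suc (i + n)) - x (i + n)))" for n
    by (rule summable_comparison_test[OF _ sums_summable[OF geo[of n]]]) (use le in auto)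
  define L where "L = x 0 + (\<Sum>i. x (Suc i) - x i)"
  have "(\<lambda>n. x 0 + (\<Sum>i<n. x (Suc i) - x i)) \<longlonglongrightarrow> L"
    unfolding L_def using summable_LIMSEQ[OF summable_norm_cancel[OF sn[of 0]]] by (intro tendsto_intros) simp
  then have L: "x \<longlonglongrightarrow> L" by (simp add: sum_lessThan_telescope)
  have "norm (x n - L) \<le> C / (1 - \<eta>) * \<eta> ^ n" for n
  proof -
    have "(\<lambda>m. x (m + n)) \<longlonglongrightarrow> L" by (rule LIMSEQ_ignore_initial_segment[OF L])
    then have lim: "(\<lambda>m. norm (x n - x (m + n))) \<longlonglongrightarrow> norm (x n - L)" by (intro tendsto_intros)
    have "norm (x n - x (m + n)) \<le> C / (1 - \<eta>) * \<eta> ^ n" for m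
    proof -
      have "x (m + n) - x n = (\<Sum>i<m. x (Suc (i + n)) - x (i + n))"
        using sum_lessThan_telescope[of "\<lambda>i. x (i + n)" m] by simp
      then have "norm (x n - x (m + n)) \<le> (\<Sum>i<m. norm (x (Suc (i + n)) - x (i + n)))"
        by (simp only: norm_minus_commute[of "x n"] norm_sum)
      also have "\<dots> \<le> (\<Sum>i. norm (x (Suc (i + n)) - x (i + n)))"
        by (rule sum_le_suminf[OF sn]) auto
      also have "\<dots> \<le> C * \<eta> ^ n * (1 / (1 - \<eta>))"
        using suminf_le[OF le sn sums_summable[OF geo]] sums_unique[OF geo] by metis
      finally show ?thesis by (simp add: mult_ac)
    qed
    then show ?thesis by (intro LIMSEQ_le_const2[OF lim]) blast
  qed
  then show thesis using L that by blast
qed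

lemma Re_mult_cnj_scale: "Re (c * x * cnj (c * y)) = (norm c)\<^sup>2 * Re (x * cnj y)"
proof -
  have "c * x * cnj (c * y) = (c * cnj c) * (x * cnj y)" by (simp add: mult_ac)
  also have "\<dots> = of_real ((norm c)\<^sup>2) * (x * cnj y)" by (simp only: complex_norm_square)
  also have "Re \<dots> = (norm c)\<^sup>2 * Re (x * cnj y)"
    by (simp only: times_complex.sel Re_complex_of_real Im_complex_of_real mult_zero_left diff_zero)
  finally show ?thesis .
qed

definition complex_cone :: "('x \<Rightarrow> complex) set \<Rightarrow> 'x set" where
  "complex_cone F = {v. \<forall>l\<in>F. \<forall>m\<in>F. 0 \<le> Re (l v * cnj (m v))}"

text \<open>Quantitative interior. The case \<open>l = m\<close> bounds all moduli between
  \<open>sqrt \<kappa> * s\<close> and \<open>s\<close>, and any two values enclose an angle of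
  cosine at least \<open>\<kappa>\<close>. The scale \<open>s\<close> depends on \<open>v\<close>,
  but \<open>\<kappa>\<close> is uniform over the image of the cone and stands in for a finite
  projective diameter.\<close>

definition deep_in_cone :: "('x \<Rightarrow> complex) set \<Rightarrow> real \<Rightarrow> real \<Rightarrow> 'x \<Rightarrow> bool" where
  "deep_in_cone F \<kappa> s v \<longleftrightarrow> 0 < s \<and> (\<forall>l\<in>F. norm (l v) \<le> s) \<and>
     (\<forall>l\<in>F. \<forall>m\<in>F. \<kappa> * s\<^sup>2 \<le> Re (l v * cnj (m v)))"

locale complex_cone_contraction =
  fixes F :: "('x::complex_banach \<Rightarrow> complex) set" and M :: "'x \<Rightarrow> 'x" and B \<kappa> :: real
  assumes M: "bounded_clinear M"
    and F_nonempty: "F \<noteq> {}"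
    and F_add: "\<And>l u v. l \<in> F \<Longrightarrow> l (u + v) = l u + l v"
    and F_scale: "\<And>l c v. l \<in> F \<Longrightarrow> l (c *\<^sub>C v) = c * l v"
    and F_bound: "\<And>l v. l \<in> F \<Longrightarrow> norm (l v) \<le> B * norm v"
    and F_norming: "\<And>v R. (\<And>l. l \<in> F \<Longrightarrow> norm (l v) \<le> R) \<Longrightarrow> norm v \<le> B * R"
    and B: "0 < B" and \<kappa>: "0 < \<kappa>"
    and M_deep: "\<And>v. v \<in> complex_cone F \<Longrightarrow> v \<noteq> 0 \<Longrightarrow> \<exists>s. deep_in_cone F \<kappa> s (M v)"
    and cone_nontrivial: "\<exists>v\<in>complex_cone F. v \<noteq> 0"
begin

abbreviation "deep \<equiv> deep_in_cone F \<kappa>"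
abbreviation "\<C> \<equiv> complex_cone F"

section \<open>Deep vectors: comparable values and stability under perturbation\<close>

lemma F_minus: "l \<in> F \<Longrightarrow> l (u - v) = l u - l v"
  using F_add[of l u "(- 1) *\<^sub>C v"] F_scale[of l "- 1" v] by (simp add: scaleC_simps)

lemma F_zero: "l \<in> F \<Longrightarrow> l 0 = 0"
  using F_minus[of l 0 0] by simp

lemma F_bounded_linear:
  assumes "l \<in> F"
  shows "bounded_linear l"
proof (rule bounded_linear_intro[where K = B])
  show "l (r *\<^sub>R v) = r *\<^sub>R l v" for r v
    using F_scale[OF assms, of "of_real r" v] by (simp add: scaleC_of_real scaleR_conv_of_real)
qed (use F_add F_bound assms in \<open>auto simp: mult.commute\<close>)

lemma M_minus: "M (u - v) = M u - M v"
  and M_scale: "M (c *\<^sub>C v) = c *\<^sub>C M v"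
  by (rule bounded_clinearD[OF M])+

lemma Mn_minus: "(M ^^ n) (u - v) = (M ^^ n) u - (M ^^ n) v"
  and Mn_scale: "(M ^^ n) (c *\<^sub>C v) = c *\<^sub>C (M ^^ n) v"
  and Mn_add: "(M ^^ n) (u + v) = (M ^^ n) u + (M ^^ n) v"
  by (rule bounded_clinearD[OF bounded_clinear_funpow[OF M]])+

lemma deep_pos: "deep s v \<Longrightarrow> 0 < s"
  and deep_upper: "deep s v \<Longrightarrow> l \<in> F \<Longrightarrow> norm (l v) \<le> s"
  and deep_Re: "deep s v \<Longrightarrow> l \<in> F \<Longrightarrow> m \<in> F \<Longrightarrow> \<kappa> * s\<^sup>2 \<le> Re (l v * cnj (m v))"
  by (simp_all add: deep_in_cone_def)

lemma deep_in: "deep s v \<Longrightarrow> v \<in> \<C>"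
proof -
  assume "deep s v"
  moreover have "0 \<le> \<kappa> * s\<^sup>2" using \<kappa> by simp
  ultimately show ?thesis unfolding complex_cone_def using deep_Re order_trans by blast
qed

lemma kappa_le_1: "deep s v \<Longrightarrow> \<kappa> \<le> 1"
proof -
  assume v: "deep s v"
  obtain l where l: "l \<in> F" using F_nonempty by auto
  have "\<kappa> * s\<^sup>2 \<le> (norm (l v))\<^sup>2"
    using deep_Re[OF v l l] by (simp add: complex_norm_square[symmetric] del: of_real_power flip: of_real_power)
  also have "\<dots> \<le> s\<^sup>2" using deep_upper[OF v l] by (intro power_mono) auto
  finally show "\<kappa> \<le> 1" using deep_pos[OF v] by simp
qed

text \<open>The case \<open>l = m\<close> gives \<open>sqrt \<kappa> * s\<close>; as \<kappa> \<le>
  1, this is weakened so that later constants are powers of \<open>\<kappa>\<close>.\<close>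

lemma deep_lower:
  assumes v: "deep s v" and l: "l \<in> F"
  shows "\<kappa> * s \<le> norm (l v)"
proof -
  have "(\<kappa> * s)\<^sup>2 = \<kappa> * (\<kappa> * s\<^sup>2)" by (simp add: power2_eq_square)
  also have "\<dots> \<le> 1 * (\<kappa> * s\<^sup>2)"
    using kappa_le_1[OF v] \<kappa> by (intro mult_right_mono) auto
  also have "\<dots> \<le> (norm (l v))\<^sup>2"
    using deep_Re[OF v l l] by (simp add: complex_norm_square[symmetric] del: of_real_power flip: of_real_power)
  finally show ?thesis by (rule power2_le_imp_le) simp
qed

lemma deep_nonzero: "deep s v \<Longrightarrow> l \<in> F \<Longrightarrow> l v \<noteq> 0"
  using deep_lower[of s v l] deep_pos[of s v] \<kappa> by (auto simp: mult_le_0_iff)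

lemma deep_neq_0: "deep s v \<Longrightarrow> v \<noteq> 0"
  using deep_nonzero F_zero F_nonempty by blast

lemma deep_norm: "deep s v \<Longrightarrow> norm v \<le> B * s"
  by (rule F_norming) (rule deep_upper)

lemma deep_norm_le:
  assumes v: "deep s v" and l: "l \<in> F"
  shows "norm v \<le> B / \<kappa> * norm (l v)"
proof -
  have "norm v \<le> B * s" by (rule deep_norm[OF v])
  also have "\<dots> \<le> B * (norm (l v) / \<kappa>)"
    using deep_lower[OF v l] \<kappa> B by (intro mult_left_mono) (auto simp: field_simps)
  finally show ?thesis by simp
qed

lemma cone_scale:
  assumes "v \<in> \<C>"
  shows "c *\<^sub>C v \<in> \<C>"
  using assms by (simp add: complex_cone_def F_scale Re_mult_cnj_scale del: complex_cnj_mult times_complex.sel)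

lemma deep_scale:
  assumes v: "deep s v" and c: "c \<noteq> 0"
  shows "deep (norm c * s) (c *\<^sub>C v)"
proof -
  have "\<kappa> * (norm c * s)\<^sup>2 = (norm c)\<^sup>2 * (\<kappa> * s\<^sup>2)" by (simp add: power_mult_distrib)
  then show ?thesis
    using v c by (auto simp: deep_in_cone_def F_scale norm_mult mult_left_mono Re_mult_cnj_scale simp del: complex_cnj_mult times_complex.sel)
qed

text \<open>Each product changes by at most (2 t + t^2) s^2 \<le> 3 t s^2, which the margin \<kappa>
  s^2 absorbs.\<close>

lemma deep_perturb:
  assumes v: "deep s v" and t: "3 * t \<le> \<kappa>" and w: "\<And>l. l \<in> F \<Longrightarrow> norm (l w) \<le> t * s"
  shows "v + w \<in> \<C>"
  unfolding complex_cone_def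
proof (intro CollectI ballI)
  fix l m assume l: "l \<in> F" and m: "m \<in> F"
  have s: "0 < s" by (rule deep_pos[OF v])
  have "0 \<le> t * s" using order_trans[OF norm_ge_zero w[OF l]] .
  then have t0: "0 \<le> t" using s by (simp add: zero_le_mult_iff)
  have "t \<le> 1" using t kappa_le_1[OF v] by simp
  then have tt: "t * t \<le> t" using t0 by (simp add: mult_left_le)
  have n: "norm (l v * cnj (m w)) \<le> s * (t * s)" "norm (l w * cnj (m v)) \<le> (t * s) * s"
    "norm (l w * cnj (m w)) \<le> (t * s) * (t * s)"
    unfolding norm_mult complex_mod_cnj
    using s t0 by (intro mult_mono deep_upper[OF v] w l m; simp)+
  have "l (v + w) * cnj (m (v + w)) = l v * cnj (m v) + (l v * cnj (m w) + l w * cnj (m v) + l w * cnj (m w))"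
    by (simp add: F_add l m algebra_simps)
  then have "Re (l (v + w) * cnj (m (v + w)))
      \<ge> Re (l v * cnj (m v)) - (norm (l v * cnj (m w)) + norm (l w * cnj (m v)) + norm (l w * cnj (m w)))"
    using abs_Re_le_cmod[of "l v * cnj (m w)"] abs_Re_le_cmod[of "l w * cnj (m v)"] abs_Re_le_cmod[of "l w * cnj (m w)"]
    by (simp only: plus_complex.sel)
  moreover have "\<kappa> * s\<^sup>2 \<le> Re (l v * cnj (m v))" by (rule deep_Re[OF v l m])
  moreover have "s * (t * s) + (t * s) * s + (t * s) * (t * s) \<le> \<kappa> * s\<^sup>2"
  proof -
    have "s * (t * s) + (t * s) * s + (t * s) * (t * s) = (2 * t + t * t) * s\<^sup>2"
      by (simp add: power2_eq_square algebra_simps)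
    also have "\<dots> \<le> \<kappa> * s\<^sup>2" using tt t by (intro mult_right_mono) auto
    finally show ?thesis .
  qed
  ultimately show "0 \<le> Re (l (v + w) * cnj (m (v + w)))" using n by linarith
qed

section \<open>Iterates and the shrinking of disks\<close>

lemma funpow_deep:
  assumes "v \<in> \<C>" "v \<noteq> 0"
  shows "\<exists>s. deep s ((M ^^ Suc n) v)"
proof (induction n)
  case 0
  show ?case using M_deep[OF assms] by simp
next
  case (Suc n)
  then obtain s where s: "deep s ((M ^^ Suc n) v)" by blast
  show ?case using M_deep[OF deep_in[OF s] deep_neq_0[OF s]] by simp
qed

lemma funpow_cone:
  assumes "v \<in> \<C>" "v \<noteq> 0"
  shows "(M ^^ n) v \<in> \<C>" "(M ^^ n) v \<noteq> 0"
  using funpow_deep[OF assms] deep_in deep_neq_0 assms by (cases n; force)+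

text \<open>The loss is \<open>\<kappa> / 3\<close>, the tolerance of \<open>deep_perturb\<close>,
  times the distance \<open>\<delta> = \<kappa> ^ 3 / 6\<close> that separates the two cases of the
  next lemma.\<close>

definition rate :: real where "rate = 1 - \<kappa> ^ 4 / 18"

text \<open>The conclusions serve different ends: the first becomes a norm estimate through
  \<open>F_norming\<close>, the second is a hypothesis of the same kind for the images and can be
  iterated.\<close>

lemma contraction_centered:
  assumes h: "h \<in> \<C>" "h \<noteq> 0" and R: "0 < R"
    and dom: "\<And>z. R \<le> norm z \<Longrightarrow> z *\<^sub>C h - v \<in> \<C>"
  obtains c where "\<And>l. l \<in> F \<Longrightarrow> norm (l (M v - c *\<^sub>C M h)) \<le> R * norm (l (M h))"
    and "\<And>z. rate * R \<le> norm (z - c) \<Longrightarrow> z *\<^sub>C M h - M v \<in> \<C>"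
proof (cases "\<exists>c. v = c *\<^sub>C h")
  \<comment> \<open>Here \<open>z h - v\<close> vanishes for one \<open>z\<close>, where
    \<open>M_deep\<close> says nothing; but all \<open>z M h - M v\<close> are multiples of the deep
    vector \<open>M h\<close>.\<close>
  case True
  then obtain c where c: "v = c *\<^sub>C h" by blast
  obtain s where "deep s (M h)" using M_deep[OF h] by blast
  then have "z *\<^sub>C M h - M v \<in> \<C>" for z
    using cone_scale[OF deep_in, of s "M h" "z - c"] by (simp add: c M_scale scaleC_simps)
  then show thesis using that[of c] R by (simp add: c M_scale F_zero)
next
  case False
  define H V where "H = M h" and "V = M v"
  obtain s where s: "deep s H" using M_deep[OF h] by (auto simp: H_def)
  have \<kappa>1: "\<kappa> \<le> 1" by (rule kappa_le_1[OF s])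
  have "\<exists>t. deep t (z *\<^sub>C H - V)" if "R \<le> norm z" for z
  proof -
    have "z *\<^sub>C h - v \<noteq> 0" using False by auto
    then show ?thesis using M_deep[OF dom[OF that]] by (simp add: H_def V_def M_minus M_scale)
  qed
  then obtain t where t: "\<And>z. R \<le> norm z \<Longrightarrow> deep (t z) (z *\<^sub>C H - V)" by metis
  define r where "r l = l V / l H" for l :: "'x \<Rightarrow> complex"
  have lH: "l H \<noteq> 0" "\<kappa> * s \<le> norm (l H)" "norm (l H) \<le> s" if "l \<in> F" for l
    using deep_nonzero[OF s that] deep_lower[OF s that] deep_upper[OF s that] by auto
  have l_eq: "l (z *\<^sub>C H - V) = l H * (z - r l)" if "l \<in> F" for l z
    using lH(1)[OF that] by (simp add: F_minus F_scale that r_def field_simps)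
  \<comment> \<open>\<open>r l\<close> is the one \<open>z\<close> at which \<open>l\<close>
    vanishes on \<open>z H - V\<close>, and functionals do not vanish on deep vectors.\<close>
  have r_less: "norm (r l) < R" if l: "l \<in> F" for l
  proof (rule ccontr)
    assume "\<not> norm (r l) < R"
    then have "deep (t (r l)) (r l *\<^sub>C H - V)" by (intro t) simp
    from deep_nonzero[OF this l] show False by (simp add: l_eq[OF l])
  qed
  \<comment> \<open>Both \<open>H\<close> and \<open>z H - V\<close> are deep, so the values of each
    are comparable up to a factor \<open>\<kappa>\<close>.\<close>
  have compare: "norm (z - r l) \<le> norm (z - r m) / \<kappa>\<^sup>2" if z: "R \<le> norm z" and l: "l \<in> F" and m: "m \<in> F" for z l m
  proof -
    have "(\<kappa> * s) * norm (z - r l) \<le> norm (l H) * norm (z - r l)"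
      using lH[OF l] by (intro mult_right_mono) auto
    also have "\<dots> \<le> t z" using deep_upper[OF t[OF z] l] by (simp add: l_eq[OF l] norm_mult)
    also have "\<dots> \<le> norm (m H) * norm (z - r m) / \<kappa>"
      using deep_lower[OF t[OF z] m] \<kappa> by (simp add: l_eq[OF m] norm_mult pos_le_divide_eq mult.commute)
    also have "\<dots> \<le> s * norm (z - r m) / \<kappa>"
      using lH[OF m] \<kappa> by (intro divide_right_mono mult_right_mono) auto
    finally show ?thesis using deep_pos[OF s] \<kappa> by (simp add: field_simps power2_eq_square)
  qed
  \<comment> \<open>Chosen so that \<open>\<delta> / \<kappa>\<^sup>2 = \<kappa> / 6\<close>: once
    one ratio is within \<open>\<delta> * R\<close> of the circle, \<open>compare\<close> puts all
    of them within \<open>\<kappa> / 6 * R\<close> of one point of it, half of what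
    \<open>deep_perturb\<close> tolerates.\<close>
  define \<delta> where "\<delta> = \<kappa> ^ 3 / 6"
  have \<delta>: "0 < \<delta>" "\<delta> < 1" using \<kappa> \<kappa>1 power_le_one[of \<kappa> 3] by (auto simp: \<delta>_def)
  have k4: "0 < \<kappa> ^ 4" "\<kappa> ^ 4 \<le> 1" using \<kappa> \<kappa>1 power_le_one[of \<kappa> 4] by auto
  show thesis
  proof (cases "\<forall>l\<in>F. norm (r l) \<le> (1 - \<delta>) * R")
    case True
    have "norm (l (M v - 0 *\<^sub>C M h)) \<le> R * norm (l (M h))" if l: "l \<in> F" for l
    proof -
      have "norm (l V) = norm (r l) * norm (l H)" using lH[OF l] by (simp add: r_def norm_divide)
      also have "\<dots> \<le> R * norm (l H)" using r_less[OF l] by (intro mult_right_mono) auto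
      finally show ?thesis by (simp add: H_def V_def scaleC_simps)
    qed
    moreover have "z *\<^sub>C M h - M v \<in> \<C>" if z: "rate * R \<le> norm (z - 0)" for z
    proof (cases "R \<le> norm z")
      case True
      from deep_in[OF t[OF this]] show ?thesis by (simp add: H_def V_def)
    next
      case False
      have z0: "0 < norm z"
        using z R k4 by (intro less_le_trans[of _ "rate * R" "norm z"]) (auto simp: rate_def)
      \<comment> \<open>Radial projection to the circle, where \<open>z' H - V\<close> is deep. All
        ratios keep the distance \<open>\<delta> * R\<close> from \<open>z'\<close>, which makes
        \<open>t z'\<close> large enough to absorb \<open>(z - z') H\<close>.\<close>
      define z' where "z' = (R / norm z) *\<^sub>R z"
      have nz': "norm z' = R" using z0 R by (simp add: z'_def)
      have "z - z' = (1 - R / norm z) *\<^sub>R z" by (simp add: z'_def scaleR_left_diff_distrib)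
      then have "norm (z - z') = \<bar>1 - R / norm z\<bar> * norm z" by simp
      also have "\<dots> = R - norm z" using z0 False by (simp add: abs_if field_simps)
      also have "\<dots> \<le> \<kappa> ^ 4 / 18 * R" using z by (simp add: rate_def algebra_simps)
      finally have zz': "norm (z - z') \<le> \<kappa> ^ 4 / 18 * R" .
      have tz': "deep (t z') (z' *\<^sub>C H - V)" using nz' by (intro t) simp
      have "(z' *\<^sub>C H - V) + (z - z') *\<^sub>C H \<in> \<C>"
      proof (rule deep_perturb[OF tz', of "\<kappa> / 3"])
        fix l assume l: "l \<in> F"
        have "\<delta> * R \<le> norm (z' - r l)"
          using True l norm_triangle_ineq2[of z' "r l"] nz' by (force simp: algebra_simps)
        then have "norm (l H) * (\<delta> * R) \<le> norm (l H) * norm (z' - r l)" by (rule mult_left_mono) simp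
        also have "\<dots> \<le> t z'" using deep_upper[OF tz' l] by (simp add: l_eq[OF l] norm_mult)
        finally have 1: "norm (l H) * (\<delta> * R) \<le> t z'" .
        have "norm (l ((z - z') *\<^sub>C H)) \<le> \<kappa> ^ 4 / 18 * R * norm (l H)"
          unfolding F_scale[OF l] norm_mult by (rule mult_right_mono[OF zz']) simp
        also have "\<dots> = \<kappa> / 3 * (norm (l H) * (\<delta> * R))" by (simp add: \<delta>_def power_numeral_reduce)
        also have "\<dots> \<le> \<kappa> / 3 * t z'" using 1 \<kappa> by (intro mult_left_mono) auto
        finally show "norm (l ((z - z') *\<^sub>C H)) \<le> \<kappa> / 3 * t z'" .
      qed simp
      then show ?thesis by (simp add: scaleC_simps H_def V_def)
    qed
    ultimately show ?thesis by (rule that)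
  next
    case False
    then obtain l0 where l0: "l0 \<in> F" "(1 - \<delta>) * R < norm (r l0)" by auto
    have nr: "0 < norm (r l0)" using l0(2) \<delta> R by (meson diff_gt_0_iff_gt less_trans mult_pos_pos)
    \<comment> \<open>The new centre is the point of the circle nearest to \<open>r l0\<close>;
      being on the circle, it is admissible in \<open>compare\<close>.\<close>
    define c where "c = (R / norm (r l0)) *\<^sub>R r l0"
    have nc: "norm c = R" using nr R by (simp add: c_def)
    have "c - r l0 = (R / norm (r l0) - 1) *\<^sub>R r l0" by (simp add: c_def scaleR_left_diff_distrib)
    then have "norm (c - r l0) = \<bar>R / norm (r l0) - 1\<bar> * norm (r l0)" by simp
    also have "\<dots> = R - norm (r l0)" using nr r_less[OF l0(1)] by (simp add: abs_if field_simps)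
    also have "\<dots> \<le> \<delta> * R" using l0(2) by (simp add: algebra_simps)
    finally have c0: "norm (c - r l0) \<le> \<delta> * R" .
    have cl: "norm (c - r l) \<le> \<kappa> / 6 * R" if l: "l \<in> F" for l
    proof -
      have "norm (c - r l) \<le> norm (c - r l0) / \<kappa>\<^sup>2" using nc by (intro compare l l0) simp
      also have "\<dots> \<le> \<delta> * R / \<kappa>\<^sup>2" by (rule divide_right_mono[OF c0]) simp
      also have "\<dots> = \<kappa> / 6 * R" using \<kappa> by (simp add: \<delta>_def power_numeral_reduce)
      finally show ?thesis .
    qed
    have lc: "l (V - c *\<^sub>C H) = l H * (r l - c)" if l: "l \<in> F" for l
      using lH(1)[OF l] by (simp add: F_minus F_scale l r_def field_simps)
    have "norm (l (M v - c *\<^sub>C M h)) \<le> R * norm (l (M h))" if l: "l \<in> F" for l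
    proof -
      have "norm (l (V - c *\<^sub>C H)) = norm (c - r l) * norm (l H)"
        by (simp add: lc[OF l] norm_mult norm_minus_commute)
      also have "\<dots> \<le> R * norm (l H)"
        using order_trans[OF cl[OF l], of "1 * R"] \<kappa>1 R by (intro mult_right_mono) auto
      finally show ?thesis by (simp add: H_def V_def)
    qed
    moreover have "z *\<^sub>C M h - M v \<in> \<C>" if z: "rate * R \<le> norm (z - c)" for z
    proof -
      \<comment> \<open>This case asks only for half the radius; the value of \<open>rate\<close> is
        dictated by the other case.\<close>
      have "1 / 2 * R \<le> rate * R" using R k4 by (intro mult_right_mono) (auto simp: rate_def)
      then have zc: "1 / 2 * R \<le> norm (z - c)" using z by linarith
      then have "z - c \<noteq> 0" using R by auto
      have "(z - c) *\<^sub>C H + (c *\<^sub>C H - V) \<in> \<C>"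
      proof (rule deep_perturb[OF deep_scale[OF s \<open>z - c \<noteq> 0\<close>], of "\<kappa> / 3"])
        fix l assume l: "l \<in> F"
        have "norm (l (c *\<^sub>C H - V)) = norm (l H) * norm (c - r l)" by (simp add: l_eq[OF l] norm_mult)
        also have "\<dots> \<le> s * (\<kappa> / 6 * R)" using lH[OF l] cl[OF l] deep_pos[OF s] by (intro mult_mono) auto
        also have "\<dots> = \<kappa> / 3 * (1 / 2 * R * s)" by simp
        also have "\<dots> \<le> \<kappa> / 3 * (norm (z - c) * s)"
          using \<kappa> deep_pos[OF s] by (intro mult_left_mono mult_right_mono zc) auto
        finally show "norm (l (c *\<^sub>C H - V)) \<le> \<kappa> / 3 * (norm (z - c) * s)" .
      qed simp
      then show ?thesis by (simp add: scaleC_simps H_def V_def)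
    qed
    ultimately show ?thesis by (rule that)
  qed
qed

lemma rate_bounds: "17 / 18 \<le> rate" "rate < 1"
proof -
  obtain v where "v \<in> \<C>" "v \<noteq> 0" using cone_nontrivial by blast
  then obtain s where "deep s (M v)" using M_deep by blast
  from kappa_le_1[OF this] show "17 / 18 \<le> rate" "rate < 1"
    using \<kappa> power_le_one[of \<kappa> 4] by (auto simp: rate_def)
qed

text \<open>Subtracting \<open>c h\<close> from \<open>v\<close> translates the disk to the origin.
  The new centre is not controlled; only the radius matters.\<close>

lemma contraction:
  assumes h: "h \<in> \<C>" "h \<noteq> 0" and R: "0 < R"
    and dom: "\<And>z. R \<le> norm (z - c) \<Longrightarrow> z *\<^sub>C h - v \<in> \<C>"
  obtains c' where "\<And>l. l \<in> F \<Longrightarrow> norm (l (M v - c' *\<^sub>C M h)) \<le> R * norm (l (M h))"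
    and "\<And>z. rate * R \<le> norm (z - c') \<Longrightarrow> z *\<^sub>C M h - M v \<in> \<C>"
proof -
  have "z *\<^sub>C h - (v - c *\<^sub>C h) \<in> \<C>" if "R \<le> norm z" for z
    using dom[of "z + c"] that by (simp add: scaleC_simps algebra_simps)
  from contraction_centered[OF h R this] obtain c1 where
    c1: "\<And>l. l \<in> F \<Longrightarrow> norm (l (M (v - c *\<^sub>C h) - c1 *\<^sub>C M h)) \<le> R * norm (l (M h))"
      "\<And>z. rate * R \<le> norm (z - c1) \<Longrightarrow> z *\<^sub>C M h - M (v - c *\<^sub>C h) \<in> \<C>"
    by blast
  show thesis
  proof (rule that[of "c + c1"])
    show "norm (l (M v - (c + c1) *\<^sub>C M h)) \<le> R * norm (l (M h))" if "l \<in> F" for l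
      using c1(1)[OF that] by (simp add: M_minus M_scale scaleC_simps algebra_simps)
    show "z *\<^sub>C M h - M v \<in> \<C>" if "rate * R \<le> norm (z - (c + c1))" for z
      using c1(2)[of "z - c"] that by (simp add: M_minus M_scale scaleC_simps algebra_simps)
  qed
qed

lemma contraction_funpow:
  assumes h: "h \<in> \<C>" "h \<noteq> 0" and R: "0 < R"
    and dom: "\<And>z. R \<le> norm z \<Longrightarrow> z *\<^sub>C h - v \<in> \<C>"
  shows "\<exists>c. \<forall>z. rate ^ n * R \<le> norm (z - c) \<longrightarrow> z *\<^sub>C (M ^^ n) h - (M ^^ n) v \<in> \<C>"
proof (induction n)
  case 0
  show ?case using dom by (intro exI[of _ 0]) simp
next
  case (Suc n)
  then obtain c where c: "\<And>z. rate ^ n * R \<le> norm (z - c) \<Longrightarrow> z *\<^sub>C (M ^^ n) h - (M ^^ n) v \<in> \<C>" by blast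
  have "0 < rate ^ n * R" using R rate_bounds by simp
  from contraction[OF funpow_cone[OF h] this c] obtain c' where
    "\<And>z. rate * (rate ^ n * R) \<le> norm (z - c') \<Longrightarrow> z *\<^sub>C M ((M ^^ n) h) - M ((M ^^ n) v) \<in> \<C>" by blast
  then show ?case by (intro exI[of _ c']) (simp add: mult.assoc)
qed

text \<open>The three estimates below hold with one constant for all \<open>h\<close> deep in the cone, whatever their size;
  this uniformity lets them be applied along an orbit.\<close>

lemma deep_dominates:
  assumes h: "deep s h" and z: "3 * B\<^sup>2 / \<kappa> * (norm v / norm h) \<le> norm z" and "z \<noteq> 0"
  shows "z *\<^sub>C h - v \<in> \<C>"
proof -
  have nh: "0 < norm h" using deep_neq_0[OF h] by simp
  have s: "0 < s" by (rule deep_pos[OF h])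
  \<comment> \<open>Origin of the radius: \<open>B * norm v\<close>, the bound for the values of
    \<open>v\<close>, must not exceed \<open>\<kappa> / 3 * (norm z * s)\<close>, and
    \<open>deep_norm\<close> gives \<open>norm h / B <= s\<close>.\<close>
  have "z *\<^sub>C h + (- v) \<in> \<C>"
  proof (rule deep_perturb[OF deep_scale[OF h \<open>z \<noteq> 0\<close>], of "\<kappa> / 3"])
    fix l assume l: "l \<in> F"
    have "norm (l (- v)) \<le> B * norm v" using F_bound[OF l, of "- v"] by simp
    also have "\<dots> = \<kappa> / 3 * ((3 * B\<^sup>2 / \<kappa> * (norm v / norm h)) * (norm h / B))"
      using \<kappa> B nh by (simp add: field_simps power2_eq_square)
    also have "\<dots> \<le> \<kappa> / 3 * (norm z * s)"
      using \<kappa> B nh s deep_norm[OF h] z by (intro mult_left_mono mult_mono) (auto simp: field_simps)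
    finally show "norm (l (- v)) \<le> \<kappa> / 3 * (norm z * s)" .
  qed simp
  then show ?thesis by simp
qed

lemma orbit_contraction:
  obtains K where "0 \<le> K" and
    "\<And>h s v n. deep s h \<Longrightarrow> \<exists>c. norm ((M ^^ n) v - c *\<^sub>C (M ^^ n) h) \<le> K * rate ^ n * (norm v / norm h) * norm ((M ^^ n) h)"
proof -
  define B1 where "B1 = 3 * B\<^sup>2 / \<kappa>"
  \<comment> \<open>The summand 1 covers \<open>v = 0\<close> and \<open>n = 0\<close>. Otherwise
    the disk shrinks \<open>n - 1\<close> times and the last step is spent on the first conclusion
    of \<open>contraction\<close>, hence the division by \<open>rate\<close>; the outer factors
    \<open>B\<close> pass from norm to functionals and back.\<close>
  define K where "K = 1 + B * B1 * B / rate"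
  have B1: "0 < B1" using B \<kappa> by (simp add: B1_def)
  have rate: "0 < rate" using rate_bounds by simp
  have K: "1 \<le> K" using B B1 rate by (simp add: K_def)
  have "\<exists>c. norm ((M ^^ n) v - c *\<^sub>C (M ^^ n) h) \<le> K * rate ^ n * (norm v / norm h) * norm ((M ^^ n) h)"
    if h: "deep s h" for h s v n
  proof (cases "v = 0 \<or> n = 0")
    case True
    have v: "norm v \<le> K * norm v" using K mult_right_mono[of 1 K "norm v"] by simp
    have "norm h \<noteq> 0" using deep_neq_0[OF h] by simp
    then show ?thesis using True v Mn_scale[of _ 0 0] by (intro exI[of _ 0]) (auto simp: scaleC_simps)
  next
    case False
    then obtain k where k: "n = Suc k" and v: "v \<noteq> 0" by (cases n) auto
    have nh: "0 < norm h" using deep_neq_0[OF h] by simp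
    define R where "R = B1 * (norm v / norm h)"
    have R: "0 < R" using B1 v nh by (simp add: R_def)
    have hC: "h \<in> \<C>" "h \<noteq> 0" using deep_in[OF h] deep_neq_0[OF h] by auto
    have "z *\<^sub>C h - v \<in> \<C>" if "R \<le> norm z" for z
      using that R by (intro deep_dominates[OF h]) (auto simp: R_def B1_def)
    from contraction_funpow[OF hC R this] obtain c where
      c: "\<And>z. rate ^ k * R \<le> norm (z - c) \<Longrightarrow> z *\<^sub>C (M ^^ k) h - (M ^^ k) v \<in> \<C>" by blast
    have "0 < rate ^ k * R" using R rate by simp
    from contraction[OF funpow_cone[OF hC] this c] obtain c' where
      "\<And>l. l \<in> F \<Longrightarrow> norm (l (M ((M ^^ k) v) - c' *\<^sub>C M ((M ^^ k) h))) \<le> rate ^ k * R * norm (l (M ((M ^^ k) h)))"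
      by blast
    then have c': "norm (l ((M ^^ n) v - c' *\<^sub>C (M ^^ n) h)) \<le> rate ^ k * R * norm (l ((M ^^ n) h))" if "l \<in> F" for l
      using that by (simp add: k)
    have "norm ((M ^^ n) v - c' *\<^sub>C (M ^^ n) h) \<le> B * (rate ^ k * R * (B * norm ((M ^^ n) h)))"
      using R rate by (intro F_norming order_trans[OF c'] mult_left_mono F_bound) auto
    also have "\<dots> = (B * B1 * B / rate) * (rate ^ n * (norm v / norm h) * norm ((M ^^ n) h))"
      using rate by (simp add: R_def k)
    also have "\<dots> \<le> K * (rate ^ n * (norm v / norm h) * norm ((M ^^ n) h))"
      using rate by (intro mult_right_mono) (auto simp: K_def)
    finally show ?thesis by (intro exI[of _ c']) (simp add: mult.assoc)
  qed
  then show thesis using that[of K] K by auto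
qed

lemma orbit_bound:
  obtains K where "0 \<le> K" and
    "\<And>h s v n. deep s h \<Longrightarrow> norm ((M ^^ n) v) \<le> K * (norm v / norm h) * norm ((M ^^ n) h)"
proof -
  define B1 where "B1 = 3 * B\<^sup>2 / \<kappa>"
  define K where "K = 1 + B * B1 * B"
  have B1: "0 < B1" using B \<kappa> by (simp add: B1_def)
  have K: "1 \<le> K" using B B1 by (simp add: K_def)
  have "norm ((M ^^ n) v) \<le> K * (norm v / norm h) * norm ((M ^^ n) h)"
    if h: "deep s h" for h s v n
  proof (cases "v = 0 \<or> n = 0")
    case True
    have v: "norm v \<le> K * norm v" using K mult_right_mono[of 1 K "norm v"] by simp
    have "norm h \<noteq> 0" using deep_neq_0[OF h] by simp
    then show ?thesis using True v Mn_scale[of _ 0 0] by (auto simp: scaleC_simps)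
  next
    case False
    then obtain k where k: "n = Suc k" and v: "v \<noteq> 0" by (cases n) auto
    have nh: "0 < norm h" using deep_neq_0[OF h] by simp
    define R where "R = B1 * (norm v / norm h)"
    have R: "0 < R" using B1 v nh by (simp add: R_def)
    have hC: "h \<in> \<C>" "h \<noteq> 0" using deep_in[OF h] deep_neq_0[OF h] by auto
    have "norm (l ((M ^^ n) v)) \<le> R * norm (l ((M ^^ n) h))" if l: "l \<in> F" for l
    proof (rule ccontr)
      assume "\<not> ?thesis"
      moreover have lh: "l ((M ^^ n) h) \<noteq> 0"
        using funpow_deep[OF hC, of k] deep_nonzero[OF _ l] k by blast
      \<comment> \<open>With this quotient, \<open>l\<close> vanishes on the \<open>n\<close>-th
        image of \<open>?z h - v\<close>. Being large, \<open>?z\<close> puts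
        \<open>?z h - v\<close> into the cone, so unless this vector is 0, its image is deep and
        \<open>l\<close> cannot vanish there.\<close>
      ultimately have z: "R < norm (l ((M ^^ n) v) / l ((M ^^ n) h))" (is "R < norm ?z")
        by (simp add: norm_divide field_simps)
      have zC: "?z *\<^sub>C h - v \<in> \<C>"
        using z R by (intro deep_dominates[OF h]) (auto simp: R_def B1_def)
      show False
      proof (cases "?z *\<^sub>C h - v = 0")
        case True
        then have "norm v = norm ?z * norm h" by (simp flip: norm_scaleC)
        \<comment> \<open>In the degenerate case \<open>v = ?z h\<close>, the size of
          \<open>?z\<close> contradicts this bound, which amounts to 1 \<le> B1.\<close>
        moreover have "norm v \<le> R * norm h"
        proof -
          have "norm h \<le> B / \<kappa> * norm (l h)" by (rule deep_norm_le[OF h l])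
          also have "\<dots> \<le> B / \<kappa> * (B * norm h)" using B \<kappa> by (intro mult_left_mono F_bound l) auto
          finally have "1 * norm h \<le> B\<^sup>2 / \<kappa> * norm h" by (simp add: power2_eq_square)
          then have "1 \<le> B\<^sup>2 / \<kappa>" using nh by (simp only: mult_le_cancel_right_pos)
          then have "1 \<le> B1" by (simp add: B1_def)
          then have "1 * norm v \<le> B1 * norm v" by (rule mult_right_mono) simp
          then show ?thesis using nh by (simp add: R_def)
        qed
        ultimately show False using z nh by simp
      next
        case False
        from funpow_deep[OF zC False, of k] obtain t where "deep t ((M ^^ n) (?z *\<^sub>C h - v))" unfolding k by blast
        from deep_nonzero[OF this l] show False
          using lh by (simp add: Mn_minus Mn_scale F_minus F_scale l)
      qed
    qed
    then have "norm ((M ^^ n) v) \<le> B * (R * (B * norm ((M ^^ n) h)))"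
      using R by (intro F_norming order_trans[OF _ mult_left_mono[OF F_bound]]) auto
    also have "\<dots> = (B * B1 * B) * ((norm v / norm h) * norm ((M ^^ n) h))"
      by (simp add: R_def)
    also have "\<dots> \<le> K * ((norm v / norm h) * norm ((M ^^ n) h))"
      by (intro mult_right_mono) (auto simp: K_def)
    finally show ?thesis by (simp add: mult.assoc)
  qed
  then show thesis using that[of K] K by auto
qed


section \<open>The eigenvector and the invariant functional\<close>

lemma eigenvector:
  obtains k \<mu> s l where "deep s k" "M k = \<mu> *\<^sub>C k" "\<mu> \<noteq> 0" "l \<in> F" "l k = 1"
proof -
  obtain l where l: "l \<in> F" using F_nonempty by blast
  obtain e where e: "e \<in> \<C>" "e \<noteq> 0" using cone_nontrivial by blast
  \<comment> \<open>The orbit starts at \<open>M e\<close>, since the orbit estimates ask for a deep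
    vector and \<open>e\<close> is only in the cone.\<close>
  define h where "h n = (M ^^ Suc n) e" for n
  have "\<exists>s. deep s (h n)" for n unfolding h_def by (rule funpow_deep[OF e])
  then obtain s where s: "\<And>n. deep (s n) (h n)" by metis
  have hS: "M (h n) = h (Suc n)" for n by (simp add: h_def)
  have h0: "(M ^^ n) (h 0) = h n" and h1: "(M ^^ n) (h (Suc 0)) = h (Suc n)" for n
    by (simp_all add: h_def funpow_swap1)
  have nh: "0 < norm (h n)" for n using deep_neq_0[OF s] by simp
  define \<beta> where "\<beta> n = l (h n)" for n
  have \<beta>: "\<beta> n \<noteq> 0" for n unfolding \<beta>_def by (rule deep_nonzero[OF s l])
  have h_le: "norm (h n) \<le> B / \<kappa> * norm (\<beta> n)" for n unfolding \<beta>_def by (rule deep_norm_le[OF s l])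
  obtain K where K: "0 \<le> K" "\<And>h s v n. deep s h \<Longrightarrow> \<exists>c. norm ((M ^^ n) v - c *\<^sub>C (M ^^ n) h) \<le> K * rate ^ n * (norm v / norm h) * norm ((M ^^ n) h)"
    by (rule orbit_contraction) blast
  obtain K' where K': "0 \<le> K'" "\<And>h s v n. deep s h \<Longrightarrow> norm ((M ^^ n) v) \<le> K' * (norm v / norm h) * norm ((M ^^ n) h)"
    by (rule orbit_bound) blast
  define K1 where "K1 = K * (norm (h (Suc 0)) / norm (h 0))"
  define K2 where "K2 = K' * (norm (h 0) / norm (h (Suc 0)))"
  have K1: "0 \<le> K1" using K by (simp add: K1_def)
  \<comment> \<open>\<open>orbit_bound\<close> with the later vector as reference: one step cannot
    make the orbit collapse. This turns errors relative to \<open>h n\<close> into errors relative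
    to \<open>\<beta> (Suc n)\<close>.\<close>
  have K2: "norm (h n) \<le> K2 * norm (h (Suc n))" for n
    using K'(2)[OF s[of "Suc 0"], where v = "h 0" and n = n] unfolding h0 h1 K2_def by simp
  have "0 < K2" using K2[of 0] nh[of 0] nh[of "Suc 0"] by (metis less_le_trans zero_less_mult_pos2)
  define k where "k n = (1 / \<beta> n) *\<^sub>C h n" for n
  define C where "C = K2 * (B / \<kappa>) * K1 * (1 + B * (B / \<kappa>))"
  have "norm (k (Suc n) - k n) \<le> C * rate ^ n" for n
  proof -
    \<comment> \<open>The orbit of \<open>h 1\<close> is that of \<open>h 0\<close> shifted by one,
      so contraction makes consecutive iterates nearly proportional.\<close>
    obtain c where c: "norm (h (Suc n) - c *\<^sub>C h n) \<le> K1 * rate ^ n * norm (h n)"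
      using K(2)[OF s[of 0], where v = "h (Suc 0)" and n = n] by (auto simp: h0 h1 K1_def mult_ac)
    define d where "d = h (Suc n) - c *\<^sub>C h n"
    have d: "norm d \<le> K1 * rate ^ n * norm (h n)" using c by (simp add: d_def)
    have ld: "l d = \<beta> (Suc n) - c * \<beta> n" by (simp add: d_def F_minus F_scale l \<beta>_def)
    have hd: "h (Suc n) = d + c *\<^sub>C h n" by (simp add: d_def)
    have "c / \<beta> (Suc n) - 1 / \<beta> n = - (1 / \<beta> (Suc n) * (l d / \<beta> n))"
      using \<beta>[of n] \<beta>[of "Suc n"] by (simp add: ld field_simps)
    moreover have "k (Suc n) - k n = (1 / \<beta> (Suc n)) *\<^sub>C d + (c / \<beta> (Suc n) - 1 / \<beta> n) *\<^sub>C h n"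
      by (simp add: k_def hd scaleC_simps)
    ultimately have "k (Suc n) - k n = (1 / \<beta> (Suc n)) *\<^sub>C (d - (l d / \<beta> n) *\<^sub>C h n)"
      by (simp add: scaleC_simps)
    then have "norm (k (Suc n) - k n) \<le> 1 / norm (\<beta> (Suc n)) * (norm d + norm (l d) * (norm (h n) / norm (\<beta> n)))"
      using norm_triangle_ineq4[of d "(l d / \<beta> n) *\<^sub>C h n"]
      by (simp add: norm_scaleC norm_divide divide_right_mono)
    also have "\<dots> \<le> 1 / norm (\<beta> (Suc n)) * (norm d + (B * norm d) * (B / \<kappa>))"
      using \<beta>[of n] h_le[of n] B by (intro mult_left_mono add_mono mult_mono F_bound l) (auto simp: divide_le_eq)
    also have "\<dots> = 1 / norm (\<beta> (Suc n)) * (norm d * (1 + B * (B / \<kappa>)))" by (simp add: algebra_simps)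
    also have "\<dots> \<le> 1 / norm (\<beta> (Suc n)) * ((K1 * rate ^ n * norm (h n)) * (1 + B * (B / \<kappa>)))"
      using B \<kappa> by (intro mult_left_mono mult_right_mono d) auto
    also have "\<dots> = (norm (h n) / norm (\<beta> (Suc n))) * (K1 * rate ^ n * (1 + B * (B / \<kappa>)))" by simp
    also have "\<dots> \<le> (K2 * (B / \<kappa>)) * (K1 * rate ^ n * (1 + B * (B / \<kappa>)))"
    proof (rule mult_right_mono)
      have "norm (h n) \<le> K2 * (B / \<kappa> * norm (\<beta> (Suc n)))"
        using K2[of n] mult_left_mono[OF h_le[of "Suc n"], of K2] \<open>0 < K2\<close> by linarith
      then show "norm (h n) / norm (\<beta> (Suc n)) \<le> K2 * (B / \<kappa>)"
        using \<beta>[of "Suc n"] by (simp add: divide_le_eq mult.assoc)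
      show "0 \<le> K1 * rate ^ n * (1 + B * (B / \<kappa>))" using K1 B \<kappa> rate_bounds by simp
    qed
    finally show ?thesis by (simp add: C_def mult_ac)
  qed
  from geometric_increments_converge[OF this] rate_bounds obtain k' where k': "k \<longlonglongrightarrow> k'" by auto
  have lim: "(\<lambda>n. m (k n)) \<longlonglongrightarrow> m k'" if "m \<in> F" for m
    by (rule bounded_linear.tendsto[OF F_bounded_linear[OF that] k'])
  have "l (k n) = 1" for n using \<beta>[of n] by (simp add: k_def F_scale l \<beta>_def)
  then have lk': "l k' = 1" using lim[OF l] by (simp add: LIMSEQ_const_iff)
  then have "k' \<noteq> 0" using F_zero[OF l] by auto
  have kC: "k n \<in> \<C>" for n unfolding k_def by (rule cone_scale[OF deep_in[OF s]])
  \<comment> \<open>The cone is closed: its inequalities are weak and the functionals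
    continuous.\<close>
  have "k' \<in> \<C>"
    unfolding complex_cone_def
  proof (intro CollectI ballI)
    fix l1 l2 assume F: "l1 \<in> F" "l2 \<in> F"
    have "(\<lambda>n. Re (l1 (k n) * cnj (l2 (k n)))) \<longlonglongrightarrow> Re (l1 k' * cnj (l2 k'))"
      by (intro tendsto_intros lim F)
    then show "0 \<le> Re (l1 k' * cnj (l2 k'))"
      by (rule LIMSEQ_le_const) (use kC F in \<open>auto simp: complex_cone_def\<close>)
  qed
  then obtain t where t: "deep t (M k')" using M_deep \<open>k' \<noteq> 0\<close> by blast
  define \<mu> where "\<mu> = l (M k')"
  have "\<mu> \<noteq> 0" unfolding \<mu>_def by (rule deep_nonzero[OF t l])
  have Mk: "(\<lambda>n. M (k n)) \<longlonglongrightarrow> M k'" by (rule bounded_linear.tendsto[OF bounded_clinearD(1)[OF M] k'])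
  have Mk_eq: "M (k n) = l (M (k n)) *\<^sub>C k (Suc n)" for n
    using \<beta>[of n] \<beta>[of "Suc n"] by (simp add: k_def M_scale hS F_scale l scaleC_simps flip: \<beta>_def)
  have "(\<lambda>n. l (M (k n))) \<longlonglongrightarrow> \<mu>"
    unfolding \<mu>_def by (rule bounded_linear.tendsto[OF F_bounded_linear[OF l] Mk])
  moreover have "(\<lambda>n. k (Suc n)) \<longlonglongrightarrow> k'" by (rule LIMSEQ_Suc[OF k'])
  ultimately have "(\<lambda>n. l (M (k n)) *\<^sub>C k (Suc n)) \<longlonglongrightarrow> \<mu> *\<^sub>C k'"
    by (rule tendsto_scaleC)
  then have "M k' = \<mu> *\<^sub>C k'" using Mk LIMSEQ_unique by (simp flip: Mk_eq)
  \<comment> \<open>\<open>k'\<close> is a multiple of its own image, hence deep and not merely in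
    the cone.\<close>
  moreover have "deep (norm (1 / \<mu>) * t) k'"
    using deep_scale[OF t, of "1 / \<mu>"] \<open>\<mu> \<noteq> 0\<close> calculation by (simp add: scaleC_simps)
  ultimately show thesis using that l lk' \<open>\<mu> \<noteq> 0\<close> by blast
qed

text \<open>The normalised iterates \<open>a n v\<close> approach the line of \<open>k\<close>. As
  \<open>l k = 1\<close>, the functional \<open>l\<close> reads off their coefficient, whose limit
  is \<open>\<nu> v\<close>.\<close>

theorem spectral_gap: "has_spectral_gap M"
proof -
  obtain k \<mu> s l where k: "deep s k" "M k = \<mu> *\<^sub>C k" and \<mu>: "\<mu> \<noteq> 0" and l: "l \<in> F" "l k = 1"
    by (rule eigenvector)
  obtain K where K: "0 \<le> K" "\<And>h s v n. deep s h \<Longrightarrow> \<exists>c. norm ((M ^^ n) v - c *\<^sub>C (M ^^ n) h) \<le> K * rate ^ n * (norm v / norm h) * norm ((M ^^ n) h)"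
    by (rule orbit_contraction) blast
  obtain N where N: "0 \<le> N" "\<And>v. norm (M v) \<le> norm v * N"
    using bounded_linear.nonneg_bounded[OF bounded_clinearD(1)[OF M]] by blast
  have nk: "0 < norm k" using deep_neq_0[OF k(1)] by simp
  have rate: "0 \<le> rate" "rate < 1" using rate_bounds by auto
  have Mnk: "(M ^^ n) k = \<mu> ^ n *\<^sub>C k" for n
    by (induction n) (auto simp: M_scale k(2) scaleC_simps mult.commute)
  define a where "a n v = (1 / \<mu>) ^ n *\<^sub>C (M ^^ n) v" for n v
  have a_Suc: "a (Suc n) v = (1 / \<mu>) *\<^sub>C M (a n v)" and aM: "a n (M v) = \<mu> *\<^sub>C a (Suc n) v" for n v
    using \<mu> by (simp_all add: a_def M_scale scaleC_simps funpow_swap1)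
  have Mn: "(M ^^ n) v = \<mu> ^ n *\<^sub>C a n v" for n v
    using \<mu> by (simp add: a_def scaleC_simps power_divide)
  define K1 where "K1 = K + B * K * norm k"
  \<comment> \<open>\<open>orbit_contraction\<close> yields an unspecified coefficient
    \<open>c\<close>; applying \<open>l\<close> to the difference shows that
    \<open>l (a n v)\<close> is equally good.\<close>
  have a_near: "norm (a n v - l (a n v) *\<^sub>C k) \<le> K1 * rate ^ n * norm v" for n v
  proof -
    obtain c where c: "norm ((M ^^ n) v - c *\<^sub>C (M ^^ n) k) \<le> K * rate ^ n * (norm v / norm k) * norm ((M ^^ n) k)"
      using K(2)[OF k(1)] by blast
    have "(M ^^ n) v - c *\<^sub>C (M ^^ n) k = \<mu> ^ n *\<^sub>C (a n v - c *\<^sub>C k)"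
      unfolding Mnk Mn[of n v] by (simp add: scaleC_simps mult.commute)
    then have "norm \<mu> ^ n * norm (a n v - c *\<^sub>C k) \<le> norm \<mu> ^ n * (K * rate ^ n * norm v)"
      using c nk by (simp add: Mnk norm_scaleC norm_power mult_ac)
    then have 1: "norm (a n v - c *\<^sub>C k) \<le> K * rate ^ n * norm v" using \<mu> by simp
    have lk: "l (a n v - c *\<^sub>C k) = l (a n v) - c" by (simp add: F_minus F_scale l)
    have 2: "norm (l (a n v) - c) \<le> B * (K * rate ^ n * norm v)"
      using order_trans[OF F_bound[OF l(1)] mult_left_mono[OF 1 less_imp_le[OF B]]] unfolding lk .
    have "a n v - l (a n v) *\<^sub>C k = (a n v - c *\<^sub>C k) - (l (a n v) - c) *\<^sub>C k" by (simp add: scaleC_simps)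
    then have "norm (a n v - l (a n v) *\<^sub>C k) \<le> norm (a n v - c *\<^sub>C k) + norm (l (a n v) - c) * norm k"
      by (metis norm_triangle_ineq4 norm_scaleC)
    also have "\<dots> \<le> K * rate ^ n * norm v + B * (K * rate ^ n * norm v) * norm k"
      by (intro add_mono 1 mult_right_mono[OF 2]) simp
    finally show ?thesis by (simp add: K1_def algebra_simps)
  qed
  define K2 where "K2 = B * (N / norm \<mu>) * K1"
  \<comment> \<open>\<open>(1 / \<mu>) M\<close> fixes \<open>k\<close>, so only the distance of
    \<open>a n v\<close> from the line of \<open>k\<close> enters.\<close>
  have inc: "norm (l (a (Suc n) v) - l (a n v)) \<le> (K2 * norm v) * rate ^ n" for n v
  proof -
    have "l (a (Suc n) v) - l (a n v) = l ((1 / \<mu>) *\<^sub>C M (a n v - l (a n v) *\<^sub>C k))"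
      using \<mu> by (simp add: a_Suc M_minus M_scale k(2) F_minus F_scale l right_diff_distrib)
    also have "norm \<dots> \<le> B * (norm (1 / \<mu>) * (norm (a n v - l (a n v) *\<^sub>C k) * N))"
      using B by (intro order_trans[OF F_bound[OF l(1)]]) (auto simp: norm_scaleC intro!: mult_left_mono divide_right_mono N(2) simp: norm_divide)
    also have "\<dots> \<le> B * (norm (1 / \<mu>) * ((K1 * rate ^ n * norm v) * N))"
      using B N(1) by (intro mult_left_mono mult_right_mono a_near) auto
    finally show ?thesis by (simp add: K2_def norm_divide mult_ac)
  qed
  define \<nu> where "\<nu> v = lim (\<lambda>n. l (a n v))" for v
  have \<nu>: "(\<lambda>n. l (a n v)) \<longlonglongrightarrow> \<nu> v \<and> (\<forall>n. norm (l (a n v) - \<nu> v) \<le> K2 * norm v / (1 - rate) * rate ^ n)" for v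
  proof -
    obtain L where "(\<lambda>n. l (a n v)) \<longlonglongrightarrow> L" "\<And>n. norm (l (a n v) - L) \<le> K2 * norm v / (1 - rate) * rate ^ n"
      using geometric_increments_converge[OF inc[of _ v] rate] by blast
    then show ?thesis using limI unfolding \<nu>_def by blast
  qed
  have a_add: "a n (u + v) = a n u + a n v" and a_scale: "a n (c *\<^sub>C v) = c *\<^sub>C a n v" for n u v c
    by (simp_all add: a_def Mn_add Mn_scale scaleC_simps mult.commute)
  have \<nu>_unique: "\<nu> v = x" if "(\<lambda>n. l (a n v)) \<longlonglongrightarrow> x" for v x using \<nu> that LIMSEQ_unique by blast
  have \<nu>_add: "\<nu> (u + v) = \<nu> u + \<nu> v" for u v
    by (rule \<nu>_unique) (use \<nu> in \<open>auto simp: a_add F_add l intro!: tendsto_add\<close>)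
  have \<nu>_scale: "\<nu> (c *\<^sub>C v) = c * \<nu> v" for c v
    by (rule \<nu>_unique) (use \<nu> in \<open>auto simp: a_scale F_scale l intro!: tendsto_mult_left\<close>)
  have \<nu>M: "\<nu> (M v) = \<mu> * \<nu> v" for v
    by (rule \<nu>_unique) (use \<nu>[of v] LIMSEQ_Suc in \<open>auto simp: aM F_scale l intro!: tendsto_mult_left\<close>)
  have "a n k = k" for n using \<mu> by (simp add: a_def Mnk scaleC_simps power_divide)
  then have \<nu>k: "\<nu> k = 1" by (intro \<nu>_unique) (simp add: l)
  \<comment> \<open>The convergence estimate at \<open>n = 0\<close>, where
    \<open>a 0 v = v\<close>.\<close>
  have \<nu>_bound: "norm (\<nu> v) \<le> norm v * (B + K2 / (1 - rate))" for v
  proof -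
    have "norm (\<nu> v) \<le> norm (l v) + norm (l v - \<nu> v)"
      using norm_triangle_ineq4[of "l v" "l v - \<nu> v"] by simp
    also have "\<dots> \<le> B * norm v + K2 * norm v / (1 - rate)"
      using \<nu>[of v] F_bound[OF l(1)] by (intro add_mono) (auto dest!: spec[of _ 0] simp: a_def scaleC_simps)
    finally show ?thesis by (simp add: algebra_simps)
  qed
  have \<nu>_bl: "bounded_linear \<nu>"
  proof (rule bounded_linear_intro[OF \<nu>_add _ \<nu>_bound])
    show "\<nu> (r *\<^sub>R v) = r *\<^sub>R \<nu> v" for r v
      using \<nu>_scale[of "of_real r" v] by (simp add: scaleC_of_real scaleR_conv_of_real)
  qed
  show ?thesis
  proof (rule spectral_gap_of_decomposition[OF M k(2) \<nu>_bl \<nu>_scale \<nu>M \<nu>k])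
    show "norm ((M ^^ n) (v - \<nu> v *\<^sub>C k)) \<le> (K1 + K2 / (1 - rate) * norm k) * (rate * norm \<mu>) ^ n * norm v" for n v
    proof -
      have "(M ^^ n) (v - \<nu> v *\<^sub>C k) = \<mu> ^ n *\<^sub>C ((a n v - l (a n v) *\<^sub>C k) + (l (a n v) - \<nu> v) *\<^sub>C k)"
        by (simp add: Mn_minus Mn_scale Mnk scaleC_simps Mn[of n v] mult.commute)
      then have "norm ((M ^^ n) (v - \<nu> v *\<^sub>C k))
          \<le> norm \<mu> ^ n * (norm (a n v - l (a n v) *\<^sub>C k) + norm (l (a n v) - \<nu> v) * norm k)"
        by (simp only: norm_scaleC norm_power) (intro mult_left_mono order_trans[OF norm_triangle_ineq]; simp add: norm_scaleC)
      also have "\<dots> \<le> norm \<mu> ^ n * (K1 * rate ^ n * norm v + (K2 * norm v / (1 - rate) * rate ^ n) * norm k)"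
        using \<nu>[of v] by (intro mult_left_mono add_mono a_near mult_right_mono) auto
      finally show ?thesis by (simp add: power_mult_distrib algebra_simps)
    qed
    show "0 \<le> rate * norm \<mu>" using rate by simp
    show "rate * norm \<mu> < norm \<mu>" using rate \<mu> by simp
  qed
qed

end

section \<open>Estimates for complex numbers and exponentials\<close>

lemma norm_exp_diff_le:
  fixes z w :: complex
  assumes "norm z \<le> G" "norm w \<le> G"
  shows "norm (exp z - exp w) \<le> exp G * norm (z - w)"
proof (rule field_differentiable_bound[of "cball 0 G"])
  show "(exp has_field_derivative exp u) (at u within cball 0 G)" for u :: complex
    by (rule DERIV_subset[OF DERIV_exp]) simp
  show "norm (exp u) \<le> exp G" if "u \<in> cball 0 G" for u :: complex
    using that complex_Re_le_cmod[of u] by simp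
qed (use assms in auto)

lemma norm_cis_diff_le: "norm (cis s - cis t) \<le> \<bar>s - t\<bar>"
proof -
  have "cis s - cis t = cis t * (exp (\<i> * of_real (s - t)) - 1)"
    by (simp add: cis_conv_exp algebra_simps flip: exp_add)
  then have "norm (cis s - cis t) = 2 * \<bar>sin ((s - t) / 2)\<bar>"
    by (simp only: norm_mult norm_cis mult_1 dist_exp_i_1)
  also have "\<dots> \<le> \<bar>s - t\<bar>" using abs_sin_x_le_abs_x[of "(s - t) / 2"] by simp
  finally show ?thesis .
qed

lemma exp_minus_one_le: "exp x - 1 \<le> x * exp (x::real)"
proof -
  have "(1 - x) * exp x \<le> exp (- x) * exp x"
    using exp_ge_add_one_self[of "- x"] by (intro mult_right_mono) auto
  then show ?thesis by (simp add: algebra_simps flip: exp_add)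
qed

text \<open>Convexity of \<open>exp\<close>: t d is the convex combination of s d and -t d in which
  -t d has weight (s - t)/(s + t). The factor becomes the upper bound of the normalised functionals
  on the image cone.\<close>

lemma exp_diff_le_ratio:
  fixes s t d :: real
  assumes "0 \<le> t" "t < s" "0 \<le> d"
  shows "exp (s * d) - exp (- (t * d)) \<le> (s + t) / (s - t) * (exp (s * d) - exp (t * d))"
proof -
  let ?c = "(s - t) / (s + t)"
  have c: "0 \<le> ?c" "?c \<le> 1" using assms by auto
  have "exp ((1 - ?c) *\<^sub>R 0 + ?c *\<^sub>R (- ((s + t) * d))) \<le> (1 - ?c) * exp 0 + ?c * exp (- ((s + t) * d))"
    using c by (intro convex_onD[OF exp_convex]) auto
  moreover have "?c * (- ((s + t) * d)) = - ((s - t) * d)"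
    using assms by simp
  ultimately have "exp (- ((s - t) * d)) \<le> (1 - ?c) + ?c * exp (- ((s + t) * d))" by simp
  then have "exp (- ((s - t) * d)) * exp (s * d) \<le> ((1 - ?c) + ?c * exp (- ((s + t) * d))) * exp (s * d)"
    by (rule mult_right_mono) simp
  also have "\<dots> = (1 - ?c) * exp (s * d) + ?c * exp (- (t * d))"
    by (simp add: algebra_simps flip: exp_add)
  finally have "?c * (exp (s * d) - exp (- (t * d))) \<le> exp (s * d) - exp (t * d)"
    by (simp add: algebra_simps flip: exp_add)
  then show ?thesis using assms by (simp add: field_simps)
qed

text \<open>Arguments relative to a fixed nonzero \<open>z0\<close> of the set lie in [-pi/2, pi/2],
  so their differences suffer no jump of the branch. They spread over at most pi/2, and rotating
  their infimum to 0 suffices.\<close>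

lemma rotate_to_first_quadrant:
  fixes Z :: "complex set"
  assumes Z: "\<And>z w. z \<in> Z \<Longrightarrow> w \<in> Z \<Longrightarrow> 0 \<le> Re (z * cnj w)"
  obtains c where "norm c = 1" "\<And>z. z \<in> Z \<Longrightarrow> 0 \<le> Re (c * z) \<and> 0 \<le> Im (c * z)"
proof (cases "\<exists>z0\<in>Z. z0 \<noteq> 0")
  case False
  show thesis
  proof (rule that[of 1])
    show "0 \<le> Re (1 * z) \<and> 0 \<le> Im (1 * z)" if "z \<in> Z" for z
      using False that by force
  qed simp
next
  case True
  then obtain z0 where z0: "z0 \<in> Z" "z0 \<noteq> 0" by blast
  define A where "A z = Arg (z * cnj z0)" for z
  have polar: "z * cnj z0 = of_real (norm z * norm z0) * cis (A z)" for z
    using rcis_cmod_Arg[of "z * cnj z0"] by (simp add: A_def rcis_def norm_mult)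
  have A_bound: "\<bar>A z\<bar> \<le> pi / 2" if "z \<in> Z" for z
    unfolding A_def Arg_Re_nonneg by (rule Z[OF that z0(1)])
  have A_diff: "A z - A w \<le> pi / 2" if z: "z \<in> Z" "z \<noteq> 0" and w: "w \<in> Z" "w \<noteq> 0" for z w
  proof (rule ccontr)
    assume "\<not> A z - A w \<le> pi / 2"
    then have "cos (A z - A w) < cos (pi / 2)"
      using A_bound[OF z(1)] A_bound[OF w(1)] by (intro cos_monotone_0_pi) auto
    then have neg: "cos (A z - A w) < 0" by simp
    have "(z * cnj z0) * cnj (w * cnj z0) = of_real (norm z0 * norm z0 * norm z * norm w) * cis (A z - A w)"
      unfolding polar by (simp add: cis_mult cis_cnj)
    moreover have "Re (cnj z0 * z * cnj (cnj z0 * w)) = (norm z0)\<^sup>2 * Re (z * cnj w)"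
      using Re_mult_cnj_scale[of "cnj z0" z w] by (simp only: complex_mod_cnj)
    ultimately have "(norm z0)\<^sup>2 * Re (z * cnj w) = (norm z0 * norm z0 * norm z * norm w) * cos (A z - A w)"
      by (simp only: mult.commute[of z "cnj z0"] mult.commute[of w "cnj z0"] times_complex.sel Re_complex_of_real
          Im_complex_of_real mult_zero_left diff_zero cis.sel)
    also have "\<dots> < 0" using neg z w z0 by (intro mult_pos_neg) auto
    finally show False using Z[OF z(1) w(1)] by (simp add: mult_less_0_iff)
  qed
  define \<alpha> where "\<alpha> = (INF z\<in>Z - {0}. A z)"
  have bdd: "bdd_below (A ` (Z - {0}))" using A_bound by (intro bdd_belowI2[of _ "- (pi / 2)"]) force
  define c where "c = cis (- \<alpha>) * (cnj z0 / of_real (norm z0))"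
  have "norm c = 1" using z0 by (simp add: c_def norm_mult norm_divide)
  moreover have "0 \<le> Re (c * z) \<and> 0 \<le> Im (c * z)" if z: "z \<in> Z" for z
  proof (cases "z = 0")
    case False
    have "c * z = cis (- \<alpha>) * (z * cnj z0) / of_real (norm z0)" by (simp add: c_def)
    also have "\<dots> = of_real (norm z) * cis (A z - \<alpha>)"
      unfolding polar using z0 by (simp add: cis_mult mult.commute)
    finally have cz: "c * z = of_real (norm z) * cis (A z - \<alpha>)" .
    have "\<alpha> \<le> A z" unfolding \<alpha>_def using bdd z False by (intro cINF_lower) auto
    moreover have "A z - pi / 2 \<le> \<alpha>"
      unfolding \<alpha>_def
    proof (rule cINF_greatest)
      show "Z - {0} \<noteq> {}" using z0 by auto
      show "A z - pi / 2 \<le> A w" if "w \<in> Z - {0}" for w using A_diff[OF z False, of w] that by simp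
    qed
    ultimately have "0 \<le> cos (A z - \<alpha>)" "0 \<le> sin (A z - \<alpha>)"
      by (auto intro!: cos_ge_zero sin_ge_zero)
    then show ?thesis unfolding cz by simp
  qed simp
  ultimately show thesis by (rule that)
qed

text \<open>\<open>a + \<i> b\<close> and \<open>c + \<i> d\<close> are the values of two functionals on the unperturbed image, \<open>E\<close> bounds the
  square root of their cross ratio, and \<open>\<gamma>\<close> is the relative size of the perturbation.\<close>

lemma Re_mult_cnj_perturbed:
  fixes z1 z2 :: complex and a b c d E \<gamma> :: real
  assumes nn: "0 \<le> a" "0 \<le> b" "0 \<le> c" "0 \<le> d"
    and cross: "a * d \<le> E\<^sup>2 * (b * c)" "b * c \<le> E\<^sup>2 * (a * d)"
    and z1: "norm (z1 - Complex a b) \<le> \<gamma> * (a + b)"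
    and z2: "norm (z2 - Complex c d) \<le> \<gamma> * (c + d)"
    and E: "8 \<le> E" and \<gamma>: "0 \<le> \<gamma>" "2 * \<gamma> * E \<le> 1"
  shows "(a + b) * (c + d) / (2 * E) \<le> Re (z1 * cnj z2)"
proof -
  define S P where "S = a * c + b * d" and "P = (a + b) * (c + d)"
  have P: "0 \<le> P" and S: "0 \<le> S" using nn by (simp_all add: P_def S_def)
  \<comment> \<open>For x = a d and y = b c, the quotient x/y lies between E^(-2) and E^2 if both
    are nonzero, which gives (x + y)^2 \<le> (E + 1/E)^2 x y; moreover x y = (a c)(b d) \<le>
    S^2/4.\<close>
  have "a * d + b * c \<le> (E + 1 / E) / 2 * S"
  proof (rule power2_le_imp_le)
    have "E\<^sup>2 * ((a * d - E\<^sup>2 * (b * c)) * (b * c - E\<^sup>2 * (a * d))) \<ge> 0"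
      using cross by (intro mult_nonneg_nonneg mult_nonpos_nonpos) auto
    then have "(a * d - E\<^sup>2 * (b * c)) * (b * c - E\<^sup>2 * (a * d)) \<ge> 0" using E by (simp add: zero_le_mult_iff)
    then have "E\<^sup>2 * ((a * d)\<^sup>2 + (b * c)\<^sup>2) \<le> (1 + E^4) * ((a * d) * (b * c))"
      by (simp add: power2_eq_square power4_eq_xxxx algebra_simps)
    then have "E\<^sup>2 * (a * d + b * c)\<^sup>2 \<le> (E\<^sup>2 + 1)\<^sup>2 * ((a * d) * (b * c))"
      by (simp add: power2_eq_square power4_eq_xxxx algebra_simps)
    also have "\<dots> \<le> (E\<^sup>2 + 1)\<^sup>2 * (S\<^sup>2 / 4)"
    proof (rule mult_left_mono)
      have "0 \<le> (a * c - b * d)\<^sup>2" by simp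
      then show "(a * d) * (b * c) \<le> S\<^sup>2 / 4" by (simp add: S_def power2_eq_square algebra_simps)
    qed simp
    finally have "(a * d + b * c)\<^sup>2 \<le> (E\<^sup>2 + 1)\<^sup>2 * (S\<^sup>2 / 4) / E\<^sup>2" using E by (simp add: field_simps)
    also have "\<dots> = ((E + 1 / E) / 2 * S)\<^sup>2" using E by (simp add: field_simps power2_eq_square)
    finally show "(a * d + b * c)\<^sup>2 \<le> ((E + 1 / E) / 2 * S)\<^sup>2" .
  qed (use E S in auto)
  moreover have "P = S + (a * d + b * c)" by (simp add: P_def S_def algebra_simps)
  ultimately have "P \<le> ((E + 1 / E) / 2 + 1) * S" by (simp add: distrib_right)
  \<comment> \<open>The constant absorbs the summands of lower order, using 8 \<le> E.\<close>
  also have "\<dots> \<le> 41 / 64 * E * S"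
  proof (rule mult_right_mono[OF _ S])
    have "1 / E \<le> 1 / 8" using E by (intro divide_left_mono) auto
    moreover have "(E + e) / 2 + 1 \<le> 41 / 64 * E" if "e \<le> 1 / 8" for e using E that by (simp add: field_simps)
    ultimately show "(E + 1 / E) / 2 + 1 \<le> 41 / 64 * E" by blast
  qed
  finally have PS: "P \<le> 41 / 64 * E * S" .
  define e1 e2 where "e1 = z1 - Complex a b" and "e2 = z2 - Complex c d"
  have n: "norm (Complex a b) \<le> a + b" "norm (Complex c d) \<le> c + d"
    using nn cmod_le[of "Complex a b"] cmod_le[of "Complex c d"] by auto
  have "Re (z1 * cnj z2) = S + Re (Complex a b * cnj e2) + Re (e1 * cnj (Complex c d)) + Re (e1 * cnj e2)"
    by (simp add: e1_def e2_def S_def algebra_simps)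
  moreover have "\<bar>Re (Complex a b * cnj e2)\<bar> \<le> (a + b) * (\<gamma> * (c + d))"
    "\<bar>Re (e1 * cnj (Complex c d))\<bar> \<le> (\<gamma> * (a + b)) * (c + d)"
    "\<bar>Re (e1 * cnj e2)\<bar> \<le> (\<gamma> * (a + b)) * (\<gamma> * (c + d))"
    using z1 z2 n nn \<gamma>
    by (intro order_trans[OF abs_Re_le_cmod]; simp only: norm_mult complex_mod_cnj e1_def[symmetric] e2_def[symmetric];
        intro mult_mono; simp)+
  ultimately have "S - (2 * \<gamma> + \<gamma>\<^sup>2) * P \<le> Re (z1 * cnj z2)"
    by (simp add: P_def power2_eq_square algebra_simps abs_le_iff)
  moreover have "(2 * \<gamma> + \<gamma>\<^sup>2) * P \<le> 33 / 32 * (P / E)"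
  proof -
    have g: "\<gamma> \<le> 1 / (2 * E)" "\<gamma> \<le> 1 / 16"
    proof -
      show "\<gamma> \<le> 1 / (2 * E)" using \<gamma> E by (simp add: field_simps)
      also have "\<dots> \<le> 1 / 16" using E by (simp add: field_simps)
      finally show "\<gamma> \<le> 1 / 16" .
    qed
    have "2 * \<gamma> + \<gamma>\<^sup>2 = \<gamma> * (2 + \<gamma>)" by (simp add: power2_eq_square algebra_simps)
    also have "\<dots> \<le> 1 / (2 * E) * (2 + 1 / 16)" using g \<gamma> E by (intro mult_mono) auto
    finally have "2 * \<gamma> + \<gamma>\<^sup>2 \<le> 33 / 32 / E" by simp
    from mult_right_mono[OF this P] show ?thesis by simp
  qed
  moreover have "64 / 41 * (P / E) \<le> S" using PS E by (simp add: field_simps)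
  moreover have "0 \<le> P / E" using P E by simp
  \<comment> \<open>The constants fit because 64/41 - 33/32 exceeds 1/2: the main term, less the
    perturbation, keeps half of P/E.\<close>
  moreover have "Q / 2 \<le> r" if "s - t \<le> r" "t \<le> 33 / 32 * Q" "64 / 41 * Q \<le> s" "0 \<le> Q" for r s t Q :: real
    using that by (simp add: field_simps)
  ultimately have "P / E / 2 \<le> Re (z1 * cnj z2)" by blast
  then show ?thesis by (simp add: P_def)
qed

section \<open>Transfer operators of expanding coverings\<close>

lemma apply_lip_diff_le: "norm (apply_lip \<phi> x - apply_lip \<phi> y) \<le> norm \<phi> * dist x y"
proof (cases "x = y")
  case False
  then show ?thesis
    using lip_quot_apply_lip_le[of \<phi> "(x, y)"] by (simp add: lip_quot_def pos_divide_le_eq)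
qed simp

lemma lip_quot_le:
  assumes "0 \<le> C" "\<And>x y. norm (\<phi> x - \<phi> y) \<le> C * dist x y"
  shows "lip_quot \<phi> p \<le> C"
proof -
  obtain x y where p: "p = (x, y)" by (cases p)
  show ?thesis
    using assms(1) assms(2)[of x y] by (cases "x = y") (auto simp: p lip_quot_def pos_divide_le_eq)
qed

lemma norm_lip_fun_le:
  assumes "\<And>x. norm (apply_lip \<phi> x) \<le> A"
    and "0 \<le> C" "\<And>x y. norm (apply_lip \<phi> x - apply_lip \<phi> y) \<le> C * dist x y"
  shows "norm \<phi> \<le> A + C"
  unfolding norm_lip_fun_def sup_norm_def Lip_def
  by (intro add_mono cSUP_least assms lip_quot_le) auto

lemma apply_Abs_lip:
  assumes "\<And>x. norm (\<phi> x) \<le> A" "0 \<le> C" "\<And>x y. norm (\<phi> x - \<phi> y) \<le> C * dist x y"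
  shows "apply_lip (Abs_lip \<phi>) = \<phi>"
proof (rule Abs_lip_inverse, intro CollectI conjI)
  show "bdd_above (range (\<lambda>x. norm (\<phi> x)))" using assms(1) by (auto simp: bdd_above_def)
  show "bdd_above (range (lip_quot \<phi>))" using lip_quot_le[OF assms(2,3)] by (auto simp: bdd_above_def)
qed

lemma transfer_add: "transfer U f g (\<lambda>x. \<phi> x + \<psi> x) y = transfer U f g \<phi> y + transfer U f g \<psi> y"
  by (simp add: transfer_def distrib_left sum.distrib)

lemma transfer_scale: "transfer U f g (\<lambda>x. c * \<phi> x) y = c * transfer U f g \<phi> y"
  by (simp add: transfer_def sum_distrib_left mult.left_commute)

text \<open>\<open>D\<close>, \<open>a\<close>, \<open>b\<close> are only upper bounds here, so that
  a one-point space can be treated with \<open>D = 1\<close>. The phase of the weight is measured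
  from \<open>m\<close>.\<close>

locale expanding_transfer =
  fixes U :: "'a::metric_space set" and f :: "'a \<Rightarrow> 'a" and J :: "'j set"
    and g :: "'a lip_fun" and \<rho> D a b \<theta> m :: real
  assumes \<rho>: "0 < \<rho>" "\<rho> < 1" and J: "finite J" "J \<noteq> {}"
    and pairing: "expanding_pairing U f J \<rho>"
    and D: "0 < D" and dist_le: "\<And>x y :: 'a. dist x y \<le> D"
    and a: "0 \<le> a" and Re_g: "\<And>x y. Re (apply_lip g x) \<le> Re (apply_lip g y) + a * dist x y"
    and b: "0 \<le> b" and Im_g: "\<And>x y. \<bar>Im (apply_lip g x) - Im (apply_lip g y)\<bar> \<le> b * dist x y"
    and Im_center: "\<And>x. \<bar>Im (apply_lip g x) - m\<bar> \<le> \<theta> / 2"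
    and gap: "(\<theta> + 2 * \<rho>\<^sup>2 * D * b / (1 - \<rho> + \<rho>\<^sup>2 * D * a))
           * exp (1 + \<rho> * ((1 + \<rho>) / (1 - \<rho>)) * D * a) * (4 / (1 - \<rho>)) < 1"
begin

text \<open>The real transfer operator maps the cone of functions with \<open>u x \<le> exp (\<sigma> d(x, y)) u y\<close> to the one
  for \<open>\<tau>\<close>; this \<open>\<sigma>\<close> makes \<open>\<tau> D\<close> the exponent of the gap condition.\<close>

definition "\<sigma> = (1 / \<rho> + 2 * \<rho> * D * a / (1 - \<rho>)) / D"
definition "\<tau> = \<rho> * (a + \<sigma>)"
text \<open>4/(1 - \<rho>) dominates the factor (\<sigma> + \<tau>)/(\<sigma> - \<tau>) between
  functionals and evaluations, and \<open>exp (\<tau> * D)\<close> that between evaluations at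
  different points; \<open>E\<close> bounds both together.\<close>

definition "E = 4 / (1 - \<rho>) * exp (\<tau> * D)"
definition "\<gamma> = \<theta> / 2 + \<rho> * b / (\<sigma> - \<tau>)"

text \<open>This denominator turns \<open>\<rho> * b / (\<sigma> - \<tau>)\<close> into half of the
  second summand of the gap condition.\<close>

lemma sigma_minus_tau: "\<sigma> - \<tau> = (1 - \<rho> + \<rho>\<^sup>2 * D * a) / (\<rho> * D)"
proof -
  have "\<sigma> - \<tau> = (1 - \<rho>) * \<sigma> - \<rho> * a" by (simp add: \<tau>_def algebra_simps)
  also have "(1 - \<rho>) * \<sigma> = ((1 - \<rho>) / \<rho> + 2 * \<rho> * D * a) / D"
    using \<rho> D by (simp add: \<sigma>_def distrib_left)
  finally show ?thesis using \<rho> D by (simp add: field_simps power2_eq_square)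
qed

lemma tau_D: "\<tau> * D = 1 + \<rho> * ((1 + \<rho>) / (1 - \<rho>)) * D * a"
proof -
  have "\<tau> * D = \<rho> * (a * D + (1 / \<rho> + 2 * \<rho> * D * a / (1 - \<rho>)))"
    using D by (simp add: \<tau>_def \<sigma>_def field_simps)
  also have "\<dots> = 1 + \<rho> * ((1 + \<rho>) / (1 - \<rho>)) * D * a"
    using \<rho> by (simp add: field_simps power2_eq_square)
  finally show ?thesis .
qed

lemma tau_less_sigma: "\<tau> < \<sigma>" and tau_pos: "0 < \<tau>"
proof -
  have "0 \<le> \<rho>\<^sup>2 * D * a" using D a by simp
  then have "0 < \<sigma> - \<tau>" unfolding sigma_minus_tau using \<rho> D by (intro divide_pos_pos) auto
  then show "\<tau> < \<sigma>" by simp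
  have "0 < \<sigma>" unfolding \<sigma>_def using \<rho> D a by (intro divide_pos_pos add_pos_nonneg) auto
  then show "0 < \<tau>" using \<rho> a by (simp add: \<tau>_def)
qed

lemma ratio_le_E: "(\<sigma> + \<tau>) / (\<sigma> - \<tau>) * exp (\<tau> * D) \<le> E"
  unfolding E_def
proof (rule mult_right_mono)
  have s: "0 < \<sigma> - \<tau>" using tau_less_sigma by simp
  have nn: "0 \<le> \<rho>\<^sup>2 * D * a" using D a by simp
  have "\<sigma> + \<tau> \<le> 2 * \<sigma>" using tau_less_sigma by simp
  also have "2 * \<sigma> \<le> 4 / (1 - \<rho>) * (\<sigma> - \<tau>)"
  proof -
    have "2 * \<sigma> = (2 * (1 - \<rho>) + 4 * (\<rho>\<^sup>2 * D * a)) / ((1 - \<rho>) * (\<rho> * D))"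
      using \<rho> D by (simp add: \<sigma>_def field_simps power2_eq_square)
    also have "\<dots> \<le> (4 * (1 - \<rho> + \<rho>\<^sup>2 * D * a)) / ((1 - \<rho>) * (\<rho> * D))"
      using \<rho> D nn by (intro divide_right_mono) auto
    finally show ?thesis unfolding sigma_minus_tau by simp
  qed
  finally show "(\<sigma> + \<tau>) / (\<sigma> - \<tau>) \<le> 4 / (1 - \<rho>)" using s by (simp add: pos_divide_le_eq)
qed simp

text \<open>\<open>E_ge\<close> is what \<open>Re_mult_cnj_perturbed\<close> asks for: the exponent
  is at least 1, so \<open>exp (\<tau> * D)\<close> is at least 2, and 4/(1 - \<rho>) is at least
  4.\<close>

lemma exp_tau_D_le_E: "exp (\<tau> * D) \<le> E" and E_ge: "8 \<le> E"
proof -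
  have "1 * exp (\<tau> * D) \<le> (\<sigma> + \<tau>) / (\<sigma> - \<tau>) * exp (\<tau> * D)"
    using tau_less_sigma tau_pos by (intro mult_right_mono) auto
  with ratio_le_E show "exp (\<tau> * D) \<le> E" by simp
  have "0 \<le> \<rho> * ((1 + \<rho>) / (1 - \<rho>)) * D * a" using \<rho> D a by simp
  then have "2 \<le> exp (\<tau> * D)" unfolding tau_D using exp_ge_add_one_self[of "1 + \<rho> * ((1 + \<rho>) / (1 - \<rho>)) * D * a"] by linarith
  moreover have "4 \<le> 4 / (1 - \<rho>)" using \<rho> by (simp add: field_simps)
  ultimately have "4 * 2 \<le> 4 / (1 - \<rho>) * exp (\<tau> * D)" using \<rho> by (intro mult_mono) auto
  then show "8 \<le> E" by (simp add: E_def)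
qed

lemma gamma_E: "2 * \<gamma> * E \<le> 1" and theta_le_gamma: "\<theta> / 2 \<le> \<gamma>" and gamma_nonneg: "0 \<le> \<gamma>"
proof -
  have "\<rho> * b / (\<sigma> - \<tau>) = \<rho>\<^sup>2 * D * b / (1 - \<rho> + \<rho>\<^sup>2 * D * a)"
    unfolding sigma_minus_tau by (simp add: power2_eq_square)
  then have "2 * \<gamma> = \<theta> + 2 * \<rho>\<^sup>2 * D * b / (1 - \<rho> + \<rho>\<^sup>2 * D * a)" by (simp add: \<gamma>_def)
  then have "2 * \<gamma> * E < 1" using gap unfolding E_def tau_D by (simp only: mult_ac)
  then show "2 * \<gamma> * E \<le> 1" by simp
  have "0 \<le> \<rho> * b / (\<sigma> - \<tau>)" using \<rho> b tau_less_sigma by simp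
  then show "\<theta> / 2 \<le> \<gamma>" by (simp add: \<gamma>_def)
  moreover have "0 \<le> \<theta> / 2" using order_trans[OF abs_ge_zero Im_center] .
  ultimately show "0 \<le> \<gamma>" by simp
qed

section \<open>Real cones and the functionals that define them\<close>

definition real_cone :: "real \<Rightarrow> ('a \<Rightarrow> real) \<Rightarrow> bool" where
  "real_cone s u \<longleftrightarrow> (\<forall>x. 0 \<le> u x) \<and> (\<forall>x y. u x \<le> exp (s * dist x y) * u y)"

definition L :: "('a \<Rightarrow> real) \<Rightarrow> 'a \<Rightarrow> real" where
  "L u y = (\<Sum>x\<in>preimages U f y. exp (Re (apply_lip g x)) * u x)"

abbreviation "T \<equiv> transfer U f (apply_lip g)"

text \<open>Normalised so that the values on the image cone are comparable with the value at the first point;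
  the case \<open>x = y\<close> supplies the evaluations, without which a one-point space would have no functional.\<close>

definition func :: "'a \<Rightarrow> 'a \<Rightarrow> ('a \<Rightarrow> 'b) \<Rightarrow> 'b::real_normed_field" where
  "func x y u = (if x = y then u x else
     (of_real (exp (\<sigma> * dist x y)) * u x - u y) / of_real (exp (\<sigma> * dist x y) - exp (\<tau> * dist x y)))"

lemma denom_pos: "x \<noteq> y \<Longrightarrow> 0 < exp (\<sigma> * dist x y) - exp (\<tau> * dist x y)"
  using tau_less_sigma by simp

lemma func_add: "func x y (\<lambda>z. u z + v z) = func x y u + func x y v"
  by (simp add: func_def add_divide_distrib diff_divide_distrib distrib_left)

lemma func_scale: "func x y (\<lambda>z. c * u z) = c * func x y u"
  by (simp add: func_def right_diff_distrib mult.left_commute)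

lemma func_Re: "Re (func x y u) = func x y (\<lambda>z. Re (u z))"
  by (simp add: func_def Re_divide_of_real del: of_real_diff)

lemma func_Im: "Im (func x y u) = func x y (\<lambda>z. Im (u z))"
  by (simp add: func_def Im_divide_of_real del: of_real_diff)

lemma real_coneI:
  assumes "\<And>x y. 0 \<le> func x y u"
  shows "real_cone \<sigma> u"
  unfolding real_cone_def
proof (intro conjI allI)
  show "0 \<le> u x" for x using assms[of x x] by (simp add: func_def)
  show "u y \<le> exp (\<sigma> * dist y x) * u x" for x y
  proof (cases "x = y")
    case False
    then show ?thesis using assms[of x y] denom_pos[OF False]
      by (simp add: func_def zero_le_divide_iff dist_commute)
  qed simp
qed

text \<open>Membership in the smaller cone bounds w y by exp(\<tau> d) w x, so the numerator is at
  least w x times the denominator; this is the reason for the normalisation.\<close>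

lemma func_ge: "real_cone \<tau> w \<Longrightarrow> w x \<le> func x y w"
proof (cases "x = y")
  case False
  assume w: "real_cone \<tau> w"
  have "w y \<le> exp (\<tau> * dist y x) * w x" using w by (simp add: real_cone_def)
  then have "w y \<le> exp (\<tau> * dist x y) * w x" by (simp only: dist_commute)
  then have "w x * (exp (\<sigma> * dist x y) - exp (\<tau> * dist x y)) \<le> exp (\<sigma> * dist x y) * w x - w y"
    by (simp add: algebra_simps)
  then show ?thesis using False denom_pos[OF False] by (simp add: func_def pos_le_divide_eq del: of_real_diff)
qed (simp add: func_def)

text \<open>The reverse inequality, w y at least exp(-\<tau> d) w x, bounds the numerator, and
  \<open>exp_diff_le_ratio\<close> compares it with the denominator uniformly in the
  distance.\<close>

lemma func_le: "real_cone \<tau> w \<Longrightarrow> func x y w \<le> (\<sigma> + \<tau>) / (\<sigma> - \<tau>) * w x"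
proof (cases "x = y")
  case True
  assume "real_cone \<tau> w"
  then have "1 * w x \<le> (\<sigma> + \<tau>) / (\<sigma> - \<tau>) * w x"
    using tau_less_sigma tau_pos by (intro mult_right_mono) (auto simp: real_cone_def)
  then show ?thesis using True by (simp add: func_def)
next
  case False
  assume w: "real_cone \<tau> w"
  let ?d = "dist x y"
  have "exp (- (\<tau> * ?d)) * w x \<le> exp (- (\<tau> * ?d)) * (exp (\<tau> * ?d) * w y)"
    using w by (intro mult_left_mono) (auto simp: real_cone_def)
  also have "\<dots> = w y" by (simp add: exp_minus)
  finally have "exp (- (\<tau> * ?d)) * w x \<le> w y" .
  then have "exp (\<sigma> * ?d) * w x - w y \<le> (exp (\<sigma> * ?d) - exp (- (\<tau> * ?d))) * w x"
    by (simp add: algebra_simps)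
  also have "\<dots> \<le> ((\<sigma> + \<tau>) / (\<sigma> - \<tau>) * (exp (\<sigma> * ?d) - exp (\<tau> * ?d))) * w x"
    using w tau_pos tau_less_sigma by (intro mult_right_mono exp_diff_le_ratio) (auto simp: real_cone_def)
  finally show ?thesis using False denom_pos[OF False]
    by (simp add: func_def pos_divide_le_eq mult_ac del: of_real_diff)
qed

lemma func_nonneg: "real_cone \<tau> w \<Longrightarrow> 0 \<le> func x y w"
  using func_ge[of w x y] by (auto simp: real_cone_def intro: order_trans)

lemma real_cone_spread: "real_cone \<tau> w \<Longrightarrow> w x \<le> exp (\<tau> * D) * w y"
proof -
  assume w: "real_cone \<tau> w"
  then have "w x \<le> exp (\<tau> * dist x y) * w y" by (simp add: real_cone_def)
  also have "\<dots> \<le> exp (\<tau> * D) * w y"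
    using w tau_pos dist_le by (intro mult_right_mono) (auto simp: real_cone_def)
  finally show ?thesis .
qed

text \<open>Functionals are replaced by evaluations at their first points, and these are exchanged
  across the space. In terms of the Hilbert metric of the \<open>\<sigma>\<close> cone, the
  \<open>\<tau>\<close> cone has diameter at most 2 log E.\<close>

lemma cross_ratio:
  assumes u: "real_cone \<tau> u" and v: "real_cone \<tau> v"
  shows "func x y u * func x' y' v \<le> E\<^sup>2 * (func x y v * func x' y' u)"
proof -
  define q where "q = (\<sigma> + \<tau>) / (\<sigma> - \<tau>)"
  have q: "0 \<le> q" using tau_pos tau_less_sigma by (simp add: q_def)
  have nn: "0 \<le> u x" "0 \<le> v x" "0 \<le> u x'" "0 \<le> v x'" using u v by (auto simp: real_cone_def)
  have "func x y u * func x' y' v \<le> (q * u x) * (q * v x')"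
    using u v q nn by (intro mult_mono func_le[folded q_def] func_nonneg) auto
  also have "\<dots> \<le> (q * (exp (\<tau> * D) * u x')) * (q * (exp (\<tau> * D) * v x))"
    using q nn by (intro mult_mono mult_left_mono real_cone_spread u v) auto
  also have "\<dots> = (q * exp (\<tau> * D))\<^sup>2 * (v x * u x')" by (simp add: power2_eq_square mult_ac)
  also have "\<dots> \<le> E\<^sup>2 * (func x y v * func x' y' u)"
  proof (intro mult_mono power_mono func_ge u v)
    show "q * exp (\<tau> * D) \<le> E" unfolding q_def by (rule ratio_le_E)
  qed (use q nn func_nonneg[OF v] in auto)
  finally show ?thesis .
qed

section \<open>The real transfer operator on the cones\<close>

lemma paired_sums:
  obtains x x' where "\<And>j. j \<in> J \<Longrightarrow> dist (x j) (x' j) \<le> \<rho> * dist y y'"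
    and "\<And>k :: 'a \<Rightarrow> real. sum k (preimages U f y) = (\<Sum>j\<in>J. k (x j))"
    and "\<And>k :: 'a \<Rightarrow> real. sum k (preimages U f y') = (\<Sum>j\<in>J. k (x' j))"
    and "\<And>k :: 'a \<Rightarrow> complex. sum k (preimages U f y) = (\<Sum>j\<in>J. k (x j))"
    and "\<And>k :: 'a \<Rightarrow> complex. sum k (preimages U f y') = (\<Sum>j\<in>J. k (x' j))"
proof -
  obtain x x' where *: "bij_betw x J (preimages U f y)" "bij_betw x' J (preimages U f y')"
    "\<And>j. j \<in> J \<Longrightarrow> dist (x j) (x' j) \<le> \<rho> * dist y y'"
    using pairing unfolding expanding_pairing_def by blast
  show thesis
    by (rule that[of x x']) (use * in \<open>auto simp: sum.reindex_bij_betw[symmetric]\<close>)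
qed

lemma preimages_finite_nonempty: "finite (preimages U f y)" "preimages U f y \<noteq> {}"
proof -
  obtain x where "bij_betw x J (preimages U f y)" using pairing unfolding expanding_pairing_def by blast
  then show "finite (preimages U f y)" "preimages U f y \<noteq> {}"
    using J bij_betw_finite bij_betw_empty2 by (auto simp: bij_betw_def)
qed

text \<open>Paired pre-images are \<rho> times closer, so the weight contributes the exponent a
  \<rho> d and the function \<sigma> \<rho> d, together \<tau> d.\<close>

lemma weight_le:
  assumes u: "real_cone \<sigma> u" and d: "dist x' x \<le> \<rho> * d"
  shows "exp (Re (apply_lip g x')) * u x' \<le> exp (\<tau> * d) * (exp (Re (apply_lip g x)) * u x)"
proof -
  have s: "0 < \<sigma>" using tau_pos tau_less_sigma by simp
  have nn: "0 \<le> u x" using u by (simp add: real_cone_def)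
  have "exp (Re (apply_lip g x')) * u x' \<le> exp (Re (apply_lip g x) + a * (\<rho> * d)) * (exp (\<sigma> * (\<rho> * d)) * u x)"
  proof (intro mult_mono)
    show "exp (Re (apply_lip g x')) \<le> exp (Re (apply_lip g x) + a * (\<rho> * d))"
      using Re_g[of x' x] mult_left_mono[OF d a] by simp
    have "u x' \<le> exp (\<sigma> * dist x' x) * u x" using u by (simp add: real_cone_def)
    also have "\<dots> \<le> exp (\<sigma> * (\<rho> * d)) * u x" using d s nn by (intro mult_right_mono) auto
    finally show "u x' \<le> exp (\<sigma> * (\<rho> * d)) * u x" .
  qed (use u in \<open>auto simp: real_cone_def\<close>)
  also have "\<dots> = exp (\<tau> * d) * (exp (Re (apply_lip g x)) * u x)"
    by (simp add: \<tau>_def exp_add algebra_simps)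
  finally show ?thesis .
qed

lemma L_cone:
  assumes u: "real_cone \<sigma> u"
  shows "real_cone \<tau> (L u)"
  unfolding real_cone_def
proof (intro conjI allI)
  show "0 \<le> L u y" for y unfolding L_def using u by (intro sum_nonneg) (auto simp: real_cone_def)
  show "L u y \<le> exp (\<tau> * dist y y') * L u y'" for y y'
    by (rule paired_sums[of y y'])
      (auto simp: L_def sum_distrib_left intro!: sum_mono weight_le u)
qed

text \<open>In the cone a single nonzero value makes all values positive, and every point has a
  pre-image.\<close>

lemma L_pos:
  assumes u: "real_cone \<sigma> u" and x: "u x \<noteq> 0"
  shows "0 < L u y"
  unfolding L_def
proof (rule sum_pos)
  have "0 \<le> u x" using u by (simp add: real_cone_def)
  with x have "0 < u x" by simp
  then show "0 < exp (Re (apply_lip g z)) * u z" for z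
  proof -
    have "0 < u x" by fact
    also have "u x \<le> exp (\<sigma> * dist x z) * u z" using u by (simp add: real_cone_def)
    finally show ?thesis by (simp add: zero_less_mult_iff)
  qed
qed (use preimages_finite_nonempty in auto)

lemma L_add: "L (\<lambda>x. u x + v x) y = L u y + L v y"
  by (simp add: L_def distrib_left sum.distrib)

section \<open>The complex weight as a perturbation of the real one\<close>

lemma exp_g: "cis (- m) * exp (apply_lip g x) = of_real (exp (Re (apply_lip g x))) * cis (Im (apply_lip g x) - m)"
proof -
  have "exp (apply_lip g x) = of_real (exp (Re (apply_lip g x))) * cis (Im (apply_lip g x))"
    by (simp add: exp_eq_polar)
  then show ?thesis by (simp add: cis_mult mult.left_commute)
qed

lemma exp_g_mult: "cis (- m) * (exp (apply_lip g x) * z)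
    = of_real (exp (Re (apply_lip g x))) * (cis (Im (apply_lip g x) - m) * z)"
  using arg_cong[OF exp_g, of "\<lambda>w. w * z"] by (simp only: mult.assoc)

text \<open>A constant phase does not affect the complex cone. Centring at \<open>m\<close> makes
  the error \<open>\<theta> / 2\<close> instead of \<open>\<theta>\<close>.\<close>

lemma phase_diff: "norm (cis (Im (apply_lip g x) - m) - 1) \<le> \<theta> / 2"
  using norm_cis_diff_le[of "Im (apply_lip g x) - m" 0] Im_center[of x] by simp

lemma transfer_perturbation:
  assumes u: "real_cone \<sigma> u"
  shows "norm (cis (- m) * func y y' (T (\<lambda>x. of_real (u x))) - of_real (func y y' (L u))) \<le> \<gamma> * func y y' (L u)"
proof (cases "y = y'")
  case True
  let ?w = "\<lambda>x. exp (Re (apply_lip g x)) * u x"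
  have w: "0 \<le> ?w x" for x using u by (simp add: real_cone_def)
  have "cis (- m) * T (\<lambda>x. of_real (u x)) y - of_real (L u y)
      = (\<Sum>x\<in>preimages U f y. of_real (?w x) * (cis (Im (apply_lip g x) - m) - 1))"
    unfolding transfer_def L_def sum_distrib_left of_real_sum sum_subtractf[symmetric]
    by (intro sum.cong refl, simp only: exp_g_mult) (simp add: right_diff_distrib mult_ac)
  also have "norm \<dots> \<le> (\<Sum>x\<in>preimages U f y. ?w x * (\<theta> / 2))"
  proof (rule sum_norm_le)
    show "norm (of_real (?w x) * (cis (Im (apply_lip g x) - m) - 1)) \<le> ?w x * (\<theta> / 2)" for x
      using mult_left_mono[OF phase_diff w] w by (simp only: norm_mult norm_of_real abs_of_nonneg)
  qed
  also have "\<dots> = \<theta> / 2 * L u y" by (simp add: L_def sum_distrib_left mult_ac)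
  also have "\<dots> \<le> \<gamma> * L u y"
    using L_cone[OF u] theta_le_gamma by (intro mult_right_mono) (auto simp: real_cone_def)
  finally show ?thesis using True by (simp add: func_def)
next
  case False
  define d where "d = dist y y'"
  have d: "0 < d" using False by (simp add: d_def)
  define N where "N = exp (\<sigma> * d) - exp (\<tau> * d)"
  have N: "0 < N" using denom_pos[OF False] by (simp add: N_def d_def)
  obtain x x' where x: "\<And>j. j \<in> J \<Longrightarrow> dist (x j) (x' j) \<le> \<rho> * d"
    and sums: "\<And>k :: 'a \<Rightarrow> real. sum k (preimages U f y) = (\<Sum>j\<in>J. k (x j))"
      "\<And>k :: 'a \<Rightarrow> real. sum k (preimages U f y') = (\<Sum>j\<in>J. k (x' j))"
      "\<And>k :: 'a \<Rightarrow> complex. sum k (preimages U f y) = (\<Sum>j\<in>J. k (x j))"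
      "\<And>k :: 'a \<Rightarrow> complex. sum k (preimages U f y') = (\<Sum>j\<in>J. k (x' j))"
    unfolding d_def by (rule paired_sums[of y y']) blast
  define A B where "A j = exp (\<sigma> * d) * (exp (Re (apply_lip g (x j))) * u (x j))"
    and "B j = exp (Re (apply_lip g (x' j))) * u (x' j)" for j
  define \<zeta> \<zeta>' where "\<zeta> j = cis (Im (apply_lip g (x j)) - m)"
    and "\<zeta>' j = cis (Im (apply_lip g (x' j)) - m)" for j
  have B: "0 \<le> B j" for j using u by (simp add: B_def real_cone_def)
  \<comment> \<open>By \<open>weight_le\<close>, \<open>A j\<close> is at least
    \<open>exp ((\<sigma> - \<tau>) * d) * B j\<close>: every pair contributes to the numerator of
    \<open>func y y' (L u)\<close> a margin proportional to \<open>d\<close>.\<close>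
  have BA: "B j * ((\<sigma> - \<tau>) * d) \<le> A j - B j" if j: "j \<in> J" for j
  proof -
    have "B j \<le> exp (\<tau> * d) * (exp (Re (apply_lip g (x j))) * u (x j))"
      unfolding B_def using x[OF j] by (intro weight_le u) (simp add: dist_commute)
    then have "exp ((\<sigma> - \<tau>) * d) * B j \<le> exp ((\<sigma> - \<tau>) * d) * (exp (\<tau> * d) * (exp (Re (apply_lip g (x j))) * u (x j)))"
      by (rule mult_left_mono) simp
    also have "\<dots> = A j" by (simp add: A_def left_diff_distrib exp_diff)
    finally have "exp ((\<sigma> - \<tau>) * d) * B j \<le> A j" .
    moreover have "(1 + (\<sigma> - \<tau>) * d) * B j \<le> exp ((\<sigma> - \<tau>) * d) * B j"
      by (intro mult_right_mono exp_ge_add_one_self B)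
    ultimately show ?thesis by (simp add: algebra_simps)
  qed
  have lin: "of_real (exp (\<sigma> * d)) * (cis (- m) * T (\<lambda>x. of_real (u x)) y) - cis (- m) * T (\<lambda>x. of_real (u x)) y'
      = (\<Sum>j\<in>J. of_real (A j) * \<zeta> j - of_real (B j) * \<zeta>' j)"
    unfolding transfer_def sums sum_distrib_left sum_subtractf[symmetric]
    by (intro sum.cong refl, simp only: exp_g_mult) (simp add: A_def B_def \<zeta>_def \<zeta>'_def mult_ac)
  have linL: "exp (\<sigma> * d) * L u y - L u y' = (\<Sum>j\<in>J. A j - B j)"
    unfolding L_def sums sum_distrib_left sum_subtractf[symmetric]
    by (intro sum.cong) (auto simp: A_def B_def)
  \<comment> \<open>The error of a pair is (A - B)(\<zeta> - 1) + B (\<zeta> - \<zeta>'). The first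
    part costs \<open>\<theta> / 2\<close>. The second is at most B b \<rho> d, and
    \<open>BA\<close> trades B d for (A - B)/(\<sigma> - \<tau>); this is how
    \<open>\<gamma>\<close> arises.\<close>
  have "norm ((\<Sum>j\<in>J. of_real (A j) * \<zeta> j - of_real (B j) * \<zeta>' j) - of_real (\<Sum>j\<in>J. A j - B j))
      = norm (\<Sum>j\<in>J. of_real (A j - B j) * (\<zeta> j - 1) + of_real (B j) * (\<zeta> j - \<zeta>' j))"
    by (simp add: sum_subtractf[symmetric] algebra_simps)
  also have "\<dots> \<le> (\<Sum>j\<in>J. \<gamma> * (A j - B j))"
  proof (rule sum_norm_le)
    fix j assume j: "j \<in> J"
    have AB: "0 \<le> A j - B j"
      using BA[OF j] B[of j] d tau_less_sigma by (intro order_trans[OF _ BA[OF j]] mult_nonneg_nonneg) auto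
    have "norm (\<zeta> j - \<zeta>' j) \<le> b * (\<rho> * d)"
      using norm_cis_diff_le[of "Im (apply_lip g (x j)) - m" "Im (apply_lip g (x' j)) - m"]
        Im_g[of "x j" "x' j"] mult_left_mono[OF x[OF j] b] by (simp add: \<zeta>_def \<zeta>'_def)
    then have "B j * norm (\<zeta> j - \<zeta>' j) \<le> B j * (b * (\<rho> * d))" by (rule mult_left_mono[OF _ B])
    also have "\<dots> = (\<rho> * b / (\<sigma> - \<tau>)) * (B j * ((\<sigma> - \<tau>) * d))" using tau_less_sigma by (simp add: field_simps)
    also have "\<dots> \<le> (\<rho> * b / (\<sigma> - \<tau>)) * (A j - B j)"
      using \<rho> b tau_less_sigma by (intro mult_left_mono BA[OF j]) auto
    finally have 2: "norm (of_real (B j) * (\<zeta> j - \<zeta>' j)) \<le> (\<rho> * b / (\<sigma> - \<tau>)) * (A j - B j)"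
      using B[of j] by (simp only: norm_mult norm_of_real abs_of_nonneg)
    have "norm (of_real (A j - B j) * (\<zeta> j - 1)) \<le> (A j - B j) * (\<theta> / 2)"
      using mult_left_mono[OF phase_diff AB, of "x j"] AB
      by (simp only: norm_mult norm_of_real abs_of_nonneg \<zeta>_def)
    with 2 have "norm (of_real (A j - B j) * (\<zeta> j - 1) + of_real (B j) * (\<zeta> j - \<zeta>' j))
        \<le> (A j - B j) * (\<theta> / 2) + (\<rho> * b / (\<sigma> - \<tau>)) * (A j - B j)"
      by (intro norm_triangle_le add_mono)
    then show "norm (of_real (A j - B j) * (\<zeta> j - 1) + of_real (B j) * (\<zeta> j - \<zeta>' j)) \<le> \<gamma> * (A j - B j)"
      by (simp add: \<gamma>_def algebra_simps)
  qed
  finally have "norm ((of_real (exp (\<sigma> * d)) * (cis (- m) * T (\<lambda>x. of_real (u x)) y) - cis (- m) * T (\<lambda>x. of_real (u x)) y')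
      - of_real (exp (\<sigma> * d) * L u y - L u y')) \<le> \<gamma> * (exp (\<sigma> * d) * L u y - L u y')"
    unfolding lin linL by (simp only: sum_distrib_left)
  then have "norm (((of_real (exp (\<sigma> * d)) * (cis (- m) * T (\<lambda>x. of_real (u x)) y) - cis (- m) * T (\<lambda>x. of_real (u x)) y')
      - of_real (exp (\<sigma> * d) * L u y - L u y')) / of_real N) \<le> \<gamma> * (exp (\<sigma> * d) * L u y - L u y') / N"
    using N by (simp only: norm_divide norm_of_real abs_of_pos) (rule divide_right_mono, auto)
  moreover have "cis (- m) * func y y' (T (\<lambda>x. of_real (u x))) - of_real (func y y' (L u))
      = ((of_real (exp (\<sigma> * d)) * (cis (- m) * T (\<lambda>x. of_real (u x)) y) - cis (- m) * T (\<lambda>x. of_real (u x)) y')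
      - of_real (exp (\<sigma> * d) * L u y - L u y')) / of_real N"
    using False by (simp add: func_def N_def d_def diff_divide_distrib right_diff_distrib mult.left_commute)
  moreover have "func y y' (L u) = (exp (\<sigma> * d) * L u y - L u y') / N"
    using False by (simp add: func_def N_def d_def)
  ultimately show ?thesis by simp
qed

lemma transfer_deep:
  assumes cone: "\<And>x y x' y'. 0 \<le> Re (func x y \<phi> * cnj (func x' y' \<phi>))" and nz: "\<phi> z0 \<noteq> 0"
  shows "\<exists>s>0. (\<forall>x y. norm (func x y (T \<phi>)) \<le> s) \<and>
    (\<forall>x y x' y'. 1 / (8 * E ^ 5) * s\<^sup>2 \<le> Re (func x y (T \<phi>) * cnj (func x' y' (T \<phi>))))"
proof -
  have "0 \<le> Re (z * cnj w)" if "z \<in> {func x y \<phi> | x y. True}" "w \<in> {func x y \<phi> | x y. True}" for z w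
    using that cone by auto
  from rotate_to_first_quadrant[OF this] obtain c where c: "norm c = 1"
    and quad: "\<And>z. z \<in> {func x y \<phi> | x y. True} \<Longrightarrow> 0 \<le> Re (c * z) \<and> 0 \<le> Im (c * z)" by blast
  define u v where "u z = Re (c * \<phi> z)" and "v z = Im (c * \<phi> z)" for z
  have c\<phi>: "(\<lambda>z. c * \<phi> z) = (\<lambda>z. of_real (u z) + \<i> * of_real (v z))"
    by (auto simp: u_def v_def complex_eq_iff)
  have func_u: "func x y u = Re (c * func x y \<phi>)" and func_v: "func x y v = Im (c * func x y \<phi>)" for x y
    using func_Re[of x y "\<lambda>z. c * \<phi> z"] func_Im[of x y "\<lambda>z. c * \<phi> z"]
    unfolding func_scale u_def v_def by auto
  have nn: "0 \<le> func x y u" "0 \<le> func x y v" for x y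
    unfolding func_u func_v using quad by blast+
  have u: "real_cone \<sigma> u" and v: "real_cone \<sigma> v"
    and k: "real_cone \<sigma> (\<lambda>z. u z + v z)"
    using nn by (auto intro!: real_coneI simp: func_add)
  have "0 \<le> u z0" "0 \<le> v z0" using u v by (auto simp: real_cone_def)
  moreover have "u z0 \<noteq> 0 \<or> v z0 \<noteq> 0"
  proof -
    have "c * \<phi> z0 \<noteq> 0" using c nz by auto
    then show ?thesis unfolding u_def v_def complex_eq_iff by simp
  qed
  ultimately have "u z0 + v z0 \<noteq> 0" by auto
  from L_pos[OF k this] have "0 < L (\<lambda>z. u z + v z) z0" .
  \<comment> \<open>One of \<open>u\<close> and \<open>v\<close> may vanish identically, but not
    their sum. Its image provides the reference value \<open>W\<close>, and \<open>p + r\<close>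
    lies between \<open>W / E\<close> and \<open>E * W\<close>.\<close>
  define w where "w = L (\<lambda>z. u z + v z)"
  define W where "W = w z0"
  have W: "0 < W" unfolding W_def w_def by fact
  have w: "real_cone \<tau> w" unfolding w_def by (rule L_cone[OF k])
  define p r where "p x y = func x y (L u)" and "r x y = func x y (L v)" for x y
  have pr: "func x y w = p x y + r x y" for x y
  proof -
    have "w = (\<lambda>y. L u y + L v y)" unfolding w_def by (rule ext) (rule L_add)
    then show ?thesis unfolding p_def r_def by (simp add: func_add)
  qed
  have prnn: "0 \<le> p x y" "0 \<le> r x y" for x y
    unfolding p_def r_def by (intro func_nonneg L_cone u v)+
  have E: "0 < E" using E_ge by simp
  have upper: "func x y w \<le> E * W" for x y
  proof -
    have "func x y w \<le> (\<sigma> + \<tau>) / (\<sigma> - \<tau>) * w x" by (rule func_le[OF w])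
    also have "\<dots> \<le> (\<sigma> + \<tau>) / (\<sigma> - \<tau>) * (exp (\<tau> * D) * W)"
      unfolding W_def using tau_pos tau_less_sigma by (intro mult_left_mono real_cone_spread w) auto
    also have "\<dots> = ((\<sigma> + \<tau>) / (\<sigma> - \<tau>) * exp (\<tau> * D)) * W" by (simp only: mult.assoc)
    also have "\<dots> \<le> E * W" using W by (intro mult_right_mono ratio_le_E) auto
    finally show ?thesis .
  qed
  have lower: "W / E \<le> func x y w" for x y
  proof -
    have "W \<le> exp (\<tau> * D) * w x" unfolding W_def by (rule real_cone_spread[OF w])
    also have "\<dots> \<le> E * w x" using w by (intro mult_right_mono exp_tau_D_le_E) (auto simp: real_cone_def)
    also have "\<dots> \<le> E * func x y w" using E by (intro mult_left_mono func_ge w) auto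
    finally show ?thesis using E by (simp add: field_simps)
  qed
  define \<omega> where "\<omega> = cis (- m) * c"
  have \<omega>: "norm \<omega> = 1" using c by (simp add: \<omega>_def norm_mult)
  have near: "norm (\<omega> * func x y (T \<phi>) - Complex (p x y) (r x y)) \<le> \<gamma> * (p x y + r x y)" for x y
  proof -
    have "(\<lambda>y. c * T \<phi> y) = (\<lambda>y. T (\<lambda>z. of_real (u z)) y + \<i> * T (\<lambda>z. of_real (v z)) y)"
      by (simp only: transfer_scale[symmetric] c\<phi> transfer_add[symmetric])
    then have "c * func x y (T \<phi>) = func x y (T (\<lambda>z. of_real (u z))) + \<i> * func x y (T (\<lambda>z. of_real (v z)))"
      by (simp only: func_scale[symmetric] func_add[symmetric])
    then have "\<omega> * func x y (T \<phi>)
        = cis (- m) * (func x y (T (\<lambda>z. of_real (u z))) + \<i> * func x y (T (\<lambda>z. of_real (v z))))"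
      by (simp only: \<omega>_def mult.assoc)
    then have "\<omega> * func x y (T \<phi>) - Complex (p x y) (r x y)
        = (cis (- m) * func x y (T (\<lambda>z. of_real (u z))) - of_real (p x y))
          + \<i> * (cis (- m) * func x y (T (\<lambda>z. of_real (v z))) - of_real (r x y))"
      by (simp add: Complex_eq algebra_simps)
    also have "norm \<dots> \<le> \<gamma> * p x y + \<gamma> * r x y"
      unfolding p_def r_def
      using transfer_perturbation[OF u, of x y] transfer_perturbation[OF v, of x y]
      by (intro norm_triangle_le add_mono) (auto simp: norm_mult)
    finally show ?thesis by (simp add: distrib_left)
  qed
  have "\<gamma> \<le> 1" using gamma_E gamma_nonneg mult_left_mono[OF E_ge, of "2 * \<gamma>"] by linarith
  \<comment> \<open>The perturbation at most doubles the upper bound \<open>E * W\<close>. The lower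
    bound \<open>(W / E)\<^sup>2 / (2 * E)\<close> for products, divided by
    \<open>s\<^sup>2\<close>, gives the constant \<open>1 / (8 * E ^ 5)\<close>.\<close>
  define s where "s = 2 * (E * W)"
  have "norm (func x y (T \<phi>)) \<le> s" for x y
  proof -
    have "norm (func x y (T \<phi>)) = norm (Complex (p x y) (r x y) + (\<omega> * func x y (T \<phi>) - Complex (p x y) (r x y)))"
      using \<omega> by (simp add: norm_mult)
    also have "\<dots> \<le> (p x y + r x y) + \<gamma> * (p x y + r x y)"
      using cmod_le[of "Complex (p x y) (r x y)"] prnn[of x y]
      by (intro norm_triangle_le add_mono near) auto
    also have "\<dots> \<le> (p x y + r x y) + 1 * (p x y + r x y)"
      using prnn[of x y] \<open>\<gamma> \<le> 1\<close> by (intro add_left_mono mult_right_mono) auto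
    also have "\<dots> \<le> s" using upper[of x y] by (simp add: s_def pr)
    finally show ?thesis .
  qed
  moreover have "1 / (8 * E ^ 5) * s\<^sup>2 \<le> Re (func x y (T \<phi>) * cnj (func x' y' (T \<phi>)))" for x y x' y'
  proof -
    have "1 / (8 * E ^ 5) * s\<^sup>2 = (W / E) * (W / E) / (2 * E)"
      using E by (simp add: s_def field_simps eval_nat_numeral)
    also have "\<dots> \<le> (p x y + r x y) * (p x' y' + r x' y') / (2 * E)"
      using lower[of x y] lower[of x' y'] W E prnn unfolding pr
      by (intro divide_right_mono mult_mono) auto
    also have "\<dots> \<le> Re ((\<omega> * func x y (T \<phi>)) * cnj (\<omega> * func x' y' (T \<phi>)))"
    proof (rule Re_mult_cnj_perturbed[OF prnn prnn _ _ near near E_ge gamma_nonneg gamma_E])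
      show "p x y * r x' y' \<le> E\<^sup>2 * (r x y * p x' y')" "r x y * p x' y' \<le> E\<^sup>2 * (p x y * r x' y')"
        unfolding p_def r_def by (intro cross_ratio L_cone u v)+
    qed
    also have "\<dots> = Re (func x y (T \<phi>) * cnj (func x' y' (T \<phi>)))"
      unfolding Re_mult_cnj_scale \<omega> by simp
    finally show ?thesis .
  qed
  moreover have "0 < s" using E W by (simp add: s_def)
  ultimately show ?thesis by blast
qed

section \<open>The transfer operator as a bounded operator on Lipschitz functions\<close>

lemma transfer_lip_bound:
  obtains K where "0 \<le> K" "\<And>\<phi> y. norm (T (apply_lip \<phi>) y) \<le> K * norm \<phi>"
    "\<And>\<phi> y y'. norm (T (apply_lip \<phi>) y - T (apply_lip \<phi>) y') \<le> K * norm \<phi> * dist y y'"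
proof -
  define G where "G = norm g"
  define K where "K = card J * (exp G * (1 + G))"
  have G: "0 \<le> G" by (simp add: G_def)
  have ge: "norm (exp (apply_lip g x)) \<le> exp G" for x
    using norm_apply_lip_le[of g x] abs_Re_le_cmod[of "apply_lip g x"] by (simp add: G_def abs_le_iff)
  have "0 \<le> K" using G by (simp add: K_def)
  moreover have "norm (T (apply_lip \<phi>) y) \<le> K * norm \<phi>" for \<phi> y
  proof -
    obtain x where x: "\<And>k :: 'a \<Rightarrow> complex. sum k (preimages U f y) = (\<Sum>j\<in>J. k (x j))"
      using paired_sums[of y y] by metis
    have "norm (exp (apply_lip g (x j)) * apply_lip \<phi> (x j)) \<le> exp G * (1 + G) * norm \<phi>" for j
    proof -
      have "norm (exp (apply_lip g (x j)) * apply_lip \<phi> (x j)) \<le> exp G * norm \<phi>"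
        unfolding norm_mult by (intro mult_mono ge norm_apply_lip_le) auto
      also have "\<dots> \<le> exp G * (1 + G) * norm \<phi>" using G by (intro mult_right_mono) auto
      finally show ?thesis .
    qed
    then show ?thesis
      unfolding transfer_def x K_def by (intro order_trans[OF norm_sum] order_trans[OF sum_bounded_above]) auto
  qed
  moreover have "norm (T (apply_lip \<phi>) y - T (apply_lip \<phi>) y') \<le> K * norm \<phi> * dist y y'" for \<phi> y y'
  proof -
    obtain x x' where x: "\<And>j. j \<in> J \<Longrightarrow> dist (x j) (x' j) \<le> \<rho> * dist y y'"
      and sums: "\<And>k :: 'a \<Rightarrow> complex. sum k (preimages U f y) = (\<Sum>j\<in>J. k (x j))"
        "\<And>k :: 'a \<Rightarrow> complex. sum k (preimages U f y') = (\<Sum>j\<in>J. k (x' j))"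
      using paired_sums[of y y'] by metis
    have "norm (exp (apply_lip g (x j)) * apply_lip \<phi> (x j) - exp (apply_lip g (x' j)) * apply_lip \<phi> (x' j))
        \<le> exp G * (1 + G) * norm \<phi> * dist y y'" if j: "j \<in> J" for j
    proof -
      have d: "dist (x j) (x' j) \<le> dist y y'"
        using x[OF j] \<rho> mult_left_le_one_le[of "dist y y'" \<rho>] by simp
      have eq: "exp (apply_lip g (x j)) * apply_lip \<phi> (x j) - exp (apply_lip g (x' j)) * apply_lip \<phi> (x' j)
          = exp (apply_lip g (x j)) * (apply_lip \<phi> (x j) - apply_lip \<phi> (x' j))
            + (exp (apply_lip g (x j)) - exp (apply_lip g (x' j))) * apply_lip \<phi> (x' j)"
        by (simp add: algebra_simps)
      have 1: "norm (apply_lip \<phi> (x j) - apply_lip \<phi> (x' j)) \<le> norm \<phi> * dist y y'"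
        by (rule order_trans[OF apply_lip_diff_le mult_left_mono[OF d norm_ge_zero]])
      have "norm (exp (apply_lip g (x j)) - exp (apply_lip g (x' j))) \<le> exp G * norm (apply_lip g (x j) - apply_lip g (x' j))"
        unfolding G_def by (intro norm_exp_diff_le norm_apply_lip_le)
      also have "\<dots> \<le> exp G * (G * dist y y')"
        unfolding G_def by (intro mult_left_mono order_trans[OF apply_lip_diff_le mult_left_mono[OF d norm_ge_zero]]) auto
      finally have 2: "norm (exp (apply_lip g (x j)) - exp (apply_lip g (x' j))) \<le> exp G * (G * dist y y')" .
      have "norm (exp (apply_lip g (x j)) * apply_lip \<phi> (x j) - exp (apply_lip g (x' j)) * apply_lip \<phi> (x' j))
          \<le> exp G * (norm \<phi> * dist y y') + (exp G * (G * dist y y')) * norm \<phi>"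
        unfolding eq by (intro norm_triangle_le add_mono; simp only: norm_mult)
          (intro mult_mono ge 1 2 norm_apply_lip_le; use G in simp)+
      also have "\<dots> = exp G * (1 + G) * norm \<phi> * dist y y'" by (simp add: algebra_simps)
      finally show ?thesis .
    qed
    then show ?thesis
      unfolding transfer_def sums K_def sum_subtractf[symmetric]
      by (intro order_trans[OF norm_sum] order_trans[OF sum_bounded_above]) (auto simp: mult.assoc)
  qed
  ultimately show thesis by (rule that)
qed

lemma transfer_lip_fun:
  obtains M :: "'a lip_fun \<Rightarrow> 'a lip_fun"
  where "\<And>\<phi>. apply_lip (M \<phi>) = T (apply_lip \<phi>)" "bounded_clinear M"
proof -
  obtain K where K: "0 \<le> K" "\<And>\<phi> y. norm (T (apply_lip \<phi>) y) \<le> K * norm \<phi>"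
    "\<And>\<phi> y y'. norm (T (apply_lip \<phi>) y - T (apply_lip \<phi>) y') \<le> K * norm \<phi> * dist y y'"
    by (rule transfer_lip_bound) blast
  define M where "M \<phi> = Abs_lip (T (apply_lip \<phi>))" for \<phi>
  have nn: "0 \<le> K * norm \<phi>" for \<phi> :: "'a lip_fun" using K(1) by simp
  have M: "apply_lip (M \<phi>) = T (apply_lip \<phi>)" for \<phi>
    unfolding M_def by (rule apply_Abs_lip[OF K(2) nn K(3)])
  moreover have "bounded_clinear M"
  proof (rule bounded_clinearI)
    show "M (\<phi> + \<psi>) = M \<phi> + M \<psi>" for \<phi> \<psi>
      by (rule lip_fun_eqI) (simp add: M plus_lip_fun.rep_eq transfer_add)
    show "M (c *\<^sub>C \<phi>) = c *\<^sub>C M \<phi>" for c \<phi>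
      by (rule lip_fun_eqI) (simp add: M scaleC_lip_fun.rep_eq transfer_scale)
    show "norm (M \<phi>) \<le> (K + K) * norm \<phi>" for \<phi>
    proof -
      have "norm (M \<phi>) \<le> K * norm \<phi> + K * norm \<phi>"
        by (rule norm_lip_fun_le) (simp_all only: M K(2,3) nn)
      then show ?thesis by (simp add: distrib_right)
    qed
  qed
  ultimately show thesis by (rule that)
qed

text \<open>For distinct points numerator and denominator are both of order \<open>dist x y\<close>:
  the former is at most (\<sigma> exp(\<sigma> D) + 1) d times the norm, the latter at least
  (\<sigma> - \<tau>) d. The leading 1 covers \<open>x = y\<close>.\<close>

lemma func_bound:
  "norm (func x y (apply_lip \<phi>)) \<le> (1 + (\<sigma> * exp (\<sigma> * D) + 1) / (\<sigma> - \<tau>)) * norm \<phi>"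
proof (cases "x = y")
  case True
  have "1 * norm \<phi> \<le> (1 + (\<sigma> * exp (\<sigma> * D) + 1) / (\<sigma> - \<tau>)) * norm \<phi>"
    using tau_pos tau_less_sigma by (intro mult_right_mono) auto
  with norm_apply_lip_le[of \<phi> x] show ?thesis using True by (simp add: func_def)
next
  case False
  let ?d = "dist x y"
  define N where "N = exp (\<sigma> * ?d) - exp (\<tau> * ?d)"
  have s: "0 < \<sigma>" using tau_pos tau_less_sigma by simp
  have N: "0 < N" using denom_pos[OF False] by (simp add: N_def)
  have "1 * ((\<sigma> - \<tau>) * ?d) \<le> exp (\<tau> * ?d) * (exp ((\<sigma> - \<tau>) * ?d) - 1)"
  proof (rule mult_mono)
    show "(\<sigma> - \<tau>) * ?d \<le> exp ((\<sigma> - \<tau>) * ?d) - 1"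
      using exp_ge_add_one_self[of "(\<sigma> - \<tau>) * ?d"] by linarith
  qed (use tau_pos tau_less_sigma in auto)
  also have "\<dots> = N" by (simp add: N_def algebra_simps flip: exp_add)
  finally have Nd: "(\<sigma> - \<tau>) * ?d \<le> N" by simp
  have "exp (\<sigma> * ?d) - 1 \<le> \<sigma> * ?d * exp (\<sigma> * ?d)" by (rule exp_minus_one_le)
  also have "\<dots> \<le> \<sigma> * ?d * exp (\<sigma> * D)" using s dist_le[of x y] by (intro mult_left_mono) auto
  finally have e: "exp (\<sigma> * ?d) - 1 \<le> \<sigma> * ?d * exp (\<sigma> * D)" .
  have eq: "of_real (exp (\<sigma> * ?d)) * apply_lip \<phi> x - apply_lip \<phi> y
      = of_real (exp (\<sigma> * ?d) - 1) * apply_lip \<phi> x + (apply_lip \<phi> x - apply_lip \<phi> y)"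
    by (simp add: algebra_simps)
  have "norm (of_real (exp (\<sigma> * ?d)) * apply_lip \<phi> x - apply_lip \<phi> y)
      \<le> (\<sigma> * ?d * exp (\<sigma> * D)) * norm \<phi> + norm \<phi> * ?d"
    unfolding eq
  proof (intro norm_triangle_le add_mono apply_lip_diff_le)
    have "0 \<le> exp (\<sigma> * ?d) - 1" using s by simp
    then show "norm (of_real (exp (\<sigma> * ?d) - 1) * apply_lip \<phi> x) \<le> (\<sigma> * ?d * exp (\<sigma> * D)) * norm \<phi>"
      using e s unfolding norm_mult norm_of_real by (intro mult_mono norm_apply_lip_le) auto
  qed
  also have "\<dots> = (\<sigma> * exp (\<sigma> * D) + 1) / (\<sigma> - \<tau>) * norm \<phi> * ((\<sigma> - \<tau>) * ?d)"
    using tau_less_sigma by (simp add: field_simps)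
  also have "\<dots> \<le> (\<sigma> * exp (\<sigma> * D) + 1) / (\<sigma> - \<tau>) * norm \<phi> * N"
    using s tau_less_sigma by (intro mult_left_mono Nd) auto
  finally have "norm (func x y (apply_lip \<phi>)) \<le> (\<sigma> * exp (\<sigma> * D) + 1) / (\<sigma> - \<tau>) * norm \<phi>"
    using False N unfolding func_def N_def[symmetric]
    by (simp add: norm_divide pos_divide_le_eq)
  then show ?thesis unfolding distrib_right mult_1 by (rule add_increasing[OF norm_ge_zero])
qed

text \<open>The diagonal functionals bound the supremum. For the Lipschitz constant, \<phi> x -
  \<phi> y is the numerator of \<open>func x y\<close> minus (exp(\<sigma> d) - 1) \<phi> x, and
  both parts are of order d.\<close>

lemma func_norming:
  assumes R: "\<And>x y. norm (func x y (apply_lip \<phi>)) \<le> R"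
  shows "norm \<phi> \<le> (1 + 2 * \<sigma> * exp (\<sigma> * D)) * R"
proof -
  have s: "0 < \<sigma>" using tau_pos tau_less_sigma by simp
  have pt: "norm (apply_lip \<phi> x) \<le> R" for x using R[of x x] by (simp add: func_def)
  have R0: "0 \<le> R" using order_trans[OF norm_ge_zero pt] .
  have "norm (apply_lip \<phi> x - apply_lip \<phi> y) \<le> (2 * \<sigma> * exp (\<sigma> * D) * R) * dist x y" for x y
  proof (cases "x = y")
    case False
    let ?d = "dist x y"
    define N where "N = exp (\<sigma> * ?d) - exp (\<tau> * ?d)"
    have N: "0 < N" using denom_pos[OF False] by (simp add: N_def)
    have 1: "norm (of_real (exp (\<sigma> * ?d)) * apply_lip \<phi> x - apply_lip \<phi> y) \<le> R * N"
      using R[of x y] False N unfolding func_def N_def[symmetric]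
      by (simp add: norm_divide pos_divide_le_eq)
    have 2: "norm (of_real (exp (\<sigma> * ?d) - 1) * apply_lip \<phi> x) \<le> (exp (\<sigma> * ?d) - 1) * R"
      using s pt[of x] unfolding norm_mult norm_of_real by (intro mult_mono) auto
    have "apply_lip \<phi> x - apply_lip \<phi> y = (of_real (exp (\<sigma> * ?d)) * apply_lip \<phi> x - apply_lip \<phi> y)
        - of_real (exp (\<sigma> * ?d) - 1) * apply_lip \<phi> x"
      by (simp add: algebra_simps)
    then have "norm (apply_lip \<phi> x - apply_lip \<phi> y) \<le> R * N + (exp (\<sigma> * ?d) - 1) * R"
      using order_trans[OF norm_triangle_ineq4 add_mono[OF 1 2]] by (simp only:)
    also have "\<dots> \<le> R * (exp (\<sigma> * ?d) - 1) + (exp (\<sigma> * ?d) - 1) * R"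
      using R0 tau_pos s by (intro add_mono mult_left_mono) (auto simp: N_def)
    also have "\<dots> = 2 * R * (exp (\<sigma> * ?d) - 1)" by simp
    also have "\<dots> \<le> 2 * R * (\<sigma> * ?d * exp (\<sigma> * D))"
    proof (rule mult_left_mono)
      have "exp (\<sigma> * ?d) - 1 \<le> \<sigma> * ?d * exp (\<sigma> * ?d)" by (rule exp_minus_one_le)
      also have "\<dots> \<le> \<sigma> * ?d * exp (\<sigma> * D)" using s dist_le[of x y] by (intro mult_left_mono) auto
      finally show "exp (\<sigma> * ?d) - 1 \<le> \<sigma> * ?d * exp (\<sigma> * D)" .
    qed (use R0 in simp)
    finally show ?thesis by (simp add: mult_ac)
  qed simp
  then have "norm \<phi> \<le> R + 2 * \<sigma> * exp (\<sigma> * D) * R"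
    using s R0 by (intro norm_lip_fun_le pt) auto
  then show ?thesis by (simp add: distrib_right)
qed

lemma transfer_spectral_gap:
  assumes M: "\<And>\<phi>. apply_lip (M \<phi>) = T (apply_lip \<phi>)" "bounded_clinear M"
  shows "has_spectral_gap M"
proof -
  define F :: "('a lip_fun \<Rightarrow> complex) set" where "F = range (\<lambda>(x, y) \<phi>. func x y (apply_lip \<phi>))"
  define B1 B2 where "B1 = 1 + (\<sigma> * exp (\<sigma> * D) + 1) / (\<sigma> - \<tau>)" and "B2 = 1 + 2 * \<sigma> * exp (\<sigma> * D)"
  have B1: "0 < B1" and B2: "0 < B2"
    using tau_pos tau_less_sigma by (auto simp: B1_def B2_def intro!: add_pos_nonneg)
  have F_iff: "l \<in> F \<longleftrightarrow> (\<exists>x y. l = (\<lambda>\<phi>. func x y (apply_lip \<phi>)))" for l by (auto simp: F_def)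
  \<comment> \<open>One constant has to serve for \<open>F_bound\<close> and for
    \<open>F_norming\<close>, hence the sum; the last argument is the depth found in
    \<open>transfer_deep\<close>.\<close>
  interpret complex_cone_contraction F M "B1 + B2" "1 / (8 * E ^ 5)"
  proof
    show "bounded_clinear M" by fact
    show "F \<noteq> {}" by (simp add: F_def)
    show "l (\<phi> + \<psi>) = l \<phi> + l \<psi>" if "l \<in> F" for l \<phi> \<psi>
      using that by (auto simp: F_iff plus_lip_fun.rep_eq func_add)
    show "l (c *\<^sub>C \<phi>) = c * l \<phi>" if "l \<in> F" for l c \<phi>
      using that by (auto simp: F_iff scaleC_lip_fun.rep_eq func_scale)
    show "norm (l \<phi>) \<le> (B1 + B2) * norm \<phi>" if "l \<in> F" for l \<phi>
    proof -
      have "norm (l \<phi>) \<le> B1 * norm \<phi>" using that func_bound by (auto simp: F_iff B1_def)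
      also have "\<dots> \<le> (B1 + B2) * norm \<phi>" using B2 by (intro mult_right_mono) auto
      finally show ?thesis .
    qed
    show "norm \<phi> \<le> (B1 + B2) * R" if "\<And>l. l \<in> F \<Longrightarrow> norm (l \<phi>) \<le> R" for \<phi> R
    proof -
      have R: "norm (func x y (apply_lip \<phi>)) \<le> R" for x y using that by (auto simp: F_iff)
      have "norm \<phi> \<le> B2 * R" unfolding B2_def by (rule func_norming[OF R])
      also have "\<dots> \<le> (B1 + B2) * R"
        using B1 order_trans[OF norm_ge_zero R] by (intro mult_right_mono) auto
      finally show ?thesis .
    qed
    show "0 < B1 + B2" using B1 B2 by simp
    show "0 < 1 / (8 * E ^ 5)" using E_ge by simp
    show "\<exists>s. deep_in_cone F (1 / (8 * E ^ 5)) s (M \<phi>)" if \<phi>: "\<phi> \<in> complex_cone F" "\<phi> \<noteq> 0" for \<phi>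
    proof -
      have "0 \<le> Re (func x y (apply_lip \<phi>) * cnj (func x' y' (apply_lip \<phi>)))" for x y x' y'
      proof -
        have "(\<lambda>\<phi>. func x y (apply_lip \<phi>)) \<in> F" "(\<lambda>\<phi>. func x' y' (apply_lip \<phi>)) \<in> F"
          unfolding F_iff by blast+
        moreover have "\<forall>l\<in>F. \<forall>m\<in>F. 0 \<le> Re (l \<phi> * cnj (m \<phi>))"
          using \<phi>(1) by (simp only: complex_cone_def mem_Collect_eq)
        ultimately show ?thesis by (metis (no_types, lifting))
      qed
      moreover obtain z0 where "apply_lip \<phi> z0 \<noteq> 0"
        using \<phi>(2) lip_fun_eqI[of \<phi> 0] by (auto simp: zero_lip_fun.rep_eq)
      ultimately have "\<exists>s>0. (\<forall>x y. norm (func x y (T (apply_lip \<phi>))) \<le> s) \<and>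
        (\<forall>x y x' y'. 1 / (8 * E ^ 5) * s\<^sup>2 \<le> Re (func x y (T (apply_lip \<phi>)) * cnj (func x' y' (T (apply_lip \<phi>)))))"
        by (rule transfer_deep)
      then obtain s where "0 < s" "\<And>x y. norm (func x y (T (apply_lip \<phi>))) \<le> s"
        "\<And>x y x' y'. 1 / (8 * E ^ 5) * s\<^sup>2 \<le> Re (func x y (T (apply_lip \<phi>)) * cnj (func x' y' (T (apply_lip \<phi>))))"
        by blast
      then show ?thesis
        by (intro exI[of _ s]) (auto simp: deep_in_cone_def F_iff M(1) simp del: times_complex.sel complex_cnj_mult)
    qed
    show "\<exists>\<phi>\<in>complex_cone F. \<phi> \<noteq> 0"
    proof -
      \<comment> \<open>Constants belong to the \<open>\<tau>\<close> cone, so all functionals are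
        real and nonnegative on the function 1.\<close>
      have one: "apply_lip (Abs_lip (\<lambda>_::'a. 1)) = (\<lambda>_. 1)" by (rule apply_Abs_lip[of _ 1 0]) auto
      have "func x y (\<lambda>_. 1) = complex_of_real (func x y (\<lambda>_. 1))" for x y by (simp add: func_def)
      moreover have "0 \<le> func x y (\<lambda>_. 1 :: real)" for x y
        using tau_pos by (intro func_nonneg) (simp add: real_cone_def)
      ultimately have "Abs_lip (\<lambda>_. 1) \<in> complex_cone F"
        by (auto simp: complex_cone_def F_iff one)
      moreover have "Abs_lip (\<lambda>_::'a. 1) \<noteq> 0"
        using one by (metis zero_lip_fun.rep_eq zero_neq_one)
      ultimately show ?thesis by blast
    qed
  qed
  show ?thesis by (rule spectral_gap)
qed

end

section \<open>Reduction of the theorem to the estimates for expanding transfer operators\<close>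

theorem theorem9p1:
  fixes U :: "'a::metric_space set" and f :: "'a \<Rightarrow> 'a" and J :: "'j set"
    and g :: "'a lip_fun" and \<rho> D a b \<theta> :: real
  assumes "bounded (UNIV :: 'a set)" and "D = diameter (UNIV :: 'a set)"
    and "finite_degree_covering U f"
    and "0 < \<rho>" and "\<rho> < 1"
    and "finite J" and "expanding_pairing U f J \<rho>"
    and "a = Lip (\<lambda>x. Re (apply_lip g x))"
    and "b = Lip (\<lambda>x. Im (apply_lip g x))"
    and "\<theta> = osc (\<lambda>x. Im (apply_lip g x))"
    and "(\<theta> + 2 * \<rho>\<^sup>2 * D * b / (1 - \<rho> + \<rho>\<^sup>2 * D * a))
           * exp (1 + \<rho> * ((1 + \<rho>) / (1 - \<rho>)) * D * a) * (4 / (1 - \<rho>)) < 1"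
  shows "\<exists>M :: 'a lip_fun \<Rightarrow> 'a lip_fun.
           (\<forall>\<phi> y. apply_lip (M \<phi>) y = transfer U f (apply_lip g) (apply_lip \<phi>) y) \<and>
           bounded_clinear M \<and> has_spectral_gap M"
proof -
  have dist: "dist x y \<le> D" for x y :: 'a
    using diameter_bounded_bound[OF assms(1)] assms(2) by auto
  have D: "0 \<le> D" using order_trans[OF zero_le_dist dist] .
  \<comment> \<open>Surjectivity of the covering excludes an empty index set, for which the operator
    would be 0.\<close>
  have "f ` U = UNIV" using assms(3) by (auto simp: finite_degree_covering_def covering_space_def)
  then obtain x0 where "x0 \<in> U" by auto
  then have "preimages U f (f x0) \<noteq> {}" by (auto simp: preimages_def)
  then have J: "J \<noteq> {}" using assms(7) unfolding expanding_pairing_def by (metis bij_betw_empty1)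
  \<comment> \<open>\<open>Lip\<close> is a supremum in the reals and bounds the quotients only once
    they are known to be bounded, here by \<open>norm g\<close>.\<close>
  have Lip: "\<bar>k x - k y\<bar> \<le> Lip k * dist x y \<and> 0 \<le> Lip k"
    if k: "\<And>x y. \<bar>k x - k y\<bar> \<le> norm (apply_lip g x - apply_lip g y)" for k :: "'a \<Rightarrow> real" and x y
  proof -
    have "norm (k x - k y) \<le> norm g * dist x y" for x y
      using k[of x y] apply_lip_diff_le[of g x y] by simp
    then have "lip_quot k p \<le> norm g" for p by (intro lip_quot_le) auto
    then have "bdd_above (range (lip_quot k))" by (intro bdd_aboveI2)
    then have le: "lip_quot k p \<le> Lip k" for p unfolding Lip_def by (rule cSUP_upper[OF UNIV_I])
    have "\<bar>k x - k y\<bar> \<le> Lip k * dist x y"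
      using le[of "(x, y)"] by (cases "x = y") (auto simp: lip_quot_def pos_divide_le_eq)
    then show ?thesis using order_trans[OF lip_quot_nonneg le] by blast
  qed
  have Re: "\<bar>Re (apply_lip g x) - Re (apply_lip g y)\<bar> \<le> a * dist x y \<and> 0 \<le> a" for x y
    unfolding assms(8) by (rule Lip) (metis abs_Re_le_cmod minus_complex.sel(1))
  have Im: "\<bar>Im (apply_lip g x) - Im (apply_lip g y)\<bar> \<le> b * dist x y \<and> 0 \<le> b" for x y
    unfolding assms(9) by (rule Lip) (metis abs_Im_le_cmod minus_complex.sel(2))
  define k where "k x = Im (apply_lip g x)" for x
  \<comment> \<open>The midpoint of the range of the imaginary part, at distance at most half the
    oscillation from each value.\<close>
  define m where "m = ((SUP x. k x) + (INF x. k x)) / 2"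
  have "\<bar>k x\<bar> \<le> norm g" for x
    using order_trans[OF abs_Im_le_cmod norm_apply_lip_le] by (simp add: k_def)
  then have bdd: "bdd_above (range k)" "bdd_below (range k)"
    by (auto intro!: bdd_aboveI2[of _ _ "norm g"] bdd_belowI2[of _ "- norm g"] simp: abs_le_iff minus_le_iff)
  have center: "\<bar>Im (apply_lip g x) - m\<bar> \<le> \<theta> / 2" for x
  proof -
    have "k x \<le> (SUP x. k x)" "(INF x. k x) \<le> k x"
      using bdd by (auto intro: cSUP_upper cINF_lower)
    moreover have "\<theta> = (SUP x. k x) - (INF x. k x)" unfolding assms(10) osc_def k_def ..
    ultimately have "\<bar>k x - m\<bar> \<le> \<theta> / 2" unfolding m_def abs_le_iff by (simp add: field_simps)
    then show ?thesis by (simp add: k_def)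
  qed
  have "\<exists>D a b. expanding_transfer U f J g \<rho> D a b \<theta> m"
  proof (cases "D = 0")
    \<comment> \<open>On a one-point space every diameter bound is admissible; \<open>\<sigma>\<close> needs a positive one.\<close>
    case True
    then have "dist x y = 0" for x y :: 'a using dist[of x y] by simp
    then have one_point: "x = y" for x y :: 'a by simp
    have "expanding_transfer U f J g \<rho> 1 0 0 \<theta> m"
    proof
      show "Re (apply_lip g x) \<le> Re (apply_lip g y) + 0 * dist x y" for x y using one_point[of x y] by simp
      show "\<bar>Im (apply_lip g x) - Im (apply_lip g y)\<bar> \<le> 0 * dist x y" for x y using one_point[of x y] by simp
      show "dist x y \<le> 1" for x y :: 'a using one_point[of x y] by simp
      show "(\<theta> + 2 * \<rho>\<^sup>2 * 1 * 0 / (1 - \<rho> + \<rho>\<^sup>2 * 1 * 0))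
           * exp (1 + \<rho> * ((1 + \<rho>) / (1 - \<rho>)) * 1 * 0) * (4 / (1 - \<rho>)) < 1"
        using assms(11) True by simp
    qed (use assms J center in auto)
    then show ?thesis by blast
  next
    case False
    have "expanding_transfer U f J g \<rho> D a b \<theta> m"
    proof
      show "Re (apply_lip g x) \<le> Re (apply_lip g y) + a * dist x y" for x y using Re[of x y] by linarith
      show "\<bar>Im (apply_lip g x) - Im (apply_lip g y)\<bar> \<le> b * dist x y" for x y using Im[of x y] by blast
      show "0 < D" using D False by simp
      show "0 \<le> a" "0 \<le> b" using Re Im by blast+
      show "dist x y \<le> D" for x y :: 'a by (rule dist)
      show "\<bar>Im (apply_lip g x) - m\<bar> \<le> \<theta> / 2" for x by (rule center)
    qed (use assms(4-7) J assms(11) in auto)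
    then show ?thesis by blast
  qed
  then obtain D a b where "expanding_transfer U f J g \<rho> D a b \<theta> m" by blast
  then interpret expanding_transfer U f J g \<rho> D a b \<theta> m .
  obtain M :: "'a lip_fun \<Rightarrow> 'a lip_fun" where M: "\<And>\<phi>. apply_lip (M \<phi>) = T (apply_lip \<phi>)" "bounded_clinear M"
    by (rule transfer_lip_fun) blast
  with transfer_spectral_gap[OF M] show ?thesis by (intro exI[of _ M]) simp
qed

end
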